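(* Let $n\ge 2$ and let $\mathcal{PS}(F_n)\subset\mathcal X(F_n)$ be the set of conjugacy classes of primitive-stable representations $F_n\to\mathrm{PSL}_2(\mathbb C)$. The action of $\mathrm{Out}(F_n)$ on $\mathcal{PS}(F_n)$ is properly discontinuous.
   Context: $F_n$ is the free group on $n$ generators. $\mathcal X(F_n)=\mathrm{Hom}(F_n,\mathrm{PSL}_2(\mathbb C))/\!/\mathrm{PSL}_2(\mathbb C)$ is the geometric-invariant-theory quotient by conjugation, with its classical topology (it agrees with the topological quotient away from representations whose image fixes a point of $\hat{\mathbb C}$). $\mathrm{Out}(F_n)$ acts by precomposition. Fix a free generating set $X=\{x_1,\dots,x_n\}$ of $F_n$. Let $\widetilde\Gamma$ be the Cayley graph of $F_n$ with respect to $X$, a tree with edges of length 1. An element of $F_n$ is primitive if it is a member of some free generating set. For a conjugacy class $[w]$ of a primitive element, the axes in $\widetilde\Gamma$ of the elements of $[w]$ form an $F_n$-invariant family of bi-infinite geodesics (equivalently, the lifts of the periodic bi-infinite word obtained by concatenating infinitely many copies of a cyclically reduced representative of $w$); these are called primitive leaves. Given $\rho:F_n\to\mathrm{PSL}_2(\mathbb C)=\mathrm{Isom}_+(\mathbb H^3)$ and $x\in\mathbb H^3$, let $\tau_{\rho,x}:\widetilde\Gamma\to\mathbb H^3$ be the unique $\rho$-equivariant map sending the origin (identity vertex) to $x$ and each edge to a geodesic segment. $\rho$ is primitive-stable if there are constants $K,\delta$ and a basepoint $x\in\mathbb H^3$ such that $\tau_{\rho,x}$ maps every primitive leaf to a $(K,\delta)$-quasi-geodesic,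 i.e. $\frac1K d_{\widetilde\Gamma}(s,t)-\delta\le d_{\mathbb H^3}(\tau_{\rho,x}(s),\tau_{\rho,x}(t))\le K d_{\widetilde\Gamma}(s,t)+\delta$ for all $s,t$ on the leaf. This property is invariant under conjugation of $\rho$ and under $\mathrm{Out}(F_n)$. The action is properly discontinuous if for each compact $C\subset\mathcal{PS}(F_n)$ the set $\{\psi\in\mathrm{Out}(F_n):\psi(C)\cap C\ne\emptyset\}$ is finite. *)

theory Defs
  imports "HOL-Analysis.Analysis" "HOL-Algebra.Coset" "HOL-Algebra.Bij"
begin

section \<open>Free groups\<close>

text \<open>The letter \<open>(x, True)\<close> stands for the generator \<open>x\<close>, and \<open>(x, False)\<close> for its inverse.
  Group elements are the freely reduced words.\<close>

type_synonym 'a word = "('a \<times> bool) list"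

fun push :: "'a \<times> bool \<Rightarrow> 'a word \<Rightarrow> 'a word" where
  "push a [] = [a]"
| "push a (b # w) = (if fst b = fst a \<and> snd b \<noteq> snd a then w else a # b # w)"

definition reduced :: "'a word \<Rightarrow> bool" where
  "reduced w \<longleftrightarrow> successively (\<lambda>a b. \<not> (fst b = fst a \<and> snd b \<noteq> snd a)) w"

definition free_group :: "'a set \<Rightarrow> 'a word monoid" where
  "free_group X =
     \<lparr>carrier = {w. reduced w \<and> fst ` set w \<subseteq> X}, mult = (\<lambda>u v. foldr push u v), one = []\<rparr>"

abbreviation Fn :: "nat \<Rightarrow> nat word monoid" where
  "Fn n \<equiv> free_group {..<n}"

definition gen :: "nat \<Rightarrow> nat word" where
  "gen i = [(i, True)]"

definition eval_word :: "('g, 'm) monoid_scheme \<Rightarrow> 'g word \<Rightarrow> 'g" where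
  "eval_word G w = foldr (\<lambda>(b, s) g. (if s then b else inv\<^bsub>G\<^esub> b) \<otimes>\<^bsub>G\<^esub> g) w \<one>\<^bsub>G\<^esub>"

definition free_generating_set :: "('g, 'm) monoid_scheme \<Rightarrow> 'g set \<Rightarrow> bool" where
  "free_generating_set G B \<longleftrightarrow> B \<subseteq> carrier G \<and> eval_word G \<in> iso (free_group B) G"

definition primitive :: "('g, 'm) monoid_scheme \<Rightarrow> 'g \<Rightarrow> bool" where
  "primitive G w \<longleftrightarrow> (\<exists>B. free_generating_set G B \<and> w \<in> B)"

definition inner_aut :: "('g, 'm) monoid_scheme \<Rightarrow> 'g \<Rightarrow> 'g \<Rightarrow> 'g" where
  "inner_aut G g = (\<lambda>x\<in>carrier G. g \<otimes>\<^bsub>G\<^esub> x \<otimes>\<^bsub>G\<^esub> inv\<^bsub>G\<^esub> g)"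

definition Out :: "('g, 'm) monoid_scheme \<Rightarrow> ('g \<Rightarrow> 'g) set monoid" where
  "Out G = AutoGroup G Mod (inner_aut G ` carrier G)"


section \<open>The group PSL(2,C) and hyperbolic 3-space\<close>

definition SL2 :: "(complex^2^2) monoid" where
  "SL2 = \<lparr>carrier = {A. det A = 1}, mult = (**), one = mat 1\<rparr>"

definition PSL2 :: "(complex^2^2) set monoid" where
  "PSL2 = SL2 Mod {mat 1, - mat 1}"

text \<open>An element of PSL(2,C) is a coset \<open>{A, -A}\<close>. The constructions below that pick an element of
  it do not depend on the choice, since they only involve even expressions in the entries.\<close>

definition psl_rep :: "(complex^2^2) set \<Rightarrow> complex^2^2" where
  "psl_rep P = (SOME A. A \<in> P)"

text \<open>Upper half-space model, with the Poincare extension of Moebius transformations.\<close>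

definition H3 :: "(complex \<times> real) set" where
  "H3 = {p. snd p > 0}"

definition H3_dist :: "complex \<times> real \<Rightarrow> complex \<times> real \<Rightarrow> real" where
  "H3_dist p q =
     arcosh (1 + ((cmod (fst p - fst q))\<^sup>2 + (snd p - snd q)\<^sup>2) / (2 * snd p * snd q))"

definition H3_act :: "(complex^2^2) set \<Rightarrow> complex \<times> real \<Rightarrow> complex \<times> real" where
  "H3_act P = (\<lambda>(z, t).
     let A = psl_rep P; a = A$1$1; b = A$1$2; c = A$2$1; d = A$2$2;
         N = (cmod (c * z + d))\<^sup>2 + (cmod c)\<^sup>2 * t\<^sup>2
     in (((a * z + b) * cnj (c * z + d) + a * cnj c * of_real (t\<^sup>2)) / of_real N, t / N))"


section \<open>The character variety\<close>

definition Rep :: "nat \<Rightarrow> (nat word \<Rightarrow> (complex^2^2) set) set" where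
  "Rep n = hom (Fn n) PSL2 \<inter> extensional (carrier (Fn n))"

definition conj_rep ::
  "nat \<Rightarrow> (complex^2^2) set \<Rightarrow> (nat word \<Rightarrow> (complex^2^2) set) \<Rightarrow> nat word \<Rightarrow> (complex^2^2) set" where
  "conj_rep n P \<rho> = (\<lambda>g\<in>carrier (Fn n). P \<otimes>\<^bsub>PSL2\<^esub> \<rho> g \<otimes>\<^bsub>PSL2\<^esub> inv\<^bsub>PSL2\<^esub> P)"

text \<open>The coordinate ring of \<open>Rep n\<close>. The regular functions on the affine variety PSL(2,C) are the
  polynomials in the entries of \<open>A \<in> SL2\<close> that are even in \<open>A\<close>, and these are generated by the
  products of two entries. Evaluation at the generators identifies \<open>Rep n\<close> with the \<open>n\<close>-th power
  of PSL(2,C); allowing all \<open>g\<close> in \<open>coord\<close> instead of only the generators yields the same ring,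
  because multiplication and inversion are regular.\<close>

inductive_set regular :: "nat \<Rightarrow> ((nat word \<Rightarrow> (complex^2^2) set) \<Rightarrow> complex) set" for n where
  const: "(\<lambda>\<rho>\<in>Rep n. c) \<in> regular n"
| coord: "g \<in> carrier (Fn n) \<Longrightarrow>
    (\<lambda>\<rho>\<in>Rep n. psl_rep (\<rho> g) $ i $ j * psl_rep (\<rho> g) $ k $ l) \<in> regular n"
| add: "f \<in> regular n \<Longrightarrow> h \<in> regular n \<Longrightarrow> (\<lambda>\<rho>\<in>Rep n. f \<rho> + h \<rho>) \<in> regular n"
| mult: "f \<in> regular n \<Longrightarrow> h \<in> regular n \<Longrightarrow> (\<lambda>\<rho>\<in>Rep n. f \<rho> * h \<rho>) \<in> regular n"

definition invariants :: "nat \<Rightarrow> ((nat word \<Rightarrow> (complex^2^2) set) \<Rightarrow> complex) set" where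
  "invariants n = {f \<in> regular n. \<forall>P\<in>carrier PSL2. \<forall>\<rho>\<in>Rep n. f (conj_rep n P \<rho>) = f \<rho>}"

text \<open>The points of the GIT quotient are the closed points of the spectrum of the ring of invariants,
  that is, its unital homomorphisms of complex algebras into the complex numbers.\<close>

definition char_points :: "nat \<Rightarrow> (((nat word \<Rightarrow> (complex^2^2) set) \<Rightarrow> complex) \<Rightarrow> complex) set" where
  "char_points n = {\<xi> \<in> extensional (invariants n).
     (\<forall>c. \<xi> (\<lambda>\<rho>\<in>Rep n. c) = c) \<and>
     (\<forall>f\<in>invariants n. \<forall>h\<in>invariants n.
        \<xi> (\<lambda>\<rho>\<in>Rep n. f \<rho> + h \<rho>) = \<xi> f + \<xi> h \<and>
        \<xi> (\<lambda>\<rho>\<in>Rep n. f \<rho> * h \<rho>) = \<xi> f * \<xi> h)}"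

text \<open>The classical topology is the coarsest one for which all regular functions on the quotient
  (evaluations at invariants) are continuous. It is the Euclidean subspace topology for any
  closed embedding into an affine space given by finitely many generators of the invariants.\<close>

definition char_variety ::
  "nat \<Rightarrow> (((nat word \<Rightarrow> (complex^2^2) set) \<Rightarrow> complex) \<Rightarrow> complex) topology" where
  "char_variety n = subtopology (product_topology (\<lambda>_. euclidean) (invariants n)) (char_points n)"

definition char_of ::
  "nat \<Rightarrow> (nat word \<Rightarrow> (complex^2^2) set) \<Rightarrow> ((nat word \<Rightarrow> (complex^2^2) set) \<Rightarrow> complex) \<Rightarrow> complex" where
  "char_of n \<rho> = (\<lambda>f\<in>invariants n. f \<rho>)"

text \<open>The left action of Out on the quotient induced by \<open>\<phi> \<cdot> \<rho> = \<rho> \<circ> \<phi>\<^sup>-\<^sup>1\<close>. Inner automorphisms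
  act on \<open>Rep n\<close> by conjugations, so the choice of \<open>\<phi> \<in> \<psi>\<close> is irrelevant; see
  \<open>Out_act_char_of\<close> below.\<close>

definition precomp ::
  "nat \<Rightarrow> (nat word \<Rightarrow> nat word) \<Rightarrow> ((nat word \<Rightarrow> (complex^2^2) set) \<Rightarrow> complex) \<Rightarrow>
   (nat word \<Rightarrow> (complex^2^2) set) \<Rightarrow> complex" where
  "precomp n \<phi> f = (\<lambda>\<rho>\<in>Rep n. f (compose (carrier (Fn n)) \<rho> \<phi>))"

definition Out_act ::
  "nat \<Rightarrow> (nat word \<Rightarrow> nat word) set \<Rightarrow> (((nat word \<Rightarrow> (complex^2^2) set) \<Rightarrow> complex) \<Rightarrow> complex) \<Rightarrow>
   ((nat word \<Rightarrow> (complex^2^2) set) \<Rightarrow> complex) \<Rightarrow> complex" where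
  "Out_act n \<psi> \<xi> =
     (\<lambda>f\<in>invariants n. \<xi> (precomp n (inv\<^bsub>AutoGroup (Fn n)\<^esub> (SOME \<phi>. \<phi> \<in> \<psi>)) f))"


section \<open>The Cayley tree and primitive leaves\<close>

definition cayley_edges :: "nat \<Rightarrow> (nat word \<times> nat word) set" where
  "cayley_edges n = {(g, h). g \<in> carrier (Fn n) \<and> h \<in> carrier (Fn n) \<and>
     (\<exists>i<n. h = g \<otimes>\<^bsub>Fn n\<^esub> gen i \<or> g = h \<otimes>\<^bsub>Fn n\<^esub> gen i)}"

definition vertex_dist :: "nat \<Rightarrow> nat word \<Rightarrow> nat word \<Rightarrow> nat" where
  "vertex_dist n g h = (LEAST k. (g, h) \<in> cayley_edges n ^^ k)"

text \<open>The geometric realization: \<open>(g, i, s)\<close> is the point at distance \<open>s\<close> from \<open>g\<close> on the edge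
  from \<open>g\<close> to \<open>g \<otimes> gen i\<close>. A vertex has several such descriptions, which are at \<open>tree_dist\<close> 0
  from each other, so \<open>tree_dist\<close> is a pseudometric whose metric quotient is the Cayley tree.\<close>

type_synonym tree_point = "nat word \<times> nat \<times> real"

definition tree :: "nat \<Rightarrow> tree_point set" where
  "tree n = carrier (Fn n) \<times> {..<n} \<times> {0..1}"

fun edge_ends :: "nat \<Rightarrow> tree_point \<Rightarrow> (nat word \<times> real) set" where
  "edge_ends n (g, i, s) = {(g, s), (g \<otimes>\<^bsub>Fn n\<^esub> gen i, 1 - s)}"

fun tree_dist :: "nat \<Rightarrow> tree_point \<Rightarrow> tree_point \<Rightarrow> real" where
  "tree_dist n (g, i, s) (h, j, t) =
     (if g = h \<and> i = j then \<bar>s - t\<bar>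
      else Min ((\<lambda>((u, a), (v, b)). a + real (vertex_dist n u v) + b) `
                (edge_ends n (g, i, s) \<times> edge_ends n (h, j, t))))"

fun tree_act :: "nat \<Rightarrow> nat word \<Rightarrow> tree_point \<Rightarrow> tree_point" where
  "tree_act n h (g, i, s) = (h \<otimes>\<^bsub>Fn n\<^esub> g, i, s)"

text \<open>The axis of \<open>w\<close> is the bi-infinite geodesic along which \<open>w\<close> acts as a translation.\<close>

definition is_axis :: "nat \<Rightarrow> nat word \<Rightarrow> (real \<Rightarrow> tree_point) \<Rightarrow> bool" where
  "is_axis n w \<gamma> \<longleftrightarrow>
     (\<forall>s. \<gamma> s \<in> tree n) \<and>
     (\<forall>s t. tree_dist n (\<gamma> s) (\<gamma> t) = \<bar>s - t\<bar>) \<and>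
     (\<exists>l>0. \<forall>s. tree_dist n (tree_act n w (\<gamma> s)) (\<gamma> (s + l)) = 0)"

definition primitive_leaves :: "nat \<Rightarrow> tree_point set set" where
  "primitive_leaves n = {range \<gamma> | \<gamma> w h. primitive (Fn n) w \<and> h \<in> carrier (Fn n) \<and>
     is_axis n (h \<otimes>\<^bsub>Fn n\<^esub> w \<otimes>\<^bsub>Fn n\<^esub> inv\<^bsub>Fn n\<^esub> h) \<gamma>}"


section \<open>Primitive-stable representations\<close>

text \<open>\<open>is_tau n \<rho> x \<tau>\<close> characterizes \<open>\<tau>\<close> on \<open>tree n\<close> uniquely: it is well-defined on the tree
  (second condition), maps the origin to \<open>x\<close>, is equivariant, and maps each edge to a geodesic
  segment with constant speed (the segment is a point if the ends of the edge have the same image).\<close>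

definition is_tau ::
  "nat \<Rightarrow> (nat word \<Rightarrow> (complex^2^2) set) \<Rightarrow> complex \<times> real \<Rightarrow> (tree_point \<Rightarrow> complex \<times> real) \<Rightarrow> bool" where
  "is_tau n \<rho> x \<tau> \<longleftrightarrow>
     (\<forall>p\<in>tree n. \<tau> p \<in> H3) \<and>
     (\<forall>p\<in>tree n. \<forall>q\<in>tree n. tree_dist n p q = 0 \<longrightarrow> \<tau> p = \<tau> q) \<and>
     (\<forall>i<n. \<tau> (\<one>\<^bsub>Fn n\<^esub>, i, 0) = x) \<and>
     (\<forall>h\<in>carrier (Fn n). \<forall>p\<in>tree n. \<tau> (tree_act n h p) = H3_act (\<rho> h) (\<tau> p)) \<and>
     (\<forall>g\<in>carrier (Fn n). \<forall>i<n. \<forall>s\<in>{0..1}. \<forall>t\<in>{0..1}.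
        H3_dist (\<tau> (g, i, s)) (\<tau> (g, i, t)) = \<bar>s - t\<bar> * H3_dist (\<tau> (g, i, 0)) (\<tau> (g, i, 1)))"

definition quasi_geodesic_on ::
  "nat \<Rightarrow> real \<Rightarrow> real \<Rightarrow> tree_point set \<Rightarrow> (tree_point \<Rightarrow> complex \<times> real) \<Rightarrow> bool" where
  "quasi_geodesic_on n K \<delta> L \<tau> \<longleftrightarrow> (\<forall>s\<in>L. \<forall>t\<in>L.
     1 / K * tree_dist n s t - \<delta> \<le> H3_dist (\<tau> s) (\<tau> t) \<and>
     H3_dist (\<tau> s) (\<tau> t) \<le> K * tree_dist n s t + \<delta>)"

definition primitive_stable :: "nat \<Rightarrow> (nat word \<Rightarrow> (complex^2^2) set) \<Rightarrow> bool" where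
  "primitive_stable n \<rho> \<longleftrightarrow> (\<exists>K \<delta> x \<tau>. K \<ge> 1 \<and> \<delta> \<ge> 0 \<and> x \<in> H3 \<and> is_tau n \<rho> x \<tau> \<and>
     (\<forall>L\<in>primitive_leaves n. quasi_geodesic_on n K \<delta> L \<tau>))"

definition PS :: "nat \<Rightarrow> (((nat word \<Rightarrow> (complex^2^2) set) \<Rightarrow> complex) \<Rightarrow> complex) set" where
  "PS n = char_of n ` {\<rho> \<in> Rep n. primitive_stable n \<rho>}"

definition properly_discontinuous ::
  "('g, 'm) monoid_scheme \<Rightarrow> ('g \<Rightarrow> 'p \<Rightarrow> 'p) \<Rightarrow> 'p topology \<Rightarrow> bool" where
  "properly_discontinuous G act T \<longleftrightarrow>
     (\<forall>C. compactin T C \<longrightarrow> finite {\<psi> \<in> carrier G. act \<psi> ` C \<inter> C \<noteq> {}})"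


section \<open>Well-definedness\<close>

abbreviation (input) flip :: "'a \<times> bool \<Rightarrow> 'a \<times> bool" where
  "flip a \<equiv> (fst a, \<not> snd a)"

lemma reduced_push: "reduced w \<Longrightarrow> reduced (push a w)"
  by (cases w) (auto simp: reduced_def successively_Cons)

lemma push_push: "reduced w \<Longrightarrow> push a (push (flip a) w) = w"
  by (cases "(a, w)" rule: push.cases; cases "tl w")
     (auto simp: reduced_def successively_Cons prod_eq_iff split: if_splits)

lemma reduced_foldr: "reduced w \<Longrightarrow> reduced (foldr push u w)"
  by (induction u) (auto intro: reduced_push)

lemma foldr_push: "reduced w \<Longrightarrow> foldr push (push a u) w = push a (foldr push u w)"
proof (cases u)
  case (Cons b v)
  moreover assume "reduced w"
  then have *: "push a (push (flip a) (foldr push v w)) = foldr push v w"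
    by (intro push_push reduced_foldr)
  moreover have "b = flip a" if "fst b = fst a" "snd b \<noteq> snd a"
    using that by (auto simp: prod_eq_iff)
  ultimately show ?thesis by auto
qed auto

lemma foldr_push_assoc:
  "reduced w \<Longrightarrow> foldr push (foldr push u v) w = foldr push u (foldr push v w)"
  by (induction u) (auto simp: foldr_push)

lemma foldr_push_Nil: "reduced u \<Longrightarrow> foldr push u [] = u"
proof (induction u)
  case (Cons a u)
  then have "reduced u" by (cases u) (auto simp: reduced_def)
  with Cons show ?case by (cases u) (auto simp: reduced_def successively_Cons)
qed simp

lemma foldr_push_inverse:
  "reduced w \<Longrightarrow> foldr push (rev (map flip u)) (foldr push u w) = w"
proof (induction u)
  case (Cons a u)
  then show ?case using push_push[OF reduced_foldr[OF Cons.prems], of "flip a"] by simp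
qed simp

lemma set_push: "set (push a w) \<subseteq> insert a (set w)"
  by (cases "(a, w)" rule: push.cases) auto

lemma set_foldr_push: "set (foldr push u w) \<subseteq> set u \<union> set w"
  using set_push by (induction u) fastforce+

lemma reduced_Nil [simp]: "reduced []"
  by (simp add: reduced_def)

lemma foldr_push_closed:
  assumes "reduced w" "fst ` set u \<subseteq> X" "fst ` set w \<subseteq> X"
  shows "foldr push u w \<in> carrier (free_group X)"
  using assms reduced_foldr[of w u] set_foldr_push[of u w] by (force simp: free_group_def)

lemma group_free_group: "group (free_group X)"
proof (rule groupI)
  fix u assume u: "u \<in> carrier (free_group X)"
  let ?v = "foldr push (rev (map flip u)) []"
  have "?v \<in> carrier (free_group X)"
    using u by (intro foldr_push_closed) (auto simp: free_group_def)
  moreover have "?v \<otimes>\<^bsub>free_group X\<^esub> u = \<one>\<^bsub>free_group X\<^esub>"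
    using u foldr_push_inverse[of "[]" u]
    by (simp add: free_group_def foldr_push_assoc foldr_push_Nil)
  ultimately show "\<exists>v\<in>carrier (free_group X). v \<otimes>\<^bsub>free_group X\<^esub> u = \<one>\<^bsub>free_group X\<^esub>"
    by blast
next
  fix u v assume "u \<in> carrier (free_group X)" "v \<in> carrier (free_group X)"
  then show "u \<otimes>\<^bsub>free_group X\<^esub> v \<in> carrier (free_group X)"
    using foldr_push_closed[of v u X] by (simp add: free_group_def)
qed (auto simp: free_group_def foldr_push_assoc foldr_push_Nil)

lemma matrix_mul_minus: "(- A) ** B = - (A ** B)" "A ** (- B) = - (A ** B)"
  for A B :: "complex^2^2"
  by (simp_all add: matrix_matrix_mult_def vec_eq_iff sum_negf)

lemma group_SL2: "group SL2"
proof (rule groupI)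
  fix A assume "A \<in> carrier SL2"
  then have d: "det A = 1" by (simp add: SL2_def)
  then have "invertible A" by (simp add: invertible_det_nz)
  then obtain B where B: "A ** B = mat 1" "B ** A = mat 1" by (auto simp: invertible_def)
  then have "det B * det A = 1" by (metis det_I det_mul)
  with d B show "\<exists>B\<in>carrier SL2. B \<otimes>\<^bsub>SL2\<^esub> A = \<one>\<^bsub>SL2\<^esub>"
    by (auto simp: SL2_def)
qed (auto simp: SL2_def det_mul matrix_mul_assoc)

lemma normal_center_SL2: "{mat 1, - mat 1} \<lhd> SL2"
proof -
  interpret group SL2 by (rule group_SL2)
  have neg: "- A \<in> carrier SL2" if "A \<in> carrier SL2" for A
    using that by (simp add: SL2_def det_2)
  have one: "mat 1 = \<one>\<^bsub>SL2\<^esub>" by (simp add: SL2_def)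
  have mm: "A \<otimes>\<^bsub>SL2\<^esub> (- B) = - (A \<otimes>\<^bsub>SL2\<^esub> B)" "(- A) \<otimes>\<^bsub>SL2\<^esub> B = - (A \<otimes>\<^bsub>SL2\<^esub> B)" for A B
    by (simp_all add: SL2_def matrix_mul_minus)
  have inv_neg: "inv\<^bsub>SL2\<^esub> (- \<one>\<^bsub>SL2\<^esub>) = - \<one>\<^bsub>SL2\<^esub>"
    by (rule inv_equality) (simp_all add: mm neg)
  have "subgroup {\<one>\<^bsub>SL2\<^esub>, - \<one>\<^bsub>SL2\<^esub>} SL2"
    by (rule subgroupI) (auto simp: mm neg inv_neg)
  then show ?thesis
    unfolding one normal_inv_iff by (auto simp: mm)
qed

lemma group_PSL2: "group PSL2"
  unfolding PSL2_def by (rule normal.factorgroup_is_group[OF normal_center_SL2])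

lemma conj_rep_Rep:
  assumes P: "P \<in> carrier PSL2" and r: "\<rho> \<in> Rep n"
  shows "conj_rep n P \<rho> \<in> Rep n"
proof -
  interpret F: group "Fn n" by (rule group_free_group)
  interpret P: group PSL2 by (rule group_PSL2)
  have c: "\<rho> g \<in> carrier PSL2" if "g \<in> carrier (Fn n)" for g
    using r that by (auto simp: Rep_def hom_def)
  have m: "\<rho> (g \<otimes>\<^bsub>Fn n\<^esub> h) = \<rho> g \<otimes>\<^bsub>PSL2\<^esub> \<rho> h"
    if "g \<in> carrier (Fn n)" "h \<in> carrier (Fn n)" for g h
    using r that by (auto simp: Rep_def hom_def)
  have "(P \<otimes>\<^bsub>PSL2\<^esub> a \<otimes>\<^bsub>PSL2\<^esub> inv\<^bsub>PSL2\<^esub> P) \<otimes>\<^bsub>PSL2\<^esub> (P \<otimes>\<^bsub>PSL2\<^esub> b \<otimes>\<^bsub>PSL2\<^esub> inv\<^bsub>PSL2\<^esub> P)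
     = P \<otimes>\<^bsub>PSL2\<^esub> (a \<otimes>\<^bsub>PSL2\<^esub> b) \<otimes>\<^bsub>PSL2\<^esub> inv\<^bsub>PSL2\<^esub> P"
    if "a \<in> carrier PSL2" "b \<in> carrier PSL2" for a b
  proof -
    have "inv\<^bsub>PSL2\<^esub> P \<otimes>\<^bsub>PSL2\<^esub> (P \<otimes>\<^bsub>PSL2\<^esub> z) = z" if "z \<in> carrier PSL2" for z
      using that P by (simp flip: P.m_assoc)
    then show ?thesis using that P by (simp add: P.m_assoc)
  qed
  then show ?thesis
    unfolding Rep_def conj_rep_def
    by (auto simp: hom_def P c m)
qed

lemma char_of_in_char_points: "char_of n \<rho> \<in> char_points n" if "\<rho> \<in> Rep n"
  using that conj_rep_Rep
  by (auto simp: char_of_def char_points_def invariants_def intro: regular.intros)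

lemma compose_Rep: "compose (carrier (Fn n)) \<rho> \<phi> \<in> Rep n"
  if "\<rho> \<in> Rep n" "\<phi> \<in> hom (Fn n) (Fn n)"
  using that group.hom_compose[OF group_free_group, of \<phi> "{..<n}" "Fn n" \<rho> PSL2]
  by (auto simp: Rep_def)

lemma precomp_regular:
  assumes "f \<in> regular n" and h: "\<phi> \<in> hom (Fn n) (Fn n)"
  shows "precomp n \<phi> f \<in> regular n"
  using assms(1)
proof induction
  case (const c)
  have "precomp n \<phi> (\<lambda>\<rho>\<in>Rep n. c) = (\<lambda>\<rho>\<in>Rep n. c)"
    using h by (auto simp: precomp_def compose_Rep fun_eq_iff)
  then show ?case by (simp only: regular.const)
next
  case (coord g i j k l)
  have "precomp n \<phi> (\<lambda>\<rho>\<in>Rep n. psl_rep (\<rho> g) $ i $ j * psl_rep (\<rho> g) $ k $ l) =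
      (\<lambda>\<rho>\<in>Rep n. psl_rep (\<rho> (\<phi> g)) $ i $ j * psl_rep (\<rho> (\<phi> g)) $ k $ l)"
    using h coord by (auto simp: precomp_def compose_Rep fun_eq_iff compose_eq)
  moreover have "\<phi> g \<in> carrier (Fn n)" using h coord by (auto simp: hom_def)
  ultimately show ?case by (simp only: regular.coord)
next
  case (add f f')
  have "precomp n \<phi> (\<lambda>\<rho>\<in>Rep n. f \<rho> + f' \<rho>) = (\<lambda>\<rho>\<in>Rep n. precomp n \<phi> f \<rho> + precomp n \<phi> f' \<rho>)"
    using h by (auto simp: precomp_def compose_Rep fun_eq_iff)
  then show ?case using add.IH by (simp only: regular.add)
next
  case (mult f f')
  have "precomp n \<phi> (\<lambda>\<rho>\<in>Rep n. f \<rho> * f' \<rho>) = (\<lambda>\<rho>\<in>Rep n. precomp n \<phi> f \<rho> * precomp n \<phi> f' \<rho>)"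
    using h by (auto simp: precomp_def compose_Rep fun_eq_iff)
  then show ?case using mult.IH by (simp only: regular.mult)
qed

lemma precomp_invariants:
  assumes f: "f \<in> invariants n" and h: "\<phi> \<in> hom (Fn n) (Fn n)"
  shows "precomp n \<phi> f \<in> invariants n"
proof -
  have "compose (carrier (Fn n)) (conj_rep n P \<rho>) \<phi> = conj_rep n P (compose (carrier (Fn n)) \<rho> \<phi>)" for P \<rho>
    using h by (auto simp: compose_def conj_rep_def fun_eq_iff hom_def)
  then show ?thesis
    using assms by (auto simp: invariants_def precomp_regular conj_rep_Rep compose_Rep)
       (auto simp: precomp_def conj_rep_Rep compose_Rep)
qed

lemma inv_AutoGroup_auto: "\<phi> \<in> auto (Fn n) \<Longrightarrow> inv\<^bsub>AutoGroup (Fn n)\<^esub> \<phi> \<in> auto (Fn n)"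
  using group.inv_closed[OF group.AutoGroup[OF group_free_group], of \<phi> "{..<n}"]
  by (simp add: AutoGroup_def)

theorem Out_act_char_of:
  assumes \<psi>: "\<psi> \<in> carrier (Out (Fn n))" and \<phi>: "\<phi> \<in> \<psi>" and \<rho>: "\<rho> \<in> Rep n"
  shows "Out_act n \<psi> (char_of n \<rho>) =
    char_of n (compose (carrier (Fn n)) \<rho> (inv\<^bsub>AutoGroup (Fn n)\<^esub> \<phi>))"
proof -
  interpret F: group "Fn n" by (rule group_free_group)
  interpret P: group PSL2 by (rule group_PSL2)
  interpret A: group "AutoGroup (Fn n)" by (rule F.AutoGroup)
  have cA: "carrier (AutoGroup (Fn n)) = auto (Fn n)" by (simp add: AutoGroup_def)
  have Ahom: "a \<in> hom (Fn n) (Fn n)" "a \<in> Bij (carrier (Fn n))" if "a \<in> auto (Fn n)" for a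
    using that by (auto simp: auto_def)
  have mA: "a \<otimes>\<^bsub>AutoGroup (Fn n)\<^esub> b = compose (carrier (Fn n)) a b"
    if "a \<in> auto (Fn n)" "b \<in> auto (Fn n)" for a b
    using that by (simp add: AutoGroup_def BijGroup_def Ahom)
  have inner: "inner_aut (Fn n) g \<in> auto (Fn n)" if g: "g \<in> carrier (Fn n)" for g
  proof -
    let ?i = "inner_aut (Fn n)"
    have cl: "?i u x \<in> carrier (Fn n)" if "x \<in> carrier (Fn n)" "u \<in> carrier (Fn n)" for x u
      using that by (simp add: inner_aut_def)
    have cancel: "u \<otimes>\<^bsub>Fn n\<^esub> (inv\<^bsub>Fn n\<^esub> u \<otimes>\<^bsub>Fn n\<^esub> z) = z"
      "inv\<^bsub>Fn n\<^esub> u \<otimes>\<^bsub>Fn n\<^esub> (u \<otimes>\<^bsub>Fn n\<^esub> z) = z"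
      if "u \<in> carrier (Fn n)" "z \<in> carrier (Fn n)" for u z
      using that by (simp_all flip: F.m_assoc)
    have 1: "?i u (?i (inv\<^bsub>Fn n\<^esub> u) x) = x" if "x \<in> carrier (Fn n)" "u \<in> carrier (Fn n)" for x u
      using that by (simp add: inner_aut_def F.m_assoc cancel)
    have "bij_betw (?i g) (carrier (Fn n)) (carrier (Fn n))"
      using 1[of _ g] 1[of _ "inv\<^bsub>Fn n\<^esub> g"] g
      by (intro bij_betw_byWitness[where f' = "?i (inv\<^bsub>Fn n\<^esub> g)"]) (auto simp: cl)
    moreover have "?i g (x \<otimes>\<^bsub>Fn n\<^esub> y) = ?i g x \<otimes>\<^bsub>Fn n\<^esub> ?i g y"
      if "x \<in> carrier (Fn n)" "y \<in> carrier (Fn n)" for x y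
      using that g by (simp add: inner_aut_def F.m_assoc cancel)
    ultimately show ?thesis
      by (auto simp: auto_def hom_def Bij_def cl g) (auto simp: inner_aut_def)
  qed
  define Q where "Q a = compose (carrier (Fn n)) \<rho> (inv\<^bsub>AutoGroup (Fn n)\<^esub> a)" for a
  have Qinn: "Q (inner_aut (Fn n) g \<otimes>\<^bsub>AutoGroup (Fn n)\<^esub> a) = 
     conj_rep n (\<rho> ((inv\<^bsub>AutoGroup (Fn n)\<^esub> a) (inv\<^bsub>Fn n\<^esub> g))) (Q a)"
    if g: "g \<in> carrier (Fn n)" and a: "a \<in> auto (Fn n)" for g a
  proof -
    let ?b = "inv\<^bsub>AutoGroup (Fn n)\<^esub> a"
    have b: "?b \<in> auto (Fn n)" by (rule inv_AutoGroup_auto[OF a])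
    have bh: "group_hom (Fn n) (Fn n) ?b"
      using Ahom(1)[OF b] by (simp add: group_hom_def group_hom_axioms_def)
    have rh: "group_hom (Fn n) PSL2 \<rho>"
      using \<rho> by (simp add: group_hom_def group_hom_axioms_def Rep_def)
    interpret b: group_hom "Fn n" "Fn n" ?b by (rule bh)
    interpret r: group_hom "Fn n" PSL2 \<rho> by (rule rh)
    have cancel: "inv\<^bsub>Fn n\<^esub> g \<otimes>\<^bsub>Fn n\<^esub> (g \<otimes>\<^bsub>Fn n\<^esub> z) = z" if "z \<in> carrier (Fn n)" for z
      using that g by (simp flip: F.m_assoc)
    have invg: "inv\<^bsub>AutoGroup (Fn n)\<^esub> (inner_aut (Fn n) g) = inner_aut (Fn n) (inv\<^bsub>Fn n\<^esub> g)"
    proof (rule A.inv_equality)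
      show "inner_aut (Fn n) (inv\<^bsub>Fn n\<^esub> g) \<otimes>\<^bsub>AutoGroup (Fn n)\<^esub> inner_aut (Fn n) g = \<one>\<^bsub>AutoGroup (Fn n)\<^esub>"
        using g inner[of g] inner[of "inv\<^bsub>Fn n\<^esub> g"]
        by (auto simp: mA) (auto simp: AutoGroup_def BijGroup_def compose_def inner_aut_def fun_eq_iff F.m_assoc cancel)
    qed (use g inner cA in auto)
    have "inv\<^bsub>AutoGroup (Fn n)\<^esub> (inner_aut (Fn n) g \<otimes>\<^bsub>AutoGroup (Fn n)\<^esub> a) =
        compose (carrier (Fn n)) ?b (inner_aut (Fn n) (inv\<^bsub>Fn n\<^esub> g))"
      using g a by (subst A.inv_mult_group) (simp_all add: cA inner invg mA b)
    then show ?thesis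
      using g by (auto simp: Q_def conj_rep_def compose_def inner_aut_def fun_eq_iff r.hom_inv b.hom_inv)
  qed
  obtain a where a: "a \<in> auto (Fn n)" and \<psi>a: "\<psi> = {inner_aut (Fn n) g \<otimes>\<^bsub>AutoGroup (Fn n)\<^esub> a | g. g \<in> carrier (Fn n)}"
    using \<psi> by (auto simp: Out_def FactGroup_def RCOSETS_def r_coset_def cA)
  have QR: "Q a \<in> Rep n"
    unfolding Q_def using \<rho> a by (intro compose_Rep Ahom inv_AutoGroup_auto)
  have Qval: "f (Q c) = f (Q a)" if "c \<in> \<psi>" "f \<in> invariants n" for c f
  proof -
    from that obtain g where g: "g \<in> carrier (Fn n)" "c = inner_aut (Fn n) g \<otimes>\<^bsub>AutoGroup (Fn n)\<^esub> a"
      by (auto simp: \<psi>a)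
    have "\<rho> ((inv\<^bsub>AutoGroup (Fn n)\<^esub> a) (inv\<^bsub>Fn n\<^esub> g)) \<in> carrier PSL2"
      using g(1) \<rho> Ahom(1)[OF inv_AutoGroup_auto[OF a]] by (auto simp: Rep_def hom_def Pi_def)
    then show ?thesis
      using that g QR by (simp add: Qinn[OF g(1) a] invariants_def)
  qed
  define c where "c = (SOME \<phi>. \<phi> \<in> \<psi>)"
  have c: "c \<in> \<psi>" unfolding c_def using \<phi> by (metis someI_ex)
  have "\<psi> \<subseteq> auto (Fn n)"
    using a inner A.m_closed by (auto simp: \<psi>a cA)
  then have "c \<in> auto (Fn n)" using c by blast
  then have "inv\<^bsub>AutoGroup (Fn n)\<^esub> c \<in> hom (Fn n) (Fn n)" by (intro Ahom inv_AutoGroup_auto)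
  then have "precomp n (inv\<^bsub>AutoGroup (Fn n)\<^esub> c) f \<in> invariants n" if "f \<in> invariants n" for f
    using that by (rule precomp_invariants[rotated])
  then have "Out_act n \<psi> (char_of n \<rho>) = (\<lambda>f\<in>invariants n. f (Q c))"
    using \<rho> by (auto simp: Out_act_def char_of_def precomp_def Q_def fun_eq_iff simp flip: c_def)
  also have "\<dots> = char_of n (Q \<phi>)"
    unfolding char_of_def by (rule restrict_ext) (simp only: Qval[OF c] Qval[OF \<phi>])
  finally show ?thesis by (simp add: Q_def)
qed

end

theory Submission
  imports Defs
begin

text \<open>For \<open>A \<in> SL2\<close> let \<open>D A = 2 sinh (d / 2)\<close>, where \<open>d\<close> is the distance by which \<open>A\<close> moves the base
  point of hyperbolic space. In the upper half-space model \<open>D\<close> is a Euclidean distance divided by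
  square roots of heights, so it satisfies the inequality of Ptolemy. This makes two classical facts
  elementary: the stability of quasi-geodesics, and the local-to-global principle that a path whose
  steps satisfy \<open>D (u v) \<ge> 3 max (D u) (D v)\<close> moves away exponentially. For a primitive-stable
  representation, stability yields a block length \<open>N\<close> at which the local condition holds along
  all primitive leaves. It only involves finitely many words, so it holds for all nearby
  representations, and it implies \<open>(|tr \<rho>(w)| + 1)\<^sup>N \<ge> 2\<^sup>|\<^sup>w\<^sup>|\<close> for all cyclically reduced primitive \<open>w\<close>.

  To make \<open>N\<close> uniform on a compact set \<open>C\<close> of characters, a sequence of representations whose
  squared traces converge is conjugated into a convergent one. This is possible because a
  primitive-stable representation has no line invariant under the first two generators: otherwise
  the logarithm of the eigenvalue would be a homomorphism, which the Euclidean algorithm makes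
  arbitrarily small on primitive elements. If \<open>\<psi> C\<close> meets \<open>C\<close> and \<open>\<phi> \<in> \<psi>\<close>, then the traces of the images of
  \<open>\<phi>\<^sup>-\<^sup>1(x\<^sub>i)\<close> and \<open>\<phi>\<^sup>-\<^sup>1(x\<^sub>i x\<^sub>j)\<close> are bounded on \<open>C\<close>, hence so are the cyclic lengths of these elements, and
  only finitely many outer automorphisms have this property.\<close>

section \<open>Ptolemaic functions\<close>

text \<open>The main obstacle is that a point of the quotient is known only through invariants.
  Squared traces of words are used: a trace has no sign in PSL(2,C), and along a sequence of
  characters the signs may vary with the index and the word. The limit tuple is therefore never
  shown to be conjugate to the given primitive-stable one; the two are compared through moduli of
  traces. This works because the traces of \<open>X\<close>, \<open>A X\<close>, \<open>B X\<close>,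
  \<open>A B X\<close> control the norm of \<open>X\<close> once \<open>A\<close> and
  \<open>B\<close> have no common eigenvector. That condition is also needed for the limit of the
  first two generators, when the others need not converge yet. Hence its proof has to get by with
  automorphisms that send these two generators to words in their own letters. The displacement
  \<open>D\<close> grows like the exponential of half the distance and satisfies no triangle
  inequality; Ptolemy takes its place, together with submultiplicativity of the matrix norm for
  bounded changes. The factor 3 makes doubling reproduce itself, as 3 - 1/2 >= 2; at the limit tuple
  the factor 6 is reached, which leaves room for a perturbation.\<close>

lemma ptolemy_inner:
  fixes p q r s :: "'a::real_inner"
  shows "dist p q * dist r s \<le> dist p r * dist q s + dist p s * dist q r"
proof -
  \<comment> \<open>Inversion in the unit sphere around \<open>p\<close> divides distances by both
    norms. The triangle inequality for the inverted points becomes the claim after multiplication by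
    the three distances to \<open>p\<close>.\<close>
  have inv: "norm (u /\<^sub>R (norm u)\<^sup>2 - v /\<^sub>R (norm v)\<^sup>2) * norm u * norm v = norm (u - v)"
    if "u \<noteq> 0" "v \<noteq> 0" for u v :: 'a
  proof -
    have nz: "norm u \<noteq> 0" "norm v \<noteq> 0" using that by auto
    have "(norm (u /\<^sub>R (norm u)\<^sup>2 - v /\<^sub>R (norm v)\<^sup>2))\<^sup>2 * (norm u)\<^sup>2 * (norm v)\<^sup>2 = (norm (u - v))\<^sup>2"
    proof -
      have sub: "(norm (x - y))\<^sup>2 = (norm x)\<^sup>2 - 2 * (x \<bullet> y) + (norm y)\<^sup>2" for x y :: 'a
        unfolding power2_norm_eq_inner by (simp add: inner_diff inner_commute)
      show ?thesis
        unfolding sub using nz by (simp add: field_simps power2_eq_square)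
    qed
    then have "(norm (u /\<^sub>R (norm u)\<^sup>2 - v /\<^sub>R (norm v)\<^sup>2) * norm u * norm v)\<^sup>2 = (norm (u - v))\<^sup>2"
      by (simp add: power_mult_distrib)
    then show ?thesis by (meson norm_ge_zero mult_nonneg_nonneg power2_eq_iff_nonneg)
  qed
  define u v w where "u = q - p" and "v = r - p" and "w = s - p"
  have "norm u * norm (v - w) \<le> norm v * norm (u - w) + norm w * norm (u - v)"
  proof (cases "u = 0 \<or> v = 0 \<or> w = 0")
    case True
    then show ?thesis by (auto simp: norm_minus_commute)
  next
    case False
    define i where "i x = x /\<^sub>R (norm x)\<^sup>2" for x :: 'a
    have "norm (i v - i w) \<le> norm (i v - i u) + norm (i u - i w)"
      using norm_triangle_ineq[of "i v - i u" "i u - i w"] by simp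
    then have "norm (i v - i w) * (norm u * norm v * norm w) \<le>
       (norm (i v - i u) + norm (i u - i w)) * (norm u * norm v * norm w)"
      by (intro mult_right_mono) auto
    then have "norm u * (norm (i v - i w) * norm v * norm w) \<le>
       norm w * (norm (i v - i u) * norm v * norm u) + norm v * (norm (i u - i w) * norm u * norm w)"
      by (simp add: algebra_simps)
    then show ?thesis
      using inv[of v w] inv[of v u] inv[of u w] False by (simp add: i_def norm_minus_commute)
  qed
  then show ?thesis
    by (simp add: u_def v_def w_def dist_norm norm_minus_commute)
qed

text \<open>Points are numbered along a path, so positions in a word can index them. No triangle
  inequality is assumed, since the intended \<open>d\<close> grows exponentially with a metric and
  violates it.\<close>

locale ptolemaic =
  fixes d :: "nat \<Rightarrow> nat \<Rightarrow> real"
  assumes nonneg: "0 \<le> d i j" and sym: "d i j = d j i"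
    and ptolemy: "d i j * d k l \<le> d i k * d j l + d i l * d j k"
begin

lemma local_to_global:
  assumes "\<And>i. 3 * d i (Suc i) \<le> d i (i + 2)" "\<And>i. 3 * d (Suc i) (i + 2) \<le> d i (i + 2)"
    and pos: "\<And>i. 0 < d i (Suc i)"
  shows "2 ^ n * d 0 1 \<le> d 0 (Suc n)"
proof -
  have "2 * d 0 (Suc n) \<le> d 0 (n + 2)" for n
  proof (induction n)
    case 0
    then show ?case using assms(1)[of 0] pos[of 0] by simp
  next
    case (Suc n)
    let ?x = "d (Suc n) (Suc n + 2)"
    have x: "0 < ?x" using assms(1)[of "Suc n"] pos[of "Suc n"] by linarith
    \<comment> \<open>Ptolemy for the points 0, n+1, n+2, n+3. The local conditions bound both steps
      at n+2 by a third of \<open>?x\<close>; after cancelling \<open>?x\<close> a recursion remains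
      in which 3 - 1/2 >= 2 reproduces the doubling.\<close>
    have "d 0 (n + 2) * ?x \<le> d 0 (Suc n) * d (n + 2) (Suc n + 2) + d 0 (Suc n + 2) * d (n + 2) (Suc n)"
      by (rule ptolemy)
    also have "\<dots> \<le> d 0 (Suc n) * (?x / 3) + d 0 (Suc n + 2) * (?x / 3)"
      using assms(1)[of "Suc n"] assms(2)[of "Suc n"] sym[of "n + 2" "Suc n"]
      by (intro add_mono mult_left_mono nonneg) auto
    also have "\<dots> = ((d 0 (Suc n) + d 0 (Suc n + 2)) / 3) * ?x" by (simp add: algebra_simps)
    finally have "d 0 (n + 2) \<le> (d 0 (Suc n) + d 0 (Suc n + 2)) / 3" using x by simp
    moreover have "2 * d 0 (Suc n) \<le> d 0 (n + 2)" by (rule Suc)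
    ultimately have "2 * d 0 (n + 2) \<le> d 0 (Suc n + 2)"
      using nonneg[of 0 "n + 2"] by (simp del: add_Suc)
    then show ?case by simp
  qed
  then show ?thesis
  proof (induction n)
    case (Suc n)
    then have "2 * (2 ^ n * d 0 1) \<le> 2 * d 0 (Suc n)" by simp
    also have "\<dots> \<le> d 0 (n + 2)" by (rule Suc)
    finally show ?case by (simp add: algebra_simps)
  qed simp
qed

text \<open>For fixed ends \<open>i\<close> and \<open>k\<close>, the quotient \<open>h l / d i k\<close> measures the exponential of the distance from
  \<open>l\<close> to the geodesic, and \<open>d i l / d l k\<close> the position of the projection. While \<open>h\<close> is large, the
  inequality of Ptolemy makes the projection move slowly, so \<open>lower\<close> bounds the length of such a
  stretch.\<close>

lemma quasigeodesic_stable: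
  assumes lower: "\<And>i j. i < j \<Longrightarrow> 2 ^ (j - i) \<le> d i j"
    and step: "\<And>i. d i (Suc i) \<le> b"
    and lip: "\<And>i k. i \<noteq> Suc k \<Longrightarrow> d i k \<le> K * d i (Suc k)" "\<And>i k. i \<noteq> k \<Longrightarrow> d i (Suc k) \<le> K * d i k"
    and K: "K \<ge> 1" and ij: "i < j" and jk: "j < k"
    and E: "(K ^ 2) ^ nat \<lceil>4 * (K ^ 2 * (2 * b)) ^ 2\<rceil> * (K ^ 2 * (2 * b)) \<le> E"
  shows "d i j * d j k \<le> E * d i k"
proof -
  have b: "2 \<le> b" using lower[of 0 1] step[of 0] by simp
  have pos: "0 < d l m" if "l \<noteq> m" for l m
  proof (cases "l < m")
    case True
    with lower[of l m] show ?thesis by (smt (verit) zero_less_power)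
  next
    case False
    with that have "m < l" by simp
    with lower[of m l] sym[of l m] show ?thesis by (smt (verit) zero_less_power)
  qed
  define h where "h l = d i l * d l k" for l
  define G where "G = K ^ 2 * (2 * b)"
  define n0 where "n0 = nat \<lceil>4 * G ^ 2\<rceil>"
  have dik: "0 < d i k" using pos ij jk by simp
  have G: "2 * b \<le> G" "G > 0" using K b by (auto simp: G_def intro: order_less_le_trans[of 0 "2*b"])
  have K2: "1 \<le> K ^ 2" using K by simp
  \<comment> \<open>\<open>P\<close> marks positions far from the geodesic. The factor 2 b is what
    \<open>ratio1\<close> needs: a jump of the ratio by more than 2 would force the product of
    \<open>?a\<close> and \<open>?c\<close> below 2 (b d i k)^2, but that product is h p h q, which
    is at least 4 (b d i k)^2.\<close>
  define P where "P l \<longleftrightarrow> i < l \<and> l < k \<and> 2 * b * d i k < h l" for l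
  have hup: "h l \<le> K ^ 2 * h (Suc l)" if "i < l" "Suc l < k" for l
  proof -
    have "d i l * d l k \<le> (K * d i (Suc l)) * (K * d (Suc l) k)"
      using lip(1)[of i l] lip(1)[of k l] that sym K by (intro mult_mono nonneg) (auto intro!: mult_nonneg_nonneg nonneg)
    then show ?thesis by (simp add: h_def power2_eq_square algebra_simps)
  qed
  have hdown: "h (Suc l) \<le> K ^ 2 * h l" if "i < l" "Suc l < k" for l
  proof -
    have "d i (Suc l) * d (Suc l) k \<le> (K * d i l) * (K * d l k)"
      using lip(2)[of i l] lip(2)[of k l] that sym K by (intro mult_mono nonneg) (auto intro!: mult_nonneg_nonneg nonneg)
    then show ?thesis by (simp add: h_def power2_eq_square algebra_simps)
  qed
  have "h j \<le> (K ^ 2) ^ n0 * (G * d i k)"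
  proof (cases "P j")
    case False
    then have "h j \<le> 2 * b * d i k" using ij jk by (simp add: P_def)
    also have "\<dots> \<le> 1 * (G * d i k)" using G dik by simp
    also have "\<dots> \<le> (K ^ 2) ^ n0 * (G * d i k)"
      using K2 G dik by (intro mult_right_mono) (auto simp: one_le_power)
    finally show ?thesis .
  next
    case True
    \<comment> \<open>\<open>s\<close> and \<open>e\<close> bound the maximal stretch around
      \<open>j\<close> on which \<open>P\<close> holds. One step further, either \<open>h\<close> is
      below the threshold or an endpoint \<open>i\<close>, \<open>k\<close> is reached; in both
      cases \<open>G * d i k\<close> bounds \<open>h\<close> at the ends.\<close>
    obtain e where e: "j \<le> e" "\<And>l. j \<le> l \<Longrightarrow> l \<le> e \<Longrightarrow> P l" "\<not> P (Suc e)"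
    proof -
      define m where "m = (LEAST m. j \<le> m \<and> \<not> P m)"
      have ex: "j \<le> k \<and> \<not> P k" using jk by (simp add: P_def)
      have m: "j \<le> m" "\<not> P m" using LeastI[of "\<lambda>m. j \<le> m \<and> \<not> P m", OF ex] by (auto simp: m_def)
      have min: "P l" if "j \<le> l" "l < m" for l
        using not_less_Least[of l "\<lambda>m. j \<le> m \<and> \<not> P m"] that by (auto simp: m_def)
      have "m \<noteq> j" using m True by auto
      then show ?thesis using that[of "m - 1"] m min by (cases m) auto
    qed
    obtain s where s: "s \<le> j" "\<And>l. s \<le> l \<Longrightarrow> l \<le> j \<Longrightarrow> P l" "\<not> P (s - 1)" "0 < s"
    proof -
      define m where "m = (GREATEST m. m \<le> j \<and> \<not> P m)"
      have ex: "i \<le> j \<and> \<not> P i" using ij by (simp add: P_def)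
      have m: "m \<le> j" "\<not> P m"
        using GreatestI_nat[of "\<lambda>m. m \<le> j \<and> \<not> P m" i j, OF ex] by (auto simp: m_def)
      have min: "P l" if "l \<le> j" "m < l" for l
        using Greatest_le_nat[of "\<lambda>m. m \<le> j \<and> \<not> P m" l j] that by (fastforce simp: m_def)
      have "m \<noteq> j" using m True by auto
      then show ?thesis using that[of "Suc m"] m min by auto
    qed
    have Pse: "P l" if "s \<le> l" "l \<le> e" for l using that s(2) e(2) by (cases "l \<le> j") auto
    have he: "h e \<le> G * d i k"
    proof (cases "Suc e < k")
      case True
      have "i < e" using e ij by simp
      then have "h (Suc e) \<le> 2 * b * d i k" using e(3) True by (auto simp: P_def)
      then have "K ^ 2 * h (Suc e) \<le> K ^ 2 * (2 * b * d i k)" by (intro mult_left_mono) auto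
      then show ?thesis using hup[of e] True \<open>i < e\<close> by (simp add: G_def algebra_simps)
    next
      case False
      have "e < k" using e(1) Pse[of e] s(1) by (auto simp: P_def)
      with False have k: "k = Suc e" by simp
      have "h e \<le> (K * d i k) * b"
        unfolding h_def using lip(1)[of i e] step[of e] k ij e(1) K
        by (intro mult_mono nonneg) (auto intro!: mult_nonneg_nonneg nonneg)
      also have "\<dots> \<le> (K ^ 2 * d i k) * (2 * b)"
        using K b dik by (intro mult_mono) (auto simp: power2_eq_square intro!: mult_nonneg_nonneg nonneg)
      finally show ?thesis by (simp add: G_def algebra_simps)
    qed
    have hs: "h s \<le> G * d i k"
    proof (cases "i < s - 1")
      case True
      have "s < k" using s(1) jk by simp
      then have "h (s - 1) \<le> 2 * b * d i k" using s(3) True by (auto simp: P_def)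
      then have "K ^ 2 * h (s - 1) \<le> K ^ 2 * (2 * b * d i k)" by (intro mult_left_mono) auto
      then show ?thesis using hdown[of "s - 1"] True \<open>s < k\<close> s(4) by (simp add: G_def algebra_simps)
    next
      case False
      have "i < s" using Pse[of s] s(1) e(1) by (auto simp: P_def)
      with False have k: "s = Suc i" by simp
      have "h s \<le> b * (K * d i k)"
        unfolding h_def using lip(2)[of k i] step[of i] k ij jk s(1) K sym[of k] b
        by (intro mult_mono nonneg) (auto intro!: mult_nonneg_nonneg nonneg)
      also have "\<dots> \<le> (2 * b) * (K ^ 2 * d i k)"
        using K b dik by (intro mult_mono) (auto simp: power2_eq_square intro!: mult_nonneg_nonneg nonneg)
      finally show ?thesis by (simp add: G_def algebra_simps)
    qed
    have ratio1: "d i p * d q k \<le> 2 * (d i q * d p k)"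
      if P: "P p" "P q" and pq: "d p q \<le> b" for p q
    proof (rule ccontr)
      let ?a = "d i p * d q k" and ?c = "d i q * d p k"
      assume "\<not> ?a \<le> 2 * ?c"
      then have gt: "2 * ?c < ?a" by simp
      have c: "0 < ?c" using P pos by (auto simp: P_def)
      have "d i p * d q k \<le> d i q * d p k + d i k * d p q" by (rule ptolemy)
      moreover have "d i k * d p q \<le> d i k * b" using pq dik by simp
      ultimately have "?a - ?c \<le> d i k * b" by linarith
      then have "(?a - ?c) * (?a - ?c) \<le> (d i k * b) * (d i k * b)"
        using gt c by (intro mult_mono) auto
      moreover have "(2 * b * d i k) * (2 * b * d i k) \<le> h p * h q"
        using P b dik by (intro mult_mono) (auto simp: P_def h_def intro!: mult_nonneg_nonneg nonneg)
      moreover have "h p * h q = ?a * ?c" by (simp add: h_def)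
      moreover have "(?a / 2) * ?c < (?a - ?c) * (?a - ?c)" using gt c by (intro mult_strict_mono) auto
      moreover have "0 < ?a" using gt c by linarith
      then have "0 < ?a * ?c" using c by (rule mult_pos_pos)
      ultimately show False by (simp add: algebra_simps)
    qed
    \<comment> \<open>Iteration of \<open>ratio1\<close>: the logarithm of the projection coordinate
      \<open>d i l / d l k\<close> moves by at most ln 2 per step, in either direction.\<close>
    have ratio: "d i s * d l k \<le> 2 ^ (l - s) * (d i l * d s k) \<and> d i l * d s k \<le> 2 ^ (l - s) * (d i s * d l k)"
      if "s \<le> l" "l \<le> e" for l
      using that
    proof (induction l rule: dec_induct)
      case base
      then show ?case by (simp add: mult.commute)
    next
      case (step l)
      have Pl: "P l" "P (Suc l)" using step Pse by auto
      have p: "0 < d l k" "0 < d i l" using Pl pos by (auto simp: P_def)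
      have sl: "Suc l - s = Suc (l - s)" using step by simp
      have b1: "d l (Suc l) \<le> b" "d (Suc l) l \<le> b" using assms(2) sym by auto
      have IH: "d i s * d l k \<le> 2 ^ (l - s) * (d i l * d s k)" "d i l * d s k \<le> 2 ^ (l - s) * (d i s * d l k)"
        using step by auto
      have "(d i s * d (Suc l) k) * (d l k * d i l) = (d i s * d l k) * (d i l * d (Suc l) k)" by simp
      also have "\<dots> \<le> (2 ^ (l - s) * (d i l * d s k)) * (2 * (d i (Suc l) * d l k))"
        by (rule mult_mono[OF IH(1) ratio1[OF Pl b1(1)]]) (auto intro!: mult_nonneg_nonneg nonneg)
      also have "\<dots> = (2 ^ (Suc l - s) * (d i (Suc l) * d s k)) * (d l k * d i l)" by (simp add: sl)
      finally have 1: "d i s * d (Suc l) k \<le> 2 ^ (Suc l - s) * (d i (Suc l) * d s k)"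
        using p by (simp add: mult_le_cancel_right)
      have "(d i (Suc l) * d s k) * (d l k * d i l) = (d i l * d s k) * (d i (Suc l) * d l k)" by simp
      also have "\<dots> \<le> (2 ^ (l - s) * (d i s * d l k)) * (2 * (d i l * d (Suc l) k))"
        by (rule mult_mono[OF IH(2) ratio1[OF Pl(2,1) b1(2)]]) (auto intro!: mult_nonneg_nonneg nonneg)
      also have "\<dots> = (2 ^ (Suc l - s) * (d i s * d (Suc l) k)) * (d l k * d i l)" by (simp add: sl)
      finally have 2: "d i (Suc l) * d s k \<le> 2 ^ (Suc l - s) * (d i s * d (Suc l) k)"
        using p by (simp add: mult_le_cancel_right)
      show ?case using 1 2 by simp
    qed
    have se: "s \<le> e" using s e by simp
    \<comment> \<open>With n = e - s, the square of \<open>?a + ?c\<close> is at least 4^n (d i k)^2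
      by \<open>lower\<close> and Ptolemy, but by \<open>ratio\<close> at most 2^n times 4 h s h e.
      The surplus factor 2^n bounds the length of the stretch.\<close>
    have "e - s \<le> n0"
    proof (cases "s = e")
      case False
      let ?n = "e - s" and ?a = "d i s * d e k" and ?c = "d i e * d s k"
      have ac: "0 \<le> ?a" "0 \<le> ?c" by (auto intro!: mult_nonneg_nonneg nonneg)
      have "2 ^ ?n * d i k \<le> d s e * d i k" using lower[of s e] se False dik by simp
      also have "\<dots> = d i k * d s e" by simp
      also have "\<dots> \<le> ?a + ?c" using ptolemy[of i k s e] by (simp add: sym mult.commute)
      finally have *: "2 ^ ?n * d i k \<le> ?a + ?c" .
      have "(2 ^ ?n * d i k) * (2 ^ ?n * d i k) \<le> (?a + ?c) * (?a + ?c)"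
        by (rule mult_mono[OF * *]) (use dik ac in auto)
      also have "\<dots> = ?a * ?a + ?c * ?c + 2 * (?a * ?c)" by (simp add: algebra_simps)
      also have "\<dots> \<le> ?a * (2 ^ ?n * ?c) + (2 ^ ?n * ?a) * ?c + 2 ^ ?n * 2 * (?a * ?c)"
      proof -
        have "2 * (?a * ?c) \<le> 2 ^ ?n * 2 * (?a * ?c)" using ac by (intro mult_right_mono) auto
        moreover have "?a * ?a \<le> ?a * (2 ^ ?n * ?c)" "?c * ?c \<le> (2 ^ ?n * ?a) * ?c"
          using ratio[of e] se ac mult_left_mono[of ?a "2 ^ ?n * ?c" ?a] mult_right_mono[of ?c "2 ^ ?n * ?a" ?c]
          by blast+
        ultimately show ?thesis by linarith
      qed
      also have "\<dots> = 2 ^ ?n * (4 * (h s * h e))" by (simp add: h_def)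
      also have "\<dots> \<le> 2 ^ ?n * (4 * ((G * d i k) * (G * d i k)))"
        using G dik by (intro mult_left_mono mult_mono[OF hs he]) (auto simp: h_def intro!: mult_nonneg_nonneg nonneg)
      finally have "2 ^ ?n * (2 ^ ?n * (d i k * d i k)) \<le> 2 ^ ?n * (4 * G ^ 2 * (d i k * d i k))"
        by (simp add: power2_eq_square algebra_simps)
      then have "2 ^ ?n \<le> 4 * G ^ 2" using dik by (simp add: mult_le_cancel_left mult_le_cancel_right)
      moreover have "real ?n < 2 ^ ?n" by (metis of_nat_less_two_power)
      ultimately show ?thesis unfolding n0_def by linarith
    qed (simp)
    moreover have "h j \<le> (K ^ 2) ^ (l - j) * h l" if "j \<le> l" "l \<le> e" for l
      using that
    proof (induction l rule: dec_induct)
      case (step l)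
      have "h j \<le> (K ^ 2) ^ (l - j) * h l" using step by simp
      also have "\<dots> \<le> (K ^ 2) ^ (l - j) * (K ^ 2 * h (Suc l))"
        using step Pse[of "Suc l"] ij s(1) by (intro mult_left_mono hup) (auto simp: P_def)
      finally show ?case using step by (simp add: Suc_diff_le mult_ac)
    qed simp
    ultimately have "e - j \<le> n0" "h j \<le> (K ^ 2) ^ (e - j) * h e" using s(1) e(1) by auto
    moreover have "(K ^ 2) ^ (e - j) * h e \<le> (K ^ 2) ^ n0 * (G * d i k)"
      by (rule mult_mono[OF power_increasing[OF \<open>e - j \<le> n0\<close> K2] he])
        (auto simp: h_def intro!: mult_nonneg_nonneg nonneg)
    ultimately show ?thesis by linarith
  qed
  also have "\<dots> \<le> E * d i k"
    using mult_right_mono[OF E, of "d i k"] dik by (simp add: n0_def G_def mult.assoc)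
  finally show ?thesis by (simp add: h_def)
qed

end

section \<open>Displacements of elements of SL(2,C)\<close>

type_synonym mat2 = "complex^2^2"

text \<open>The adjugate stands in for the inverse: both agree for determinant 1, and being
  polynomial in the entries it is continuous without any condition.\<close>

definition adj2 :: "mat2 \<Rightarrow> mat2" where
  "adj2 A = vector [vector [A$2$2, - A$1$2], vector [- A$2$1, A$1$1]]"

lemma adj2_nth [simp]:
  "adj2 A $ 1 $ 1 = A$2$2" "adj2 A $ 1 $ 2 = - A$1$2" "adj2 A $ 2 $ 1 = - A$2$1" "adj2 A $ 2 $ 2 = A$1$1"
  by (simp_all add: adj2_def)

lemma mat2_eq_iff: "A = B \<longleftrightarrow> A$1$1 = B$1$1 \<and> A$1$2 = B$1$2 \<and> A$2$1 = B$2$1 \<and> A$2$2 = B$2$2"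
  for A B :: "'a^2^2"
  by (auto simp: vec_eq_iff forall_2)

lemma mult2_nth: "(A ** B) $ i $ j = A$i$1 * B$1$j + A$i$2 * B$2$j" for A B :: mat2
  by (simp add: matrix_matrix_mult_def sum_2)

lemma mat_nth2 [simp]: "(mat k :: 'a::zero^2^2) $ 1 $ 1 = k" "(mat k :: 'a^2^2) $ 1 $ 2 = 0"
  "(mat k :: 'a^2^2) $ 2 $ 1 = 0" "(mat k :: 'a^2^2) $ 2 $ 2 = k"
  by (simp_all add: mat_def)

lemma trace2: "trace A = A$1$1 + A$2$2" for A :: mat2
  by (simp add: trace_def sum_2)

lemma adj2_mult: "adj2 (A ** B) = adj2 B ** adj2 A"
  by (simp add: mat2_eq_iff mult2_nth algebra_simps)

lemma adj2_adj2 [simp]: "adj2 (adj2 A) = A"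
  by (simp add: mat2_eq_iff)

lemma adj2_one [simp]: "adj2 (mat 1) = mat 1"
  by (simp add: mat2_eq_iff)

lemma det_adj2 [simp]: "det (adj2 A) = det A"
  by (simp add: det_2 algebra_simps)

lemma adj2_inverse: assumes "det A = 1" shows "adj2 A ** A = mat 1" "A ** adj2 A = mat 1"
  using assms by (simp_all add: mat2_eq_iff mult2_nth det_2 algebra_simps)

lemma adj2_cancel: assumes "det A = 1" shows "adj2 A ** (A ** B) = B" "A ** (adj2 A ** B) = B"
  using adj2_inverse[OF assms] by (simp_all add: matrix_mul_assoc)

lemma cayley_hamilton2: "A ** A = mat (trace A) ** A - mat (det A)" for A :: mat2
  by (simp add: mat2_eq_iff mult2_nth trace2 det_2 algebra_simps)

lemma norm_mat2: "(norm A)\<^sup>2 = (cmod (A$1$1))\<^sup>2 + (cmod (A$1$2))\<^sup>2 + (cmod (A$2$1))\<^sup>2 + (cmod (A$2$2))\<^sup>2"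
  for A :: mat2
  by (simp add: norm_vec_def L2_set_def sum_2)

lemma norm_adj2 [simp]: "norm (adj2 A) = norm A"
  by (rule power2_eq_imp_eq) (simp_all add: norm_mat2)

lemma norm_mult2: "norm (A ** B) \<le> norm A * norm B" for A B :: mat2
proof -
  have cs: "(cmod (a * x + b * y))\<^sup>2 \<le> ((cmod a)\<^sup>2 + (cmod b)\<^sup>2) * ((cmod x)\<^sup>2 + (cmod y)\<^sup>2)" for a b x y
  proof -
    have "(cmod (a * x + b * y))\<^sup>2 \<le> (cmod a * cmod x + cmod b * cmod y)\<^sup>2"
      using norm_triangle_ineq[of "a * x" "b * y"] by (intro power_mono) (auto simp: norm_mult)
    also have "\<dots> \<le> ((cmod a)\<^sup>2 + (cmod b)\<^sup>2) * ((cmod x)\<^sup>2 + (cmod y)\<^sup>2)"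
      using zero_le_power2[of "cmod a * cmod y - cmod b * cmod x"]
      by (simp add: power2_eq_square algebra_simps)
    finally show ?thesis .
  qed
  have "(norm (A ** B))\<^sup>2 \<le> (norm A * norm B)\<^sup>2"
    using cs[of "A$1$1" "B$1$1" "A$1$2" "B$2$1"] cs[of "A$1$1" "B$1$2" "A$1$2" "B$2$2"]
      cs[of "A$2$1" "B$1$1" "A$2$2" "B$2$1"] cs[of "A$2$1" "B$1$2" "A$2$2" "B$2$2"]
    by (simp add: power_mult_distrib norm_mat2 mult2_nth algebra_simps)
  then show ?thesis by (rule power2_le_imp_le) auto
qed

lemma norm_trace2: "cmod (trace A) \<le> 2 * norm A" for A :: mat2
proof -
  have "cmod (A$i$j) \<le> norm A" for i j
    by (meson Finite_Cartesian_Product.norm_nth_le order_trans)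
  then show ?thesis using norm_triangle_ineq[of "A$1$1" "A$2$2"] unfolding trace2
    by (smt (verit))
qed

lemma norm_SL2_ge: assumes "det A = 1" shows "2 \<le> (norm (A::mat2))\<^sup>2"
proof -
  have "1 = cmod (A$1$1 * A$2$2 - A$1$2 * A$2$1)" using assms by (simp add: det_2)
  also have "\<dots> \<le> cmod (A$1$1) * cmod (A$2$2) + cmod (A$1$2) * cmod (A$2$1)"
    using norm_triangle_ineq4[of "A$1$1 * A$2$2" "A$1$2 * A$2$1"] by (simp add: norm_mult)
  finally have "2 \<le> 2 * (cmod (A$1$1) * cmod (A$2$2)) + 2 * (cmod (A$1$2) * cmod (A$2$1))" by simp
  also have "\<dots> \<le> (norm A)\<^sup>2"
    using zero_le_power2[of "cmod (A$1$1) - cmod (A$2$2)"] zero_le_power2[of "cmod (A$1$2) - cmod (A$2$1)"]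
    unfolding norm_mat2 by (simp add: power2_eq_square algebra_simps)
  finally show ?thesis .
qed

text \<open>By \<open>norm_adj2_mult\<close> below, \<open>(norm A)\<^sup>2 = 2 cosh d\<close>, where \<open>d\<close> is the distance by which \<open>A\<close> moves the
  base point of hyperbolic space; hence \<open>displ A = 2 sinh (d / 2)\<close>.\<close>

definition displ :: "mat2 \<Rightarrow> real" where
  "displ A = sqrt ((norm A)\<^sup>2 - 2)"

lemma displ_sq: "det A = 1 \<Longrightarrow> (displ A)\<^sup>2 = (norm A)\<^sup>2 - 2"
  using norm_SL2_ge[of A] by (simp add: displ_def)

lemma displ_nonneg: "det A = 1 \<Longrightarrow> 0 \<le> displ A"
  using norm_SL2_ge[of A] by (simp add: displ_def)

lemma displ_le_norm: "det A = 1 \<Longrightarrow> displ A \<le> norm A"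
  unfolding displ_def by (rule real_le_lsqrt) auto

lemma norm_le_displ: assumes "det A = 1" "1 \<le> displ A" shows "norm A \<le> 2 * displ A"
proof (rule power2_le_imp_le)
  have "1 \<le> (displ A)\<^sup>2" using assms(2) by simp
  then show "(norm A)\<^sup>2 \<le> (2 * displ A)\<^sup>2"
    using displ_sq[OF assms(1)] by (simp add: power_mult_distrib)
qed (use assms in auto)

text \<open>The image of the base point (0, 1) under the Poincare extension of
  \<open>A\<close>.\<close>

definition orbit_pt :: "mat2 \<Rightarrow> complex \<times> real" where
  "orbit_pt A = (let N = (cmod (A$2$1))\<^sup>2 + (cmod (A$2$2))\<^sup>2 in
     ((A$1$1 * cnj (A$2$1) + A$1$2 * cnj (A$2$2)) / of_real N, 1 / N))"

lemma det_row_pos: assumes "det (A :: mat2) = 1" shows "0 < (cmod (A$2$1))\<^sup>2 + (cmod (A$2$2))\<^sup>2"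
proof -
  have "A$2$1 \<noteq> 0 \<or> A$2$2 \<noteq> 0" using assms by (auto simp: det_2)
  then show ?thesis by (auto intro: add_pos_nonneg add_nonneg_pos)
qed

lemma snd_orbit_pt_pos: "det A = 1 \<Longrightarrow> 0 < snd (orbit_pt A)"
  using det_row_pos[of A] by (simp add: orbit_pt_def Let_def)

text \<open>With \<open>A A\<^sup>* = [[p, q], [cnj q, s]]\<close> of determinant 1, the point \<open>orbit_pt A\<close> is \<open>(q / s, 1 / s)\<close>,
  and the squared norm of \<open>A\<^sup>-\<^sup>1 B\<close> is the trace of \<open>(A A\<^sup>*)\<^sup>-\<^sup>1 (B B\<^sup>*)\<close>.\<close>

lemma norm_adj2_mult:
  assumes A: "det A = 1" and B: "det B = 1"
  shows "(norm (adj2 A ** B))\<^sup>2 - 2 =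
    (dist (orbit_pt A) (orbit_pt B))\<^sup>2 / (snd (orbit_pt A) * snd (orbit_pt B))"
proof -
  define p where "p X = (cmod (X$1$1))\<^sup>2 + (cmod (X$1$2))\<^sup>2" for X :: mat2
  define s where "s X = (cmod (X$2$1))\<^sup>2 + (cmod (X$2$2))\<^sup>2" for X :: mat2
  define q where "q X = X$1$1 * cnj (X$2$1) + X$1$2 * cnj (X$2$2)" for X :: mat2
  have s: "0 < s X" if "det X = 1" for X using det_row_pos[OF that] by (simp add: s_def)
  have pt: "orbit_pt X = (q X / of_real (s X), 1 / s X)" for X
    by (simp add: orbit_pt_def q_def s_def Let_def)
  have pc: "complex_of_real (p X) = X$1$1 * cnj (X$1$1) + X$1$2 * cnj (X$1$2)"
    and sc: "complex_of_real (s X) = X$2$1 * cnj (X$2$1) + X$2$2 * cnj (X$2$2)" for X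
    by (simp_all only: p_def s_def of_real_add complex_norm_square)
  have ps: "p X * s X = (cmod (q X))\<^sup>2 + 1" if "det X = 1" for X
  proof -
    have d: "X$1$1 * X$2$2 - X$1$2 * X$2$1 = 1" using that by (simp add: det_2)
    then have "cnj (X$1$1 * X$2$2 - X$1$2 * X$2$1) = 1" by (metis complex_cnj_one)
    with d have "(X$1$1 * X$2$2 - X$1$2 * X$2$1) * cnj (X$1$1 * X$2$2 - X$1$2 * X$2$1) = 1" by simp
    moreover have "complex_of_real (p X * s X) - q X * cnj (q X) =
        (X$1$1 * X$2$2 - X$1$2 * X$2$1) * cnj (X$1$1 * X$2$2 - X$1$2 * X$2$1)"
      unfolding of_real_mult pc sc q_def by (simp add: algebra_simps)
    ultimately have "complex_of_real (p X * s X) = complex_of_real ((cmod (q X))\<^sup>2 + 1)"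
      by (simp only: of_real_add complex_norm_square of_real_1) (simp add: algebra_simps del: of_real_mult)
    then show ?thesis by (simp only: of_real_eq_iff)
  qed
  have n: "(norm (adj2 A ** B))\<^sup>2 = s A * p B + p A * s B - 2 * Re (q A * cnj (q B))"
  proof -
    have "complex_of_real ((norm (adj2 A ** B))\<^sup>2) =
       of_real (s A * p B + p A * s B) - (q A * cnj (q B) + cnj (q A * cnj (q B)))"
      unfolding norm_mat2 of_real_add of_real_mult pc sc q_def complex_norm_square mult2_nth adj2_nth
      by (simp add: algebra_simps)
    also have "\<dots> = complex_of_real (s A * p B + p A * s B - 2 * Re (q A * cnj (q B)))"
      by (simp only: complex_add_cnj of_real_diff)
    finally show ?thesis by (simp only: of_real_eq_iff)
  qed
  have "(cmod (q A / of_real (s A) - q B / of_real (s B)))\<^sup>2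
     = (cmod (q A))\<^sup>2 / (s A)\<^sup>2 + (cmod (q B))\<^sup>2 / (s B)\<^sup>2 - 2 * Re (q A * cnj (q B)) / (s A * s B)"
  proof -
    have sub: "(cmod (x - y))\<^sup>2 = (cmod x)\<^sup>2 + (cmod y)\<^sup>2 - 2 * Re (x * cnj y)" for x y
      by (simp add: cmod_power2 power2_diff algebra_simps)
    have re: "Re (q A / of_real (s A) * cnj (q B / of_real (s B))) = Re (q A * cnj (q B)) / (s A * s B)"
      by (simp add: complex_cnj_divide flip: of_real_mult)
    show ?thesis
      unfolding sub re using s[OF A] s[OF B] by (simp add: norm_divide power_divide)
  qed
  moreover have "(dist (orbit_pt A) (orbit_pt B))\<^sup>2 =
     (cmod (q A / of_real (s A) - q B / of_real (s B)))\<^sup>2 + (1 / s A - 1 / s B)\<^sup>2"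
    by (simp add: pt dist_prod_def dist_norm)
  ultimately have d: "(dist (orbit_pt A) (orbit_pt B))\<^sup>2 =
    (p A * s A - 1) / (s A)\<^sup>2 + (p B * s B - 1) / (s B)\<^sup>2 - 2 * Re (q A * cnj (q B)) / (s A * s B)
     + (1 / s A - 1 / s B)\<^sup>2" using ps[OF A] ps[OF B] by simp
  have sq: "(x * y - 1) / y\<^sup>2 = x / y - 1 / y\<^sup>2" if "0 < y" for x y :: real
    using that by (simp add: field_simps power2_eq_square)
  have "(1 / s A - 1 / s B)\<^sup>2 = 1 / (s A)\<^sup>2 + 1 / (s B)\<^sup>2 - 2 / (s A * s B)"
    by (simp add: power2_diff power_divide)
  with d sq[OF s[OF A], of "p A"] sq[OF s[OF B], of "p B"]
  have D: "(dist (orbit_pt A) (orbit_pt B))\<^sup>2 =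
      p A / s A + p B / s B - 2 * Re (q A * cnj (q B)) / (s A * s B) - 2 / (s A * s B)"
    by linarith
  have key: "(x / u + y / v - z / (u * v) - 2 / (u * v)) / (1 / u * (1 / v)) = u * y + x * v - z - 2"
    if "0 < u" "0 < v" for x y z u v :: real
    using that by (simp add: field_simps)
  have snd: "snd (orbit_pt X) = 1 / s X" for X by (simp add: pt)
  show ?thesis unfolding n D snd by (rule key[symmetric]; rule s, fact)
qed

lemma displ_orbit_pt:
  assumes "det A = 1" "det B = 1"
  shows "displ (adj2 A ** B) = dist (orbit_pt A) (orbit_pt B) / (sqrt (snd (orbit_pt A)) * sqrt (snd (orbit_pt B)))"
  unfolding displ_def norm_adj2_mult[OF assms] by (simp add: real_sqrt_divide real_sqrt_mult)

abbreviation (input) gap :: "(nat \<Rightarrow> mat2) \<Rightarrow> nat \<Rightarrow> nat \<Rightarrow> real" where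
  "gap P i j \<equiv> displ (adj2 (P i) ** P j)"

text \<open>By \<open>displ_orbit_pt\<close> all three products in Ptolemy's inequality carry the
  same denominator, one root of a height for each of the four points, so the Euclidean inequality
  transfers.\<close>

lemma ptolemaic_displ:
  assumes P: "\<And>i. det (P i) = 1"
  shows "ptolemaic (gap P)"
proof
  let ?p = "\<lambda>i. orbit_pt (P i)" and ?t = "\<lambda>i. sqrt (snd (orbit_pt (P i)))"
  have t: "0 < ?t i" for i using snd_orbit_pt_pos[OF P] by simp
  fix i j k l
  show "0 \<le> gap P i j"
    by (intro displ_nonneg) (simp add: det_mul P)
  show "gap P i j = gap P j i"
    by (simp add: displ_orbit_pt P dist_commute mult.commute)
  have "dist (?p i) (?p j) * dist (?p k) (?p l) / (?t i * ?t j * ?t k * ?t l)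
      \<le> (dist (?p i) (?p k) * dist (?p j) (?p l) + dist (?p i) (?p l) * dist (?p j) (?p k)) / (?t i * ?t j * ?t k * ?t l)"
    using t by (intro divide_right_mono ptolemy_inner) (simp add: less_imp_le)
  then show "gap P i j * gap P k l
      \<le> gap P i k * gap P j l + gap P i l * gap P j k"
    unfolding displ_orbit_pt[OF P P] by (simp add: add_divide_distrib mult_ac)
qed

section \<open>Words evaluated in matrices of determinant 1\<close>

fun lmat :: "('a \<Rightarrow> mat2) \<Rightarrow> 'a \<times> bool \<Rightarrow> mat2" where
  "lmat B (i, s) = (if s then B i else adj2 (B i))"

text \<open>Evaluation does not reduce, so concatenation is matrix multiplication for arbitrary
  words; \<open>wmat_foldr_push\<close> adds that free cancellation does not change the
  value.\<close>

definition wmat :: "('a \<Rightarrow> mat2) \<Rightarrow> 'a word \<Rightarrow> mat2" where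
  "wmat B u = foldr (\<lambda>a. (**) (lmat B a)) u (mat 1)"

lemma wmat_Nil [simp]: "wmat B [] = mat 1" by (simp add: wmat_def)
lemma wmat_Cons [simp]: "wmat B (a # u) = lmat B a ** wmat B u" by (simp add: wmat_def)

lemma wmat_append: "wmat B (u @ v) = wmat B u ** wmat B v"
  by (induction u) (simp_all add: matrix_mul_assoc)

lemma det_lmat: "det (B (fst a)) = 1 \<Longrightarrow> det (lmat B a) = 1"
  by (cases a) simp

lemma det_wmat: "(\<And>i. det (B i) = 1) \<Longrightarrow> det (wmat B u) = 1"
  by (induction u) (simp_all add: det_mul det_lmat)

lemma wmat_push:
  assumes "\<And>i. det (B i) = 1" shows "wmat B (push a u) = lmat B a ** wmat B u"
proof (cases u)
  case (Cons b v)
  obtain i s where a: "a = (i, s)" by (cases a)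
  show ?thesis
    by (cases b) (auto simp: Cons a adj2_cancel[OF assms])
qed simp

lemma wmat_foldr_push:
  assumes "\<And>i. det (B i) = 1" shows "wmat B (foldr push u v) = wmat B u ** wmat B v"
  by (induction u) (simp_all add: wmat_push[OF assms] matrix_mul_assoc)

lemma norm_wmat_le:
  assumes "1 \<le> \<beta>" "\<And>a. a \<in> set u \<Longrightarrow> norm (B (fst a)) \<le> \<beta>"
  shows "norm (wmat B u) \<le> 2 * \<beta> ^ length u"
  using assms(2)
proof (induction u)
  case Nil
  have "norm (mat 1 :: mat2) \<le> 2"
    by (rule power2_le_imp_le) (simp_all add: norm_mat2)
  then show ?case by simp
next
  case (Cons a u)
  have "norm (lmat B a) \<le> \<beta>" using Cons.prems[of a] by (cases a) auto
  then have "norm (lmat B a) * norm (wmat B u) \<le> \<beta> * (2 * \<beta> ^ length u)"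
    using Cons assms(1) by (intro mult_mono) auto
  then show ?case using norm_mult2[of "lmat B a" "wmat B u"] by simp
qed

lemma wmat_conj:
  assumes "det g = 1" shows "wmat (\<lambda>i. adj2 g ** B i ** g) u = adj2 g ** wmat B u ** g"
proof (induction u)
  case (Cons a u)
  have l: "lmat (\<lambda>i. adj2 g ** B i ** g) a = adj2 g ** lmat B a ** g"
    by (cases a) (simp add: adj2_mult matrix_mul_assoc)
  have "g ** (adj2 g ** (wmat B u ** g)) = wmat B u ** g"
    by (rule adj2_cancel(2)[OF assms])
  then show ?case unfolding wmat_Cons l Cons by (simp only: matrix_mul_assoc[symmetric])
qed (simp add: adj2_inverse[OF assms])

lemma trace_conj: "det g = 1 \<Longrightarrow> trace (adj2 g ** A ** g) = trace A" for A :: mat2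
  by (subst trace_mul_sym) (simp add: adj2_cancel)

section \<open>Expanding products of matrices\<close>

definition seg :: "(nat \<Rightarrow> 'a) \<Rightarrow> nat \<Rightarrow> nat \<Rightarrow> 'a list" where
  "seg a j m = map a [j..<j + m]"

lemma length_seg [simp]: "length (seg a j m) = m" by (simp add: seg_def)

lemma seg_0 [simp]: "seg a j 0 = []" by (simp add: seg_def)

lemma seg_append: "seg a j (m + k) = seg a j m @ seg a (j + m) k"
  by (simp add: seg_def upt_add_eq_append[of j "j + m" k] add.assoc[symmetric] del: upt_Suc)

lemma seg_periodic:
  assumes "\<And>i. a (i + l) = a i" shows "seg a (j + l) m = seg a j m"
  using assms by (auto simp: seg_def intro!: nth_equalityI)
    (metis add.assoc add.commute)

lemma adj2_wmat_seg:
  assumes "\<And>i. det (B i) = 1"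
  shows "adj2 (wmat B (seg a j m)) ** wmat B (seg a j (m + k)) = wmat B (seg a (j + m) k)"
  by (simp add: seg_append wmat_append adj2_cancel[OF det_wmat[OF assms]])

text \<open>Growing k removes the constants: if x > y, then (x / y)^k eventually exceeds K /
  c.\<close>

lemma power_le_power_imp_le:
  fixes x y c K :: real
  assumes c: "0 < c" and x: "0 \<le> x" and y: "0 < y" and le: "\<And>k. 1 \<le> k \<Longrightarrow> c * x ^ k \<le> K * y ^ k"
  shows "x \<le> y"
proof (rule ccontr)
  assume "\<not> x \<le> y"
  then have gt: "1 < x / y" using y by simp
  obtain k where k: "K / c < (x / y) ^ k" using real_arch_pow[OF gt] by blast
  have "(x / y) ^ k \<le> (x / y) ^ Suc k" using gt by (intro power_increasing) auto
  then have "K / c < (x / y) ^ Suc k" using k by linarith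
  then have "K * y ^ Suc k < c * x ^ Suc k" using c y by (simp add: field_simps)
  then show False using le[of "Suc k"] by simp
qed

lemma norm_mat_scale: "norm (mat c ** A) = cmod c * norm A" for A :: mat2
  by (rule power2_eq_imp_eq) (simp_all add: norm_mat2 mult2_nth norm_mult power_mult_distrib algebra_simps)

primrec mpow :: "mat2 \<Rightarrow> nat \<Rightarrow> mat2" where
  "mpow A 0 = mat 1"
| "mpow A (Suc m) = A ** mpow A m"

text \<open>Cayley-Hamilton turns powers into the recursion A^m = tr(A) A^(m-1) - A^(m-2), whose
  growth rate is at most |tr A| + 1. This is the passage from displacements to traces.\<close>

lemma norm_mpow_le:
  assumes "det A = 1"
  shows "norm (mpow A m) \<le> (2 + norm A) * (cmod (trace A) + 1) ^ m"
proof (induction m rule: less_induct)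
  case (less m)
  let ?t = "cmod (trace A)"
  have one: "norm (mat 1 :: mat2) \<le> 2"
    by (rule power2_le_imp_le) (simp_all add: norm_mat2)
  consider "m = 0" | "m = 1" | k where "m = Suc (Suc k)"
    by (metis One_nat_def not0_implies_Suc)
  then show ?case
  proof cases
    case 1
    then show ?thesis using one by (simp add: add_increasing2)
  next
    case 2
    have "norm A * 1 \<le> (2 + norm A) * (?t + 1)" by (intro mult_mono) auto
    then show ?thesis using 2 by simp
  next
    case 3
    have "mpow A m = mat (trace A) ** mpow A (Suc k) - mpow A k"
    proof -
      have "mpow A m = (A ** A) ** mpow A k" by (simp add: 3 matrix_mul_assoc)
      also have "\<dots> = (mat (trace A) ** A) ** mpow A k - mpow A k"
        unfolding cayley_hamilton2[of A] assms by (simp add: mat2_eq_iff mult2_nth algebra_simps)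
      finally show ?thesis by (simp add: matrix_mul_assoc)
    qed
    then have "norm (mpow A m) \<le> ?t * norm (mpow A (Suc k)) + norm (mpow A k)"
      using norm_triangle_ineq4[of "mat (trace A) ** mpow A (Suc k)" "mpow A k"] by (simp add: norm_mat_scale)
    also have "\<dots> \<le> ?t * ((2 + norm A) * (?t + 1) ^ Suc k) + (2 + norm A) * (?t + 1) ^ k"
      using less[of "Suc k"] less[of k] 3 by (intro add_mono mult_left_mono) auto
    also have "\<dots> \<le> ?t * ((2 + norm A) * (?t + 1) ^ Suc k) + (2 + norm A) * (?t + 1) ^ Suc k"
      by (intro add_mono mult_left_mono power_increasing) auto
    also have "\<dots> = (2 + norm A) * (?t + 1) ^ m" by (simp add: 3 algebra_simps)
    finally show ?thesis .
  qed
qed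

lemma wmat_seg_periodic:
  fixes a :: "nat \<Rightarrow> 'a \<times> bool"
  assumes "\<And>i. a (i + l) = a i"
  shows "wmat B (seg a 0 (l * k)) = mpow (wmat B (seg a 0 l)) k"
proof (induction k)
  case (Suc k)
  have "seg a l (l * k) = seg a 0 (l * k)" using seg_periodic[of a l 0] assms by simp
  then show ?case using Suc seg_append[of a 0 l "l * k"] by (simp add: wmat_append)
qed simp

abbreviation (input) seg_displ :: "('a \<Rightarrow> mat2) \<Rightarrow> (nat \<Rightarrow> 'a \<times> bool) \<Rightarrow> nat \<Rightarrow> nat \<Rightarrow> real" where
  "seg_displ B a j m \<equiv> displ (wmat B (seg a j m))"

text \<open>The hypotheses of \<open>local_to_global\<close> for blocks of length \<open>N\<close>,
  at every starting position. They concern words of length at most 2 N, so over a finite alphabet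
  only finitely many different conditions occur.\<close>

definition locally_expanding :: "('a \<Rightarrow> mat2) \<Rightarrow> (nat \<Rightarrow> 'a \<times> bool) \<Rightarrow> nat \<Rightarrow> bool" where
  "locally_expanding B a N \<longleftrightarrow> (\<forall>j. 0 < seg_displ B a j N \<and>
     3 * seg_displ B a j N \<le> seg_displ B a j (N + N) \<and>
     3 * seg_displ B a (j + N) N \<le> seg_displ B a j (N + N))"

text \<open>l k blocks of length \<open>N\<close> are also N k periods of length l. The displacement
  of this word is at least a constant times 2^(l k) by \<open>local_to_global\<close>, and at most a
  constant times (|tr| + 1)^(N k) by \<open>norm_mpow_le\<close>; k-th roots give the claim.\<close>

lemma trace_growth:
  assumes B: "\<And>i. det (B i) = 1" and loc: "locally_expanding B a N"
    and per: "\<And>i. a (i + l) = a i" and l: "1 \<le> l"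
  shows "2 ^ l \<le> (cmod (trace (wmat B (seg a 0 l))) + 1) ^ N"
proof -
  define P where "P i = wmat B (seg a 0 (i * N))" for i
  have dP: "det (P i) = 1" for i by (simp add: P_def det_wmat B)
  interpret ptolemaic "gap P"
    by (rule ptolemaic_displ[OF dP])
  have 1: "adj2 (P i) ** P (Suc i) = wmat B (seg a (i * N) N)" for i
    using adj2_wmat_seg[OF B, where a = a and j = 0 and m = "i * N" and k = N] by (simp add: P_def add.commute)
  have 2: "adj2 (P i) ** P (i + 2) = wmat B (seg a (i * N) (N + N))" for i
    using adj2_wmat_seg[OF B, where a = a and j = 0 and m = "i * N" and k = "N + N"] by (simp add: P_def algebra_simps)
  let ?A = "wmat B (seg a 0 l)"
  let ?d = "seg_displ B a 0 N"
  have d: "0 < ?d" using loc by (auto simp: locally_expanding_def)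
  have lg: "2 ^ n * ?d \<le> displ (P (Suc n))" for n
  proof -
    have "2 ^ n * gap P 0 1 \<le> gap P 0 (Suc n)"
    proof (rule local_to_global)
      fix i
      show "3 * gap P i (Suc i) \<le> gap P i (i + 2)"
        "0 < gap P i (Suc i)"
        unfolding 1 2 using loc by (auto simp: locally_expanding_def)
      have "adj2 (P (Suc i)) ** P (i + 2) = wmat B (seg a (i * N + N) N)"
        using 1[of "Suc i"] by (simp add: add.commute)
      then show "3 * gap P (Suc i) (i + 2) \<le> gap P i (i + 2)"
        unfolding 2 using loc by (auto simp: locally_expanding_def)
    qed
    then show ?thesis using 1[of 0] by (simp add: P_def)
  qed
  have "?d / 2 * (2 ^ l) ^ k \<le> (2 + norm ?A) * ((cmod (trace ?A) + 1) ^ N) ^ k" if k1: "1 \<le> k" for k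
  proof -
    obtain n where n: "l * k = Suc n" using k1 l by (cases "l * k") auto
    have "?d / 2 * (2 ^ l) ^ k = 2 ^ n * ?d" by (simp add: power_mult[symmetric] n)
    also have "\<dots> \<le> displ (P (l * k))" using lg[of n] n by simp
    also have "\<dots> \<le> norm (P (l * k))" by (rule displ_le_norm[OF dP])
    also have "P (l * k) = mpow ?A (N * k)"
      unfolding P_def using wmat_seg_periodic[where a = a and l = l and B = B and k = "N * k"] per by (simp add: mult_ac)
    also have "norm \<dots> \<le> (2 + norm ?A) * (cmod (trace ?A) + 1) ^ (N * k)"
      by (rule norm_mpow_le) (simp add: det_wmat B)
    finally show ?thesis by (simp add: power_mult)
  qed
  moreover have "0 < (cmod (trace ?A) + 1) ^ N" by (intro zero_less_power add_nonneg_pos) auto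
  ultimately show ?thesis using d power_le_power_imp_le[of "?d / 2" "2 ^ l"] by auto
qed

text \<open>The squared norm is comparable to the exponential of the distance moved, so this is a
  linear lower bound for distances in exponential form, uniform in the sequence and the
  position.\<close>

definition expanding :: "('a \<Rightarrow> mat2) \<Rightarrow> (nat \<Rightarrow> 'a \<times> bool) set \<Rightarrow> bool" where
  "expanding B S \<longleftrightarrow> (\<exists>c \<mu>. 0 < c \<and> 1 < \<mu> \<and> (\<forall>a\<in>S. \<forall>j m. c * \<mu> ^ m \<le> (norm (wmat B (seg a j m)))\<^sup>2))"

lemma expanding_blocks:
  assumes B: "\<And>i. det (B i) = 1" and S: "expanding B S"
  obtains N where "1 \<le> N" "\<And>a j m. a \<in> S \<Longrightarrow> 1 \<le> m \<Longrightarrow> 2 ^ m \<le> seg_displ B a j (N * m)"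
proof -
  obtain c \<mu> where c: "0 < c" "1 < \<mu>" and H: "\<And>a j m. a \<in> S \<Longrightarrow> c * \<mu> ^ m \<le> (norm (wmat B (seg a j m)))\<^sup>2"
    using S by (auto simp: expanding_def)
  \<comment> \<open>6 / c absorbs \<open>c\<close> in the first block, and growth by 6 per block
    leaves 6^m - 2 >= 4^m, which pays for the 2 subtracted in \<open>displ\<close>.\<close>
  obtain N where N: "max 6 (6 / c) < \<mu> ^ N" using real_arch_pow[OF c(2)] by blast
  have "\<mu> ^ N \<noteq> 1" using N by auto
  then have N1: "1 \<le> N" by (cases N) auto
  have "2 ^ m \<le> seg_displ B a j (N * m)" if aS: "a \<in> S" and m1: "1 \<le> m" for a j m
  proof -
    let ?X = "wmat B (seg a j (N * m))"
    obtain k where m: "m = Suc k" using m1 by (cases m) auto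
    have "(6::real) ^ m = 6 * 6 ^ k" by (simp add: m)
    also have "\<dots> \<le> (c * \<mu> ^ N) * (\<mu> ^ N) ^ k"
      using N c by (intro mult_mono power_mono) (auto simp: field_simps)
    also have "\<dots> = c * \<mu> ^ (N * m)" by (simp add: m power_add power_mult)
    also have "\<dots> \<le> (norm ?X)\<^sup>2" by (rule H[OF aS])
    finally have 1: "6 ^ m \<le> (norm ?X)\<^sup>2" .
    have "(4::real) ^ Suc k + 2 \<le> 6 ^ Suc k"
    proof (induction k)
      case (Suc k)
      have "(0::real) < 4 ^ k" "(0::real) < 6 ^ k" by simp_all
      with Suc show ?case unfolding power_Suc by linarith
    qed simp
    moreover have "(2 ^ m)\<^sup>2 = (4::real) ^ m"
      by (simp add: power2_eq_square power_mult_distrib[symmetric])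
    ultimately have "(2 ^ m)\<^sup>2 \<le> (norm ?X)\<^sup>2 - 2" using 1 by (simp add: m)
    then show ?thesis unfolding displ_def by (rule real_le_rsqrt)
  qed
  with N1 that show ?thesis by blast
qed

text \<open>For adjacent pieces with displacements u, v and union w,
  \<open>quasigeodesic_stable\<close> gives u v <= E w. Pieces so long that u and v exceed 6 E then
  satisfy 6 u <= w and 6 v <= w.\<close>

lemma expanding_local:
  assumes B: "\<And>i. det (B i) = 1" and S: "expanding B S"
    and fin: "finite I" "\<And>a i. a \<in> S \<Longrightarrow> fst (a i) \<in> I"
  obtains N where "1 \<le> N" "\<And>a j. a \<in> S \<Longrightarrow> 1 \<le> seg_displ B a j N \<and>
     6 * seg_displ B a j N \<le> seg_displ B a j (N + N) \<and>
     6 * seg_displ B a (j + N) N \<le> seg_displ B a j (N + N)"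
proof -
  obtain M where M: "1 \<le> M" and
    low: "\<And>a j m. a \<in> S \<Longrightarrow> 1 \<le> m \<Longrightarrow> 2 ^ m \<le> seg_displ B a j (M * m)"
    using expanding_blocks[OF B S] by blast
  define \<beta> where "\<beta> = Max (insert 1 ((norm \<circ> B) ` I))"
  have \<beta>: "1 \<le> \<beta>" "\<And>i. i \<in> I \<Longrightarrow> norm (B i) \<le> \<beta>"
    unfolding \<beta>_def using fin by (auto intro!: Max_ge)
  define b where "b = 2 * \<beta> ^ M"
  have b: "norm (wmat B (seg a j M)) \<le> b" if "a \<in> S" for a j
  proof -
    have "norm (B (fst x)) \<le> \<beta>" if "x \<in> set (seg a j M)" for x
      using that fin(2)[OF \<open>a \<in> S\<close>] \<beta>(2) by (auto simp: seg_def)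
    then show ?thesis using norm_wmat_le[of \<beta> "seg a j M" B] \<beta>(1) by (simp add: b_def)
  qed
  have b1: "1 \<le> b" using one_le_power[OF \<beta>(1), of M] by (simp add: b_def)
  define E where "E = max 1 (((2*b) ^ 2) ^ nat \<lceil>4 * ((2*b) ^ 2 * (2 * b)) ^ 2\<rceil> * ((2*b) ^ 2 * (2 * b)))"
  have stable: "seg_displ B a j (M * r) * seg_displ B a (j + M * r) (M * s)
      \<le> E * displ (wmat B (seg a j (M * (r + s))))" if a: "a \<in> S" and rs: "1 \<le> r" "1 \<le> s" for a j r s
  proof -
    define P where "P i = wmat B (seg a j (M * i))" for i
    have dP: "det (P i) = 1" for i by (simp add: P_def det_wmat B)
    interpret ptolemaic "gap P"
      by (rule ptolemaic_displ[OF dP])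
    have P: "adj2 (P i) ** P (i + k) = wmat B (seg a (j + M * i) (M * k))" for i k
      using adj2_wmat_seg[OF B, where a = a and j = j and m = "M * i" and k = "M * k"] by (simp add: P_def algebra_simps)
    have low': "2 ^ (k - i) \<le> gap P i k" if "i < k" for i k
      using P[of i "k - i"] low[OF a, of "k - i"] that by simp
    have low1: "1 \<le> gap P i k" if "i \<noteq> k" for i k
    proof (cases "i < k")
      case True
      have "(1::real) \<le> 2 ^ (k - i)" by simp
      with low'[OF True] show ?thesis by linarith
    next
      case False
      then have "k < i" using that by simp
      have "(1::real) \<le> 2 ^ (i - k)" by simp
      with low'[OF \<open>k < i\<close>] sym[of k i] show ?thesis by linarith
    qed
    have dd: "det (adj2 (P i) ** P k) = 1" for i k by (simp add: det_mul dP)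
    have nb: "norm (adj2 (P i) ** P (Suc i)) \<le> b" for i
      using P[of i 1] b[OF a] by simp
    have nb': "norm (adj2 (P (Suc i)) ** P i) \<le> b" for i
      using nb[of i] norm_adj2[of "adj2 (P i) ** P (Suc i)"] by (simp add: adj2_mult)
    \<comment> \<open>Submultiplicativity of the norm replaces the missing triangle inequality.
      Passing from norms back to \<open>displ\<close> costs the factor 2 of
      \<open>norm_le_displ\<close>, which needs a displacement of at least 1.\<close>
    have lip: "gap P i l \<le> 2 * b * gap P i k"
      if "i \<noteq> k" "norm (adj2 (P k) ** P l) \<le> b" for i k l
    proof -
      have "adj2 (P i) ** P l = (adj2 (P i) ** P k) ** (adj2 (P k) ** P l)"
        by (simp add: matrix_mul_assoc[symmetric] adj2_cancel[OF dP])
      then have "norm (adj2 (P i) ** P l) \<le> norm (adj2 (P i) ** P k) * norm (adj2 (P k) ** P l)"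
        by (metis norm_mult2)
      also have "\<dots> \<le> (2 * gap P i k) * b"
        using that low1[OF that(1)] by (intro mult_mono norm_le_displ dd) auto
      finally show ?thesis using displ_le_norm[OF dd, of i l] by (simp add: mult_ac)
    qed
    have "gap P 0 r * gap P r (r + s) \<le> E * gap P 0 (r + s)"
    proof (rule quasigeodesic_stable[where b = b and K = "2 * b"])
      show "gap P i (Suc i) \<le> b" for i
        using displ_le_norm[OF dd, of i "Suc i"] nb[of i] by linarith
      show "gap P i k \<le> 2 * b * gap P i (Suc k)" if "i \<noteq> Suc k" for i k
        by (rule lip[OF that nb'])
      show "gap P i (Suc k) \<le> 2 * b * gap P i k" if "i \<noteq> k" for i k
        by (rule lip[OF that nb])
    qed (use low' b1 rs in \<open>auto simp: E_def\<close>)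
    then show ?thesis using P[of 0 r] P[of r s] P[of 0 "r + s"] by simp
  qed
  obtain L where L: "6 * E < 2 ^ L" using real_arch_pow[of 2 "6 * E"] by auto
  have E1: "1 \<le> E" by (simp add: E_def)
  have L1: "1 \<le> L" using L E1 by (cases L) auto
  show ?thesis
  proof (rule that[of "M * L"])
    show "1 \<le> M * L" using M L1 by simp
    fix a j assume a: "a \<in> S"
    let ?u = "seg_displ B a j (M * L)" and ?v = "seg_displ B a (j + M * L) (M * L)"
      and ?w = "seg_displ B a j (M * L + M * L)"
    have u: "2 ^ L \<le> ?u" and v: "2 ^ L \<le> ?v" using low[OF a L1] by auto
    have st: "?u * ?v \<le> E * ?w" using stable[OF a L1 L1, of j] by (simp add: distrib_left)
    have "(6 * E) * ?u \<le> ?v * ?u" using v L u E1 by (intro mult_right_mono) auto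
    with st have "E * (6 * ?u) \<le> E * ?w" by (simp add: mult_ac)
    then have 1: "6 * ?u \<le> ?w" using E1 by simp
    have "(6 * E) * ?v \<le> ?u * ?v" using v L u E1 by (intro mult_right_mono) auto
    with st have "E * (6 * ?v) \<le> E * ?w" by (simp add: mult_ac)
    then have 2: "6 * ?v \<le> ?w" using E1 by simp
    have "(1::real) \<le> 2 ^ L" by simp
    with u 1 2 show "1 \<le> ?u \<and> 6 * ?u \<le> ?w \<and> 6 * ?v \<le> ?w" by linarith
  qed
qed

section \<open>Persistence of local expansion near a limit\<close>

lemma tendsto_mat2_iff: "(f \<longlongrightarrow> L) F \<longleftrightarrow> (\<forall>i j. ((\<lambda>k. f k $ i $ j) \<longlongrightarrow> L $ i $ j) F)"
  for L :: mat2
proof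
  assume "(f \<longlongrightarrow> L) F"
  then show "\<forall>i j. ((\<lambda>k. f k $ i $ j) \<longlongrightarrow> L $ i $ j) F" by (intro allI tendsto_vec_nth)
next
  assume *: "\<forall>i j. ((\<lambda>k. f k $ i $ j) \<longlongrightarrow> L $ i $ j) F"
  show "(f \<longlongrightarrow> L) F"
    by (rule vec_tendstoI, rule vec_tendstoI) (use * in blast)
qed

lemma tendsto_mult2:
  fixes A B :: mat2
  assumes "(f \<longlongrightarrow> A) F" "(g \<longlongrightarrow> B) F" shows "((\<lambda>k. f k ** g k) \<longlongrightarrow> A ** B) F"
proof -
  have "((\<lambda>k. f k $ i $ j) \<longlongrightarrow> A $ i $ j) F" "((\<lambda>k. g k $ i $ j) \<longlongrightarrow> B $ i $ j) F" for i j
    using assms by (simp_all add: tendsto_mat2_iff)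
  then show ?thesis unfolding tendsto_mat2_iff mult2_nth by (intro allI tendsto_add tendsto_mult)
qed

lemma tendsto_adj2: "((\<lambda>k. adj2 (f k)) \<longlongrightarrow> adj2 A) F" if "(f \<longlongrightarrow> A) F"
  using that unfolding tendsto_mat2_iff by (simp add: forall_2 tendsto_minus)

lemma tendsto_trace2: "((\<lambda>k. trace (f k)) \<longlongrightarrow> trace (A::mat2)) F" if "(f \<longlongrightarrow> A) F"
  using that unfolding tendsto_mat2_iff trace2 by (simp add: tendsto_add)

lemma tendsto_det2: "((\<lambda>k. det (f k)) \<longlongrightarrow> det (A::mat2)) F" if "(f \<longlongrightarrow> A) F"
  using that unfolding tendsto_mat2_iff det_2 by (simp add: tendsto_diff tendsto_mult)

lemma tendsto_wmat:
  assumes "\<And>a. a \<in> set u \<Longrightarrow> ((\<lambda>k. B k (fst a)) \<longlongrightarrow> L (fst a)) F"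
  shows "((\<lambda>k. wmat (B k) u) \<longlongrightarrow> wmat L u) F"
  using assms
proof (induction u)
  case (Cons a u)
  have "((\<lambda>k. lmat (B k) a) \<longlongrightarrow> lmat L a) F"
    using Cons.prems[of a] by (cases a) (auto intro: tendsto_adj2)
  then show ?case using Cons by (auto intro!: tendsto_mult2)
qed simp

text \<open>The filter is arbitrary so that the lemma serves convergent sequences and also, with a
  constant family, a single tuple.\<close>

lemma locally_expanding_nearby:
  assumes L: "\<And>i. det (L i) = 1" and S: "expanding L S"
    and fin: "finite I" "\<And>a i. a \<in> S \<Longrightarrow> fst (a i) \<in> I"
    and lim: "\<And>i. i \<in> I \<Longrightarrow> ((\<lambda>k. B k i) \<longlongrightarrow> L i) F"
  obtains N where "1 \<le> N" "\<forall>\<^sub>F k in F. \<forall>a\<in>S. locally_expanding (B k) a N"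
proof -
  obtain N where N: "1 \<le> N" and loc: "\<And>a j. a \<in> S \<Longrightarrow> 1 \<le> seg_displ L a j N \<and>
     6 * seg_displ L a j N \<le> seg_displ L a j (N + N) \<and>
     6 * seg_displ L a (j + N) N \<le> seg_displ L a j (N + N)"
    using expanding_local[OF L S, of I] fin by blast
  define W where "W = {u. set u \<subseteq> I \<times> (UNIV :: bool set) \<and> length u \<le> N + N}"
  have "finite W" unfolding W_def using fin by (intro finite_lists_length_le) auto
  have "\<forall>\<^sub>F k in F. dist (displ (wmat (B k) u)) (displ (wmat L u)) < 1 / 4" if "u \<in> W" for u
  proof -
    have "((\<lambda>k. displ (wmat (B k) u)) \<longlongrightarrow> displ (wmat L u)) F"
      unfolding displ_def using that lim by (intro tendsto_intros tendsto_wmat) (auto simp: W_def)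
    then show ?thesis by (rule tendstoD) simp
  qed
  then have "\<forall>\<^sub>F k in F. \<forall>u\<in>W. dist (displ (wmat (B k) u)) (displ (wmat L u)) < 1 / 4"
    using \<open>finite W\<close> by (simp add: eventually_ball_finite)
  then have "\<forall>\<^sub>F k in F. \<forall>a\<in>S. locally_expanding (B k) a N"
  proof eventually_elim
    case (elim k)
    \<comment> \<open>An error of 1/4 is harmless: u >= 1 and 6 u <= w imply 3 (u + 1/4) <= w -
      1/4.\<close>
    have *: "\<bar>seg_displ (B k) a j m - seg_displ L a j m\<bar> < 1 / 4"
      if "a \<in> S" "m \<le> N + N" for a j m
    proof -
      have "seg a j m \<in> W"
        using fin(2)[OF that(1)] that(2) by (auto simp: W_def seg_def) (metis fst_conv)
      then show ?thesis using elim by (simp add: dist_real_def)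
    qed
    show ?case
    proof
      fix a assume a: "a \<in> S"
      show "locally_expanding (B k) a N"
        unfolding locally_expanding_def
      proof
        fix j
        show "0 < seg_displ (B k) a j N \<and>
         3 * seg_displ (B k) a j N \<le> seg_displ (B k) a j (N + N) \<and>
         3 * seg_displ (B k) a (j + N) N \<le> seg_displ (B k) a j (N + N)"
        proof -
          have "1 \<le> seg_displ L a j N" "1 \<le> seg_displ L a (j + N) N"
            "6 * seg_displ L a j N \<le> seg_displ L a j (N + N)"
            "6 * seg_displ L a (j + N) N \<le> seg_displ L a j (N + N)"
            using loc[OF a, of j] loc[OF a, of "j + N"] by auto
          moreover have "N \<le> N + N" by simp
          note *[OF a this, of j] *[OF a this, of "j + N"] *[OF a order_refl, of j]
          ultimately show ?thesis by linarith
        qed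
      qed
    qed
  qed
  with N that show ?thesis by blast
qed

section \<open>Automorphisms of free groups\<close>

lemma reduced_append_iff:
  "reduced (u @ v) \<longleftrightarrow> reduced u \<and> reduced v \<and> (u = [] \<or> v = [] \<or> hd v \<noteq> flip (last u))"
  by (auto simp: reduced_def successively_append_iff prod_eq_iff)

lemma reduced_tl: "reduced u \<Longrightarrow> reduced (tl u)"
  by (cases u) (auto simp: reduced_def successively_Cons)

lemma carrier_Fn: "u \<in> carrier (Fn n) \<longleftrightarrow> reduced u \<and> (\<forall>a\<in>set u. fst a < n)"
  by (auto simp: free_group_def)

lemma mult_Fn: "u \<otimes>\<^bsub>Fn n\<^esub> v = foldr push u v"
  by (simp add: free_group_def)

lemma one_Fn: "\<one>\<^bsub>Fn n\<^esub> = []"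
  by (simp add: free_group_def)

lemma letter_in_Fn [simp]: "[a] \<in> carrier (Fn n) \<longleftrightarrow> fst a < n"
  by (simp add: carrier_Fn reduced_def)

lemma gen_in_Fn [simp]: "gen i \<in> carrier (Fn n) \<longleftrightarrow> i < n"
  by (simp add: gen_def)

lemma mult_Fn_append:
  assumes "reduced (u @ v)" shows "u \<otimes>\<^bsub>Fn n\<^esub> v = u @ v"
proof -
  have "foldr push u (foldr push v []) = u @ v" using foldr_push_Nil[OF assms] by simp
  moreover have "foldr push v [] = v" using assms by (intro foldr_push_Nil) (simp add: reduced_append_iff)
  ultimately show ?thesis by (simp add: mult_Fn)
qed

lemma length_push: "length (push a w) \<le> Suc (length w)"
  by (cases "(a, w)" rule: push.cases) auto

lemma length_mult_Fn: "length (u \<otimes>\<^bsub>Fn n\<^esub> v) \<le> length u + length v"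
proof -
  have "length (foldr push u v) \<le> length u + length v"
  proof (induction u)
    case (Cons a u)
    then show ?case using length_push[of a "foldr push u v"] by simp
  qed simp
  then show ?thesis by (simp add: mult_Fn)
qed

lemma inv_letter:
  assumes "fst a < n" shows "inv\<^bsub>Fn n\<^esub> [a] = [flip a]"
  by (rule group.inv_equality[OF group_free_group]) (use assms in \<open>auto simp: mult_Fn one_Fn\<close>)

lemma cancel_hd:
  assumes u: "u \<in> carrier (Fn n)" "u \<noteq> []" "hd u = a"
  shows "[flip a] \<otimes>\<^bsub>Fn n\<^esub> u = tl u"
  using u by (cases u) (auto simp: mult_Fn)

lemma cancel_last:
  assumes u: "u \<in> carrier (Fn n)" "u \<noteq> []" "last u = flip a"
  shows "u \<otimes>\<^bsub>Fn n\<^esub> [a] = butlast u"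
proof -
  interpret group "Fn n" by (rule group_free_group)
  have eq: "butlast u @ [flip a] = u" using u by (metis append_butlast_last_id)
  have r: "reduced (butlast u @ [flip a])" unfolding eq using u by (simp add: carrier_Fn)
  have b: "butlast u \<in> carrier (Fn n)"
    using r u by (auto simp: carrier_Fn reduced_append_iff dest: in_set_butlastD)
  have a: "fst a < n" using u by (metis carrier_Fn fst_conv last_in_set)
  have "butlast u \<otimes>\<^bsub>Fn n\<^esub> [flip a] = u" using mult_Fn_append[OF r] eq by simp
  then have "u \<otimes>\<^bsub>Fn n\<^esub> [a] = butlast u \<otimes>\<^bsub>Fn n\<^esub> ([flip a] \<otimes>\<^bsub>Fn n\<^esub> [a])"
    using a b by (metis m_assoc letter_in_Fn fst_conv)
  also have "[flip a] \<otimes>\<^bsub>Fn n\<^esub> [a] = \<one>\<^bsub>Fn n\<^esub>" by (simp add: mult_Fn one_Fn)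
  finally show ?thesis using b r_one by metis
qed

section \<open>The universal property of the free group\<close>

definition letter_val :: "('g, 'm) monoid_scheme \<Rightarrow> 'g \<times> bool \<Rightarrow> 'g" where
  "letter_val G a = (if snd a then fst a else inv\<^bsub>G\<^esub> (fst a))"

lemma eval_word_simps [simp]:
  "eval_word G [] = \<one>\<^bsub>G\<^esub>"
  "eval_word G (a # w) = letter_val G a \<otimes>\<^bsub>G\<^esub> eval_word G w"
  by (simp_all add: eval_word_def letter_val_def case_prod_beta)

abbreviation (input) relabel :: "('a \<Rightarrow> 'b) \<Rightarrow> 'a word \<Rightarrow> 'b word" where
  "relabel f \<equiv> map (\<lambda>a. (f (fst a), snd a))"

context group
begin

lemma letter_val_closed: "fst a \<in> carrier G \<Longrightarrow> letter_val G a \<in> carrier G"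
  by (simp add: letter_val_def)

lemma eval_word_closed: "fst ` set w \<subseteq> carrier G \<Longrightarrow> eval_word G w \<in> carrier G"
  by (induction w) (auto simp: letter_val_closed)

lemma eval_word_relabel_closed:
  assumes "f ` X \<subseteq> carrier G" "fst ` set w \<subseteq> X"
  shows "eval_word G (relabel f w) \<in> carrier G"
  using assms by (intro eval_word_closed) fastforce

lemma eval_word_relabel_push:
  assumes f: "f ` X \<subseteq> carrier G" and aw: "fst a \<in> X" "fst ` set w \<subseteq> X"
  shows "eval_word G (relabel f (push a w)) = letter_val G (f (fst a), snd a) \<otimes> eval_word G (relabel f w)"
proof (cases w)
  case (Cons b v)
  have v: "eval_word G (relabel f v) \<in> carrier G"
    using aw Cons by (intro eval_word_relabel_closed[OF f]) auto
  have "letter_val G (f (fst a), s) \<otimes> (letter_val G (f (fst a), \<not> s) \<otimes> eval_word G (relabel f v)) = eval_word G (relabel f v)" for s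
    using v f aw(1) by (auto simp: letter_val_def image_subset_iff simp flip: m_assoc)
  then show ?thesis by (auto simp: Cons)
qed simp

text \<open>Substituting \<open>f\<close> may produce unreduced words; this is harmless because
  \<open>eval_word\<close> respects cancellation (\<open>eval_word_relabel_push\<close>).\<close>

lemma eval_word_relabel_hom:
  assumes f: "f ` X \<subseteq> carrier G"
  shows "(\<lambda>u. eval_word G (relabel f u)) \<in> hom (free_group X) G"
proof (rule homI)
  fix u v assume "u \<in> carrier (free_group X)" "v \<in> carrier (free_group X)"
  then have uv: "fst ` set u \<subseteq> X" "fst ` set v \<subseteq> X" by (auto simp: free_group_def)
  have "eval_word G (relabel f (foldr push u v)) = eval_word G (relabel f u) \<otimes> eval_word G (relabel f v)"
    using uv(1)
  proof (induction u)
    case Nil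
    then show ?case using eval_word_relabel_closed[OF f uv(2)] by simp
  next
    case (Cons a u)
    have "fst ` set (foldr push u v) \<subseteq> X" using set_foldr_push[of u v] Cons.prems uv(2) by fastforce
    then have "eval_word G (relabel f (push a (foldr push u v))) =
        letter_val G (f (fst a), snd a) \<otimes> (eval_word G (relabel f u) \<otimes> eval_word G (relabel f v))"
      using Cons eval_word_relabel_push[OF f, of a "foldr push u v"] by simp
    then show ?case
      using Cons.prems f eval_word_relabel_closed[OF f uv(2)] eval_word_relabel_closed[OF f, of u]
      by (simp add: m_assoc letter_val_closed image_subset_iff)
  qed
  then show "eval_word G (relabel f (u \<otimes>\<^bsub>free_group X\<^esub> v)) = eval_word G (relabel f u) \<otimes> eval_word G (relabel f v)"
    by (simp add: free_group_def)
qed (use f in \<open>simp add: free_group_def eval_word_relabel_closed\<close>)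

lemma eval_word_hom: "X \<subseteq> carrier G \<Longrightarrow> eval_word G \<in> hom (free_group X) G"
  using eval_word_relabel_hom[of "\<lambda>x. x" X] by simp

end

lemma reduced_Cons_append: "reduced (a # u) \<Longrightarrow> u \<in> carrier (Fn n) \<Longrightarrow> a # u = [a] \<otimes>\<^bsub>Fn n\<^esub> u"
  using mult_Fn_append[of "[a]" u n] by simp

lemma Fn_Cons: "a # u \<in> carrier (Fn n) \<Longrightarrow> fst a < n \<and> u \<in> carrier (Fn n) \<and> a # u = [a] \<otimes>\<^bsub>Fn n\<^esub> u"
  using reduced_tl[of "a # u"] reduced_Cons_append[of a u n] by (auto simp: carrier_Fn)

lemma hom_letter:
  assumes "group G" "\<theta> \<in> hom (Fn n) G" "fst a < n"
  shows "\<theta> [a] = letter_val G (\<theta> (gen (fst a)), snd a)"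
proof (cases "snd a")
  case True
  then have "[a] = gen (fst a)" by (simp add: gen_def prod_eq_iff)
  with True show ?thesis by (simp add: letter_val_def)
next
  case False
  interpret group_hom "Fn n" G \<theta>
    using assms group_free_group by (simp add: group_hom_def group_hom_axioms_def)
  from False have "[a] = inv\<^bsub>Fn n\<^esub> (gen (fst a))" using assms(3) by (simp add: gen_def inv_letter prod_eq_iff)
  with False assms(3) show ?thesis by (simp add: letter_val_def)
qed

lemma hom_eq_eval_word:
  assumes G: "group G" and \<theta>: "\<theta> \<in> hom (Fn n) G" and u: "u \<in> carrier (Fn n)"
  shows "\<theta> u = eval_word G (relabel (\<lambda>i. \<theta> (gen i)) u)"
  using u
proof (induction u)
  case Nil
  interpret group_hom "Fn n" G \<theta>
    using assms group_free_group by (simp add: group_hom_def group_hom_axioms_def)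
  show ?case using hom_one by (simp add: one_Fn)
next
  case (Cons a u)
  have a: "fst a < n" "u \<in> carrier (Fn n)" and eq: "a # u = [a] \<otimes>\<^bsub>Fn n\<^esub> u"
    using Fn_Cons[OF Cons.prems] by blast+
  have "\<theta> (a # u) = \<theta> [a] \<otimes>\<^bsub>G\<^esub> \<theta> u"
    unfolding eq using a by (intro hom_mult[OF \<theta>]) simp_all
  then show ?case using Cons.IH a hom_letter[OF G \<theta>] by simp
qed

lemma hom_eqI:
  assumes "group G" "\<theta> \<in> hom (Fn n) G" "\<theta>' \<in> hom (Fn n) G" "\<And>i. i < n \<Longrightarrow> \<theta> (gen i) = \<theta>' (gen i)"
    "u \<in> carrier (Fn n)"
  shows "\<theta> u = \<theta>' u"
proof -
  have "relabel (\<lambda>i. \<theta> (gen i)) u = relabel (\<lambda>i. \<theta>' (gen i)) u"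
    using assms(4,5) by (auto simp: carrier_Fn)
  then show ?thesis unfolding hom_eq_eval_word[OF assms(1,2,5)] hom_eq_eval_word[OF assms(1,3,5)] by (rule arg_cong)
qed

lemma reduced_relabel:
  assumes "inj_on f (fst ` set u)" shows "reduced (relabel f u) \<longleftrightarrow> reduced u"
  using assms
proof (induction u rule: induct_list012)
  case (3 a b u)
  have "f (fst b) = f (fst a) \<longleftrightarrow> fst b = fst a"
    by (rule inj_on_eq_iff[OF "3.prems"]) auto
  moreover have "inj_on f (fst ` set (b # u))" by (rule inj_on_subset[OF "3.prems"]) auto
  note "3.IH"(2)[OF this]
  ultimately show ?case by (simp add: reduced_def)
qed (auto simp: reduced_def)

text \<open>Relabelling the generators by their images, viewed as new symbols, identifies
  \<open>Fn n\<close> with the free group on these images, and \<open>eval_word\<close> after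
  relabelling is \<theta>. So the images form a free generating set.\<close>

lemma primitive_iso_gen:
  assumes \<theta>: "\<theta> \<in> iso (Fn n) (Fn n)" and i: "i < n"
  shows "primitive (Fn n) (\<theta> (gen i))"
proof -
  interpret group "Fn n" by (rule group_free_group)
  let ?b = "\<lambda>i. \<theta> (gen i)"
  let ?X = "?b ` {..<n}"
  have hom: "\<theta> \<in> hom (Fn n) (Fn n)" and bij: "bij_betw \<theta> (carrier (Fn n)) (carrier (Fn n))"
    using \<theta> by (auto simp: iso_def)
  have X: "?X \<subseteq> carrier (Fn n)" using bij by (auto dest: bij_betwE)
  have inj: "inj_on ?b {..<n}"
  proof (rule inj_onI)
    fix k l assume kl: "k \<in> {..<n}" "l \<in> {..<n}" and "\<theta> (gen k) = \<theta> (gen l)"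
    with kl have "gen k = gen l" using inj_onD[OF bij_betw_imp_inj_on[OF bij], of "gen k" "gen l"] kl by simp
    then show "k = l" by (simp add: gen_def)
  qed
  have rel: "bij_betw (relabel ?b) (carrier (Fn n)) (carrier (free_group ?X))"
  proof (rule bij_betwI')
    fix u v assume uv: "u \<in> carrier (Fn n)" "v \<in> carrier (Fn n)"
    have "inj_on (\<lambda>a. (?b (fst a), snd a)) ({..<n} \<times> UNIV)"
      using inj by (auto simp: inj_on_def)
    then have "inj_on (\<lambda>a. (?b (fst a), snd a)) (set u \<union> set v)"
      by (rule inj_on_subset) (use uv in \<open>auto simp: carrier_Fn\<close>)
    then show "relabel ?b u = relabel ?b v \<longleftrightarrow> u = v" by (rule inj_on_map_eq_map)
  next
    fix u assume u: "u \<in> carrier (Fn n)"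
    then have "fst ` set u \<subseteq> {..<n}" by (auto simp: carrier_Fn)
    then show "relabel ?b u \<in> carrier (free_group ?X)"
      using u reduced_relabel[OF inj_on_subset[OF inj]] by (fastforce simp: free_group_def)
  next
    fix v assume v: "v \<in> carrier (free_group ?X)"
    let ?c = "inv_into {..<n} ?b"
    have c: "?c (fst a) < n \<and> ?b (?c (fst a)) = fst a" if "a \<in> set v" for a
    proof -
      have "fst a \<in> ?X" using v that by (auto simp: free_group_def)
      then show ?thesis using inv_into_into[of "fst a" ?b "{..<n}"] f_inv_into_f[of "fst a" ?b "{..<n}"] by auto
    qed
    have eq: "relabel ?b (relabel ?c v) = v"
      using c by (auto simp: map_idI)
    have s: "fst ` set (relabel ?c v) \<subseteq> {..<n}" using c by auto
    have "reduced (relabel ?b (relabel ?c v))" unfolding eq using v by (simp add: free_group_def)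
    then have "reduced (relabel ?c v)" using reduced_relabel[OF inj_on_subset[OF inj s]] by blast
    then have "relabel ?c v \<in> carrier (Fn n)" using c by (auto simp: carrier_Fn)
    then show "\<exists>u\<in>carrier (Fn n). v = relabel ?b u" by (rule rev_bexI) (rule eq[symmetric])
  qed
  have ev: "eval_word (Fn n) (relabel ?b u) = \<theta> u" if "u \<in> carrier (Fn n)" for u
    using hom_eq_eval_word[OF group_free_group hom that] by simp
  have "bij_betw (eval_word (Fn n)) (carrier (free_group ?X)) (carrier (Fn n))"
  proof (rule bij_betw_comp_iff[OF rel, THEN iffD2])
    show "bij_betw (eval_word (Fn n) \<circ> relabel ?b) (carrier (Fn n)) (carrier (Fn n))"
      using bij by (rule bij_betw_cong[THEN iffD1, rotated]) (simp add: ev)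
  qed
  then have "free_generating_set (Fn n) ?X"
    using X eval_word_hom[OF X] by (simp add: free_generating_set_def iso_def)
  then show ?thesis using i by (auto simp: primitive_def)
qed

text \<open>The inverse of a Nielsen transvection uses the opposite exponent, since the letter
  \<open>j\<close> itself is fixed. Transvections drive the Euclidean algorithm and show that a
  product of two distinct generators is primitive.\<close>

lemma iso_transvection:
  assumes ij: "i < n" "j < n" "i \<noteq> j"
  obtains \<nu> where "\<nu> \<in> iso (Fn n) (Fn n)" "\<nu> (gen i) = gen i \<otimes>\<^bsub>Fn n\<^esub> [(j, e)]"
    "\<And>k. k < n \<Longrightarrow> k \<noteq> i \<Longrightarrow> \<nu> (gen k) = gen k"
proof -
  interpret group "Fn n" by (rule group_free_group)
  define b where "b e k = (if k = i then gen i \<otimes>\<^bsub>Fn n\<^esub> [(j, e)] else gen k)" for e k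
  define \<nu> where "\<nu> e u = eval_word (Fn n) (relabel (b e) u)" for e u
  have b: "b e k \<in> carrier (Fn n)" if "k < n" for e k
    using that ij by (auto simp: b_def)
  have hom: "\<nu> e \<in> hom (Fn n) (Fn n)" for e
    unfolding \<nu>_def using b by (intro eval_word_relabel_hom) auto
  have gen: "\<nu> e (gen k) = b e k" if "k < n" for e k
    using b[OF that, of e] by (simp add: \<nu>_def gen_def letter_val_def)
  have let_j: "\<nu> e [(j, s)] = [(j, s)]" for e s
  proof -
    have "\<nu> e [(j, s)] = letter_val (Fn n) (gen j, s)"
      using hom_letter[OF is_group hom[of e], of "(j, s)"] gen[of j e] ij by (simp add: b_def)
    then show ?thesis using ij by (simp add: letter_val_def gen_def inv_letter)
  qed
  have id: "\<nu> e (\<nu> (\<not> e) u) = u" if "u \<in> carrier (Fn n)" for e u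
  proof -
    have "(\<nu> e \<circ> \<nu> (\<not> e)) u = (\<lambda>u. u) u"
    proof (rule hom_eqI[OF is_group _ _ _ that])
      show "\<nu> e \<circ> \<nu> (\<not> e) \<in> hom (Fn n) (Fn n)" using hom[of e] hom[of "\<not> e"] by (auto simp: hom_def Pi_def)
      show "(\<lambda>u. u) \<in> hom (Fn n) (Fn n)" by (simp add: hom_def)
      fix k assume k: "k < n"
      show "(\<nu> e \<circ> \<nu> (\<not> e)) (gen k) = gen k"
      proof (cases "k = i")
        case True
        have "\<nu> e (gen i \<otimes>\<^bsub>Fn n\<^esub> [(j, \<not> e)]) = \<nu> e (gen i) \<otimes>\<^bsub>Fn n\<^esub> \<nu> e [(j, \<not> e)]"
          using hom[of e] ij by (intro hom_mult) auto
        also have "\<dots> = gen i \<otimes>\<^bsub>Fn n\<^esub> ([(j, e)] \<otimes>\<^bsub>Fn n\<^esub> [(j, \<not> e)])"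
          using ij by (simp add: gen let_j b_def m_assoc)
        also have "[(j, e)] \<otimes>\<^bsub>Fn n\<^esub> [(j, \<not> e)] = \<one>\<^bsub>Fn n\<^esub>" by (simp add: mult_Fn one_Fn)
        also have "gen i \<otimes>\<^bsub>Fn n\<^esub> \<one>\<^bsub>Fn n\<^esub> = gen i" using ij by (intro r_one) simp
        finally show ?thesis using True ij by (simp add: gen b_def)
      next
        case False
        then show ?thesis using k by (simp add: gen b_def)
      qed
    qed
    then show ?thesis by simp
  qed
  have "bij_betw (\<nu> e) (carrier (Fn n)) (carrier (Fn n))"
    using id[of _ e] id[of _ "\<not> e"] hom[of e] hom[of "\<not> e"]
    by (intro bij_betw_byWitness[where f' = "\<nu> (\<not> e)"]) (auto simp: hom_def)
  then have "\<nu> e \<in> iso (Fn n) (Fn n)" using hom by (simp add: iso_def)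
  then show ?thesis using that[of "\<nu> e"] gen[of _ e] ij by (simp add: b_def)
qed

abbreviation (input) conj_Fn :: "nat \<Rightarrow> nat word \<Rightarrow> nat word \<Rightarrow> nat word" where
  "conj_Fn n g x \<equiv> g \<otimes>\<^bsub>Fn n\<^esub> x \<otimes>\<^bsub>Fn n\<^esub> inv\<^bsub>Fn n\<^esub> g"

lemma iso_conj:
  assumes g: "g \<in> carrier (Fn n)"
  shows "(\<lambda>x. conj_Fn n g x) \<in> iso (Fn n) (Fn n)"
proof -
  interpret group "Fn n" by (rule group_free_group)
  have c1: "u \<otimes>\<^bsub>Fn n\<^esub> (inv\<^bsub>Fn n\<^esub> u \<otimes>\<^bsub>Fn n\<^esub> z) = z" "inv\<^bsub>Fn n\<^esub> u \<otimes>\<^bsub>Fn n\<^esub> (u \<otimes>\<^bsub>Fn n\<^esub> z) = z"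
    if "u \<in> carrier (Fn n)" "z \<in> carrier (Fn n)" for u z
    using that by (simp_all flip: m_assoc)
  have "bij_betw (\<lambda>x. conj_Fn n g x) (carrier (Fn n)) (carrier (Fn n))"
    by (rule bij_betw_byWitness[where f' = "\<lambda>x. inv\<^bsub>Fn n\<^esub> g \<otimes>\<^bsub>Fn n\<^esub> x \<otimes>\<^bsub>Fn n\<^esub> g"])
      (use g in \<open>auto simp: m_assoc c1\<close>)
  moreover have "(\<lambda>x. conj_Fn n g x) \<in> hom (Fn n) (Fn n)"
    using g by (intro homI) (auto simp: m_assoc c1)
  ultimately show ?thesis by (simp add: iso_def)
qed

section \<open>Cyclic reduction and short conjugates\<close>

definition cyclically_reduced :: "'a word \<Rightarrow> bool" where
  "cyclically_reduced w \<longleftrightarrow> reduced (w @ w)"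

lemma not_cyclically_reduced:
  assumes "reduced w" "\<not> cyclically_reduced w"
  obtains a where "w \<noteq> []" "hd w = a" "last w = flip a" "tl w \<noteq> []"
proof -
  have w: "w \<noteq> []" "hd w = flip (last w)"
    using assms by (auto simp: cyclically_reduced_def reduced_append_iff)
  \<comment> \<open>A single letter is never its own inverse.\<close>
  have tl: "tl w \<noteq> []" using w by (cases w) (auto simp: prod_eq_iff split: if_splits)
  have "last w = flip (hd w)" unfolding w(2) by simp
  then show ?thesis by (rule that[OF w(1) refl _ tl])
qed

lemma cancel_hd_last:
  assumes "w \<in> carrier (Fn n)" "w \<noteq> []" "hd w = a" "last w = flip a" "tl w \<noteq> []"
  shows "[flip a] \<otimes>\<^bsub>Fn n\<^esub> w \<otimes>\<^bsub>Fn n\<^esub> [a] = butlast (tl w)"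
proof -
  have "tl w \<in> carrier (Fn n)"
    using assms(1) reduced_tl[of w] by (auto simp: carrier_Fn dest: list.set_sel(2)[OF assms(2)])
  then have "tl w \<otimes>\<^bsub>Fn n\<^esub> [a] = butlast (tl w)"
    using assms by (intro cancel_last) (auto simp: last_tl)
  then show ?thesis using cancel_hd[OF assms(1-3)] by simp
qed

lemma exists_cyclically_reduced_conj:
  assumes "w \<in> carrier (Fn n)"
  shows "\<exists>g\<in>carrier (Fn n). cyclically_reduced (conj_Fn n g w)"
  using assms
proof (induction "length w" arbitrary: w rule: less_induct)
  case less
  interpret group "Fn n" by (rule group_free_group)
  show ?case
  proof (cases "cyclically_reduced w")
    case True
    then show ?thesis using less.prems by (intro bexI[of _ "\<one>\<^bsub>Fn n\<^esub>"]) auto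
  next
    case False
    moreover have "reduced w" using less.prems by (simp add: carrier_Fn)
    ultimately obtain a where a: "w \<noteq> []" "hd w = a" "last w = flip a" "tl w \<noteq> []"
      using not_cyclically_reduced by blast
    have an: "fst a < n" using less.prems a by (metis carrier_Fn hd_in_set)
    let ?h = "[flip a]"
    have h: "?h \<in> carrier (Fn n)" "inv\<^bsub>Fn n\<^esub> ?h = [a]" using an by (auto simp: inv_letter)
    let ?w = "?h \<otimes>\<^bsub>Fn n\<^esub> w \<otimes>\<^bsub>Fn n\<^esub> inv\<^bsub>Fn n\<^esub> ?h"
    have "length ?w < length w"
      using cancel_hd_last[OF less.prems a] a h by (cases w) auto
    moreover have "?w \<in> carrier (Fn n)" using h(1) less.prems by simp
    ultimately obtain g where g: "g \<in> carrier (Fn n)"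
      "cyclically_reduced (conj_Fn n g ?w)"
      using less.hyps by blast
    have "conj_Fn n g ?w = (g \<otimes>\<^bsub>Fn n\<^esub> ?h) \<otimes>\<^bsub>Fn n\<^esub> w \<otimes>\<^bsub>Fn n\<^esub> inv\<^bsub>Fn n\<^esub> (g \<otimes>\<^bsub>Fn n\<^esub> ?h)"
      using g(1) h(1) less.prems by (simp add: inv_mult_group m_assoc)
    then show ?thesis using g h(1) by (metis m_closed)
  qed
qed

text \<open>Among the conjugates of \<open>\<theta>\<close> take one that minimizes the total length of the images of the
  generators. If the image of some generator is too long, it has the form \<open>a v a\<^sup>-\<^sup>1\<close>; conjugating by
  \<open>a\<^sup>-\<^sup>1\<close> can make the image of another generator longer only if its product with \<open>a v a\<^sup>-\<^sup>1\<close> is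
  cyclically reduced as it stands.\<close>

lemma short_conjugate:
  assumes \<theta>: "\<theta> \<in> hom (Fn n) (Fn n)"
    and gens: "\<And>g i. g \<in> carrier (Fn n) \<Longrightarrow> i < n \<Longrightarrow>
      cyclically_reduced (conj_Fn n g (\<theta> (gen i))) \<Longrightarrow>
      length (conj_Fn n g (\<theta> (gen i))) \<le> R"
    and prods: "\<And>g i j. g \<in> carrier (Fn n) \<Longrightarrow> i < n \<Longrightarrow> j < n \<Longrightarrow> i \<noteq> j \<Longrightarrow>
      cyclically_reduced (conj_Fn n g (\<theta> (gen i \<otimes>\<^bsub>Fn n\<^esub> gen j))) \<Longrightarrow>
      length (conj_Fn n g (\<theta> (gen i \<otimes>\<^bsub>Fn n\<^esub> gen j))) \<le> R"
  shows "\<exists>g\<in>carrier (Fn n). \<forall>i<n. length (conj_Fn n g (\<theta> (gen i))) \<le> R"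
proof -
  interpret group "Fn n" by (rule group_free_group)
  define f where "f g = (\<Sum>i<n. length (conj_Fn n g (\<theta> (gen i))))" for g
  obtain g where g: "g \<in> carrier (Fn n)" and min: "\<And>h. h \<in> carrier (Fn n) \<Longrightarrow> f g \<le> f h"
    using ex_has_least_nat[of "\<lambda>g. g \<in> carrier (Fn n)" "\<one>\<^bsub>Fn n\<^esub>" f] one_closed by blast
  have t: "\<theta> (gen i) \<in> carrier (Fn n)" if "i < n" for i using \<theta> that by (auto simp: hom_def)
  define u where "u i = conj_Fn n g (\<theta> (gen i))" for i
  have u: "u i \<in> carrier (Fn n)" if "i < n" for i using g t[OF that] by (simp add: u_def)
  have "length (u i) \<le> R" if i: "i < n" for i
  proof (rule ccontr)
    assume long: "\<not> length (u i) \<le> R"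
    then have "\<not> cyclically_reduced (u i)" using gens[OF g i] by (auto simp: u_def)
    moreover have "reduced (u i)" using u[OF i] by (simp add: carrier_Fn)
    ultimately obtain a where a: "u i \<noteq> []" "hd (u i) = a" "last (u i) = flip a" "tl (u i) \<noteq> []"
      using not_cyclically_reduced by blast
    have an: "fst a < n" using u[OF i] a by (metis carrier_Fn hd_in_set)
    let ?h = "[flip a]"
    have h: "?h \<in> carrier (Fn n)" "inv\<^bsub>Fn n\<^esub> ?h = [a]" "[a] \<in> carrier (Fn n)"
      using an by (auto simp: inv_letter)
    have conj: "conj_Fn n (?h \<otimes>\<^bsub>Fn n\<^esub> g) (\<theta> (gen j)) = ?h \<otimes>\<^bsub>Fn n\<^esub> u j \<otimes>\<^bsub>Fn n\<^esub> [a]"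
      if "j < n" for j
      using t[OF that] g h(1,3) by (simp add: inv_mult_group h(2) m_assoc u_def)
    have le: "length (?h \<otimes>\<^bsub>Fn n\<^esub> u j \<otimes>\<^bsub>Fn n\<^esub> [a]) \<le> length (u j)" if j: "j < n" for j
    proof (cases "u j = []")
      case True
      then show ?thesis by (simp add: mult_Fn)
    next
      case ne: False
      \<comment> \<open>In the first two cases a cancellation at one end pays for the letter that
        may be added at the other end.\<close>
      consider "hd (u j) = a" | "last (u j) = flip a" | "hd (u j) \<noteq> a" "last (u j) \<noteq> flip a" by blast
      then show ?thesis
      proof cases
        case 1
        then have "?h \<otimes>\<^bsub>Fn n\<^esub> u j = tl (u j)" using cancel_hd[OF u[OF j] ne] by simp
        then show ?thesis using length_mult_Fn[of n "tl (u j)" "[a]"] ne by (cases "u j") auto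
      next
        case 2
        then have "u j \<otimes>\<^bsub>Fn n\<^esub> [a] = butlast (u j)" using cancel_last[OF u[OF j] ne] by simp
        then have "?h \<otimes>\<^bsub>Fn n\<^esub> u j \<otimes>\<^bsub>Fn n\<^esub> [a] = ?h \<otimes>\<^bsub>Fn n\<^esub> butlast (u j)" using h u[OF j] by (simp add: m_assoc)
        then show ?thesis using length_mult_Fn[of n ?h "butlast (u j)"] ne by (cases "u j") auto
      next
        case 3
        have "a \<noteq> flip (last (u j))" using 3(2) by (auto simp: prod_eq_iff)
        then have red: "reduced (u i @ u j)" "reduced ((u i @ u j) @ (u i @ u j))"
          using u[OF i] u[OF j] a ne 3 unfolding reduced_append_iff by (auto simp: carrier_Fn reduced_append_iff)
        have "i \<noteq> j" using a 3 by auto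
        have "conj_Fn n g (\<theta> (gen i \<otimes>\<^bsub>Fn n\<^esub> gen j)) = u i \<otimes>\<^bsub>Fn n\<^esub> u j"
        proof -
          have "inv\<^bsub>Fn n\<^esub> g \<otimes>\<^bsub>Fn n\<^esub> (g \<otimes>\<^bsub>Fn n\<^esub> z) = z" if "z \<in> carrier (Fn n)" for z
            using that g by (simp flip: m_assoc)
          then show ?thesis using g t i j by (simp add: u_def m_assoc hom_mult[OF \<theta>])
        qed
        also have "\<dots> = u i @ u j" by (rule mult_Fn_append[OF red(1)])
        finally have "length (u i @ u j) \<le> R"
          using prods[OF g i j \<open>i \<noteq> j\<close>] red(2) by (simp add: cyclically_reduced_def)
        then show ?thesis using long by simp
      qed
    qed
    have "length (?h \<otimes>\<^bsub>Fn n\<^esub> u i \<otimes>\<^bsub>Fn n\<^esub> [a]) < length (u i)"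
      using cancel_hd_last[OF u[OF i] a] a by (cases "u i") auto
    then have "(\<Sum>j<n. length (?h \<otimes>\<^bsub>Fn n\<^esub> u j \<otimes>\<^bsub>Fn n\<^esub> [a])) < (\<Sum>j<n. length (u j))"
      using le i by (intro sum_strict_mono_ex1) auto
    then have "f (?h \<otimes>\<^bsub>Fn n\<^esub> g) < f g" using conj by (simp add: f_def u_def)
    then show False using min[of "?h \<otimes>\<^bsub>Fn n\<^esub> g"] h(1) g by simp
  qed
  then show ?thesis using g by (auto simp: u_def)
qed

section \<open>Common eigenvectors and trace norms\<close>

definition eigen :: "mat2 \<Rightarrow> complex \<Rightarrow> complex^2 \<Rightarrow> bool" where
  "eigen A \<alpha> v \<longleftrightarrow> A *v v = \<alpha> *s v"

lemma vec2_eq_iff: "v = w \<longleftrightarrow> v$1 = w$1 \<and> v$2 = w$2" for v w :: "'a^2"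
  by (auto simp: vec_eq_iff forall_2)

lemma mult_vec2_nth: "(A *v v) $ i = A$i$1 * v$1 + A$i$2 * v$2" for A :: mat2
  by (simp add: matrix_vector_mult_def sum_2)

lemma eigen_mult: "eigen A \<alpha> v \<Longrightarrow> eigen B \<beta> v \<Longrightarrow> eigen (A ** B) (\<alpha> * \<beta>) v"
  by (simp add: eigen_def matrix_vector_mul_assoc[symmetric] vector_scalar_commute vector_smult_assoc mult.commute)

lemma eigen_char_eq:
  assumes "eigen A \<alpha> v" "v \<noteq> 0" shows "\<alpha> * \<alpha> - trace A * \<alpha> + det A = 0"
proof -
  let ?e1 = "(A$1$1 - \<alpha>) * v$1 + A$1$2 * v$2" and ?e2 = "A$2$1 * v$1 + (A$2$2 - \<alpha>) * v$2"
  have e: "?e1 = 0" "?e2 = 0"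
    using assms(1) by (auto simp: eigen_def vec2_eq_iff mult_vec2_nth algebra_simps)
  let ?c = "\<alpha> * \<alpha> - trace A * \<alpha> + det A"
  \<comment> \<open>Cramer's rule: the adjugate of A - \<alpha> is applied to the vector (A -
    \<alpha>) v, which is 0.\<close>
  have "?c * v$1 = (A$2$2 - \<alpha>) * ?e1 - A$1$2 * ?e2" "?c * v$2 = (A$1$1 - \<alpha>) * ?e2 - A$2$1 * ?e1"
    by (simp_all add: trace2 det_2 algebra_simps)
  with e have "?c * v$1 = 0" "?c * v$2 = 0" by simp_all
  moreover have "v$1 \<noteq> 0 \<or> v$2 \<noteq> 0" using assms(2) by (auto simp: vec2_eq_iff)
  ultimately show ?thesis by auto
qed

lemma eigen_SL2:
  assumes A: "det A = 1" and e: "eigen A \<alpha> v" "v \<noteq> 0"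
  shows "\<alpha> \<noteq> 0" "trace A = \<alpha> + inverse \<alpha>" "eigen (adj2 A) (inverse \<alpha>) v"
proof -
  have c: "\<alpha> * \<alpha> - trace A * \<alpha> + 1 = 0" using eigen_char_eq[OF e] A by simp
  then show nz: "\<alpha> \<noteq> 0" by auto
  with c show tr: "trace A = \<alpha> + inverse \<alpha>" by (simp add: field_simps)
  have "adj2 A *v (A *v v) = v" by (simp add: matrix_vector_mul_assoc adj2_inverse[OF A])
  then have "\<alpha> *s (adj2 A *v v) = v" using e by (simp add: eigen_def vector_scalar_commute)
  then have "inverse \<alpha> *s (\<alpha> *s (adj2 A *v v)) = inverse \<alpha> *s v" by simp
  then show "eigen (adj2 A) (inverse \<alpha>) v" using nz by (simp add: eigen_def vector_smult_assoc)
qed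

lemma det_mpow: "det A = 1 \<Longrightarrow> det (mpow A k) = 1"
  by (induction k) (simp_all add: det_mul)

lemma eigen_mpow: "eigen A \<alpha> v \<Longrightarrow> eigen (mpow A k) (\<alpha> ^ k) v"
proof (induction k)
  case 0
  then show ?case by (simp add: eigen_def vec2_eq_iff)
qed (simp add: eigen_mult)

lemma exists_eigen: "\<exists>\<alpha> v. v \<noteq> 0 \<and> eigen A \<alpha> v"
proof -
  define s where "s = csqrt (trace A ^ 2 - 4 * det A)"
  define \<alpha> where "\<alpha> = (trace A + s) / 2"
  have s: "s * s = trace A * trace A - 4 * det A" by (simp add: s_def power2_eq_square flip: power2_eq_square)
  have "4 * (\<alpha> * \<alpha> - trace A * \<alpha> + det A) = s * s - (trace A * trace A - 4 * det A)"
    by (simp add: \<alpha>_def field_simps)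
  then have "\<alpha> * \<alpha> - trace A * \<alpha> + det A = 0" unfolding s
    by (simp only: diff_self mult_eq_0_iff) simp
  then have c: "(A$1$1 - \<alpha>) * (A$2$2 - \<alpha>) - A$1$2 * A$2$1 = 0"
    by (simp add: trace2 det_2 algebra_simps)
  \<comment> \<open>A vector annihilated by a nonzero row of A - \<alpha>, or an arbitrary one if A
    = \<alpha>; vanishing of the determinant takes care of the other row.\<close>
  define v :: "complex^2" where "v = (if A$1$2 \<noteq> 0 \<or> A$1$1 \<noteq> \<alpha> then vector [- A$1$2, A$1$1 - \<alpha>]
     else if A$2$1 \<noteq> 0 \<or> A$2$2 \<noteq> \<alpha> then vector [\<alpha> - A$2$2, A$2$1] else vector [1, 0])"
  have "v \<noteq> 0" "eigen A \<alpha> v"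
    using c by (auto simp: v_def eigen_def vec2_eq_iff mult_vec2_nth algebra_simps)
  then show ?thesis by blast
qed

lemma singular_kernel:
  assumes "det Y = 0" "Y \<noteq> 0"
  obtains v where "v \<noteq> 0" "Y *v v = (0 :: complex^2)" "\<And>u. Y *v u = 0 \<Longrightarrow> \<exists>c. u = c *s v"
proof -
  have d: "Y$1$1 * Y$2$2 = Y$1$2 * Y$2$1" using assms(1) by (simp add: det_2)
  have ker: "\<exists>c. u = c *s (vector [- q, p] :: complex^2)"
    if "p * u$1 + q * u$2 = 0" "p \<noteq> 0 \<or> q \<noteq> 0" for p q :: complex and u :: "complex^2"
  proof (cases "p = 0")
    case True
    with that have "u = (- u$1 / q) *s vector [- q, p]" by (simp add: vec2_eq_iff)
    then show ?thesis by blast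
  next
    case False
    with that(1) have "u$1 = - (q * u$2) / p" by (simp add: field_simps add_eq_0_iff2 add_eq_0_iff)
    then have "u = (u$2 / p) *s vector [- q, p]" using False by (simp add: vec2_eq_iff)
    then show ?thesis by blast
  qed
  show ?thesis
  proof (cases "Y$1$1 \<noteq> 0 \<or> Y$1$2 \<noteq> 0")
    case True
    show ?thesis
    proof (rule that[of "vector [- Y$1$2, Y$1$1]"])
      show "vector [- Y$1$2, Y$1$1] \<noteq> (0 :: complex^2)" using True by (auto simp: vec2_eq_iff)
      show "Y *v vector [- Y$1$2, Y$1$1] = 0" using d by (simp add: vec2_eq_iff mult_vec2_nth algebra_simps)
      show "\<exists>c. u = c *s vector [- Y$1$2, Y$1$1]" if "Y *v u = 0" for u
        using ker[of "Y$1$1" u "Y$1$2"] that True by (simp add: vec2_eq_iff mult_vec2_nth)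
    qed
  next
    case False
    have nz: "Y$2$1 \<noteq> 0 \<or> Y$2$2 \<noteq> 0" using assms(2) False by (auto simp: mat2_eq_iff)
    show ?thesis
    proof (rule that[of "vector [- Y$2$2, Y$2$1]"])
      show "vector [- Y$2$2, Y$2$1] \<noteq> (0 :: complex^2)" using nz by (auto simp: vec2_eq_iff)
      show "Y *v vector [- Y$2$2, Y$2$1] = 0" using False by (simp add: vec2_eq_iff mult_vec2_nth algebra_simps)
      show "\<exists>c. u = c *s vector [- Y$2$2, Y$2$1]" if "Y *v u = 0" for u
        using ker[of "Y$2$1" u "Y$2$2"] that nz by (simp add: vec2_eq_iff mult_vec2_nth)
    qed
  qed
qed

definition common_eigenvector :: "mat2 \<Rightarrow> mat2 \<Rightarrow> bool" where
  "common_eigenvector A B \<longleftrightarrow> (\<exists>v \<alpha> \<beta>. v \<noteq> 0 \<and> eigen A \<alpha> v \<and> eigen B \<beta> v)"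

text \<open>Unless \<open>A\<close> is scalar, the kernel of A - \<alpha> is a line, and every
  matrix commuting with \<open>A\<close> preserves it.\<close>

lemma commuting_common_eigenvector:
  assumes "A ** B = B ** A" shows "common_eigenvector A B"
proof -
  obtain \<alpha> v where v: "v \<noteq> 0" "eigen A \<alpha> v" using exists_eigen[of A] by blast
  define Y where "Y = A - mat \<alpha>"
  have "Y ** B = A ** B - mat \<alpha> ** B" "B ** Y = B ** A - mat \<alpha> ** B"
    by (simp_all add: Y_def mat2_eq_iff mult2_nth algebra_simps)
  then have YB: "Y ** B = B ** Y" using assms by metis
  have Yv: "Y *v u = 0 \<longleftrightarrow> eigen A \<alpha> u" for u
    by (auto simp: Y_def eigen_def vec2_eq_iff mult_vec2_nth algebra_simps)
  show ?thesis
  proof (cases "Y = 0")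
    case True
    obtain \<beta> w where "w \<noteq> 0" "eigen B \<beta> w" using exists_eigen[of B] by blast
    moreover have "eigen A \<alpha> w" using True Yv[of w] by simp
    ultimately show ?thesis by (auto simp: common_eigenvector_def)
  next
    case False
    have "det Y = 0"
      using eigen_char_eq[OF v(2,1)] by (simp add: Y_def det_2 trace2 algebra_simps)
    then obtain w where w: "w \<noteq> 0" "Y *v w = 0" "\<And>u. Y *v u = 0 \<Longrightarrow> \<exists>c. u = c *s w"
      using singular_kernel False by blast
    have "Y *v (B *v w) = B *v (Y *v w)" by (simp add: matrix_vector_mul_assoc YB)
    then obtain \<beta> where "B *v w = \<beta> *s w" using w by auto
    then show ?thesis using w Yv by (auto simp: common_eigenvector_def eigen_def)
  qed
qed

text \<open>Equivalently, 1, A, B, AB span all matrices. For X of trace 0, the condition tr(Z X) = 0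
  means Z X = X \<open>adj2 Z\<close>. If X is singular, its kernel is then a common eigenline; if X
  is invertible, the relations for A, B and AB combine to A B X = B A X, so A and B commute.\<close>

lemma traces_separate:
  assumes A: "det A = 1" and B: "det B = 1" and nce: "\<not> common_eigenvector A B"
    and t: "trace X = 0" "trace (A ** X) = 0" "trace (B ** X) = 0" "trace (A ** B ** X) = 0"
  shows "X = 0"
proof (rule ccontr)
  assume X: "X \<noteq> 0"
  have adj0: "adj2 Z = - Z" if "trace Z = 0" for Z
    using that by (simp add: mat2_eq_iff trace2 add_eq_0_iff2 add_eq_0_iff)
  have comm: "Z ** X = X ** adj2 Z" if "trace (Z ** X) = 0" for Z
  proof -
    have "- (Z ** X) = adj2 X ** adj2 Z" using adj0[OF that] by (simp add: adj2_mult)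
    also have "\<dots> = - (X ** adj2 Z)" using adj0[OF t(1)] by (simp add: matrix_mul_minus)
    finally show ?thesis by simp
  qed
  show False
  proof (cases "det X = 0")
    case True
    then obtain v where v: "v \<noteq> 0" "X *v v = 0" "\<And>u. X *v u = 0 \<Longrightarrow> \<exists>c. u = c *s v"
      using singular_kernel X by blast
    have *: "\<exists>c. eigen Z c v" if "trace (Z ** X) = 0" for Z
    proof -
      have "X *v (adj2 Z *v v) = Z *v (X *v v)" by (simp add: matrix_vector_mul_assoc comm[OF that])
      then obtain c where "adj2 Z *v v = c *s v" using v by auto
      then have "eigen Z (trace Z - c) v"
        by (auto simp: eigen_def vec2_eq_iff mult_vec2_nth trace2 algebra_simps)
      then show ?thesis by blast
    qed
    show False using nce v(1) *[OF t(2)] *[OF t(3)] unfolding common_eigenvector_def by blast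
  next
    case False
    have "A ** B ** X = X ** adj2 B ** adj2 A" using comm[OF t(4)] by (simp add: adj2_mult matrix_mul_assoc)
    also have "\<dots> = B ** (X ** adj2 A)" using comm[OF t(3)] by (simp add: matrix_mul_assoc)
    also have "\<dots> = B ** A ** X" unfolding comm[OF t(2), symmetric] by (simp add: matrix_mul_assoc)
    finally have "A ** B ** X = B ** A ** X" .
    then have "A ** B ** (X ** W) = B ** A ** (X ** W)" for W :: mat2
      unfolding matrix_mul_assoc by simp
    moreover obtain W :: mat2 where "X ** W = mat 1"
      using False by (auto simp: invertible_det_nz[symmetric] invertible_def)
    ultimately have "A ** B = B ** A" by (metis matrix_mul_rid)
    then show False using nce commuting_common_eigenvector by blast
  qed
qed

text \<open>If \<open>A\<close> and \<open>B\<close> have no common eigenvector, this is a norm by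
  \<open>traces_separate\<close>. It sees \<open>X\<close> only through moduli of traces, which is
  what the squared traces reveal.\<close>

definition trace_norm :: "mat2 \<Rightarrow> mat2 \<Rightarrow> mat2 \<Rightarrow> real" where
  "trace_norm A B X = cmod (trace X) + cmod (trace (A ** X)) + cmod (trace (B ** X)) + cmod (trace (A ** B ** X))"

lemma continuous_trace_mult: "continuous_on S (\<lambda>X. trace (Z ** X))" for Z :: mat2
  unfolding trace2 mult2_nth by (intro continuous_intros)

text \<open>By homogeneity it suffices to look at the compact unit sphere, where the minimum is
  positive by \<open>traces_separate\<close>.\<close>

lemma trace_norm_lower:
  assumes "det A = 1" "det B = 1" "\<not> common_eigenvector A B"
  obtains \<epsilon> where "0 < \<epsilon>" "\<And>X. \<epsilon> * norm X \<le> trace_norm A B X"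
proof -
  have cont: "continuous_on (sphere 0 1) (trace_norm A B)"
    unfolding trace_norm_def using continuous_trace_mult[of _ "mat 1"]
    by (intro continuous_intros continuous_trace_mult) simp
  have "axis 1 (axis 1 1) \<in> sphere (0 :: mat2) 1" by (simp add: norm_axis_1 norm_eq_sqrt_inner inner_axis_axis)
  then have "sphere (0 :: mat2) 1 \<noteq> {}" by blast
  from continuous_attains_inf[OF compact_sphere this cont] obtain X0 where
    X0: "X0 \<in> sphere 0 1" "\<And>X. X \<in> sphere 0 1 \<Longrightarrow> trace_norm A B X0 \<le> trace_norm A B X" by blast
  have "trace_norm A B X0 \<noteq> 0"
  proof
    assume 0: "trace_norm A B X0 = 0"
    have "cmod (trace X0) = 0" "cmod (trace (A ** X0)) = 0" "cmod (trace (B ** X0)) = 0" "cmod (trace (A ** B ** X0)) = 0"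
      using 0 norm_ge_zero[of "trace X0"] norm_ge_zero[of "trace (A ** X0)"] norm_ge_zero[of "trace (B ** X0)"]
        norm_ge_zero[of "trace (A ** B ** X0)"] unfolding trace_norm_def by linarith+
    then have "X0 = 0" using traces_separate[OF assms] by simp
    then show False using X0(1) by simp
  qed
  moreover have "0 \<le> trace_norm A B X0" by (simp add: trace_norm_def)
  ultimately have pos: "0 < trace_norm A B X0" by simp
  have "trace_norm A B X0 * norm X \<le> trace_norm A B X" for X
  proof (cases "X = 0")
    case False
    define Y where "Y = X /\<^sub>R norm X"
    have scale: "trace (Z ** Y) = trace (Z ** X) /\<^sub>R norm X" for Z
      by (simp add: Y_def trace2 mult2_nth scaleR_add_right)
    have "Y \<in> sphere 0 1" using False by (simp add: Y_def)
    then have "trace_norm A B X0 \<le> trace_norm A B Y" by (rule X0(2))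
    also have "\<dots> = trace_norm A B X / norm X"
      using scale[of "mat 1"] by (simp add: trace_norm_def scale divide_inverse algebra_simps)
    finally show ?thesis using False by (simp add: field_simps)
  qed (simp add: trace_norm_def)
  with pos that show ?thesis by blast
qed

text \<open>One constant has to serve all late members of a sequence whose first two matrices still
  vary.\<close>

lemma trace_norm_perturb:
  assumes "\<And>X. \<epsilon> * norm X \<le> trace_norm A B X"
    and "2 * (norm (A' - A) + norm (B' - B) + norm (A' ** B' - A ** B)) \<le> \<epsilon> / 2"
  shows "\<epsilon> / 2 * norm X \<le> trace_norm A' B' X"
proof -
  have d: "cmod (trace (Z ** X)) \<le> cmod (trace (Z' ** X)) + 2 * norm (Z' - Z) * norm X" for Z Z'
  proof -
    have "trace (Z' ** X) - trace (Z ** X) = trace ((Z' - Z) ** X)"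
      by (simp add: trace2 mult2_nth algebra_simps)
    then have "cmod (trace (Z' ** X) - trace (Z ** X)) \<le> 2 * norm ((Z' - Z) ** X)"
      using norm_trace2 by metis
    also have "\<dots> \<le> 2 * (norm (Z' - Z) * norm X)" using norm_mult2 by simp
    finally show ?thesis
      using norm_triangle_ineq2[of "trace (Z ** X)" "trace (Z' ** X)"] by (simp add: norm_minus_commute)
  qed
  have "\<epsilon> * norm X \<le> trace_norm A B X" by (rule assms)
  also have "\<dots> \<le> trace_norm A' B' X + 2 * (norm (A' - A) + norm (B' - B) + norm (A' ** B' - A ** B)) * norm X"
    using d[of A A'] d[of B B'] d[of "A ** B" "A' ** B'"] by (simp add: trace_norm_def algebra_simps)
  also have "\<dots> \<le> trace_norm A' B' X + \<epsilon> / 2 * norm X"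
    using assms(2) by (intro add_left_mono mult_right_mono) auto
  finally show ?thesis by (simp add: algebra_simps)
qed

lemma norm_mat2_le_sum: "norm A \<le> cmod (A$1$1) + cmod (A$1$2) + cmod (A$2$1) + cmod (A$2$2)" for A :: mat2
proof (rule power2_le_imp_le)
  show "(norm A)\<^sup>2 \<le> (cmod (A$1$1) + cmod (A$1$2) + cmod (A$2$1) + cmod (A$2$2))\<^sup>2"
    unfolding norm_mat2 by (simp add: power2_eq_square algebra_simps add_increasing2)
qed simp

text \<open>Take the basis v, B v with v an eigenvector of \<open>A\<close>; the two are independent
  as v is not an eigenvector of \<open>B\<close>. There \<open>A\<close> is upper triangular and
  \<open>B\<close> has columns (0, 1) and (-1, tr B). The diagonal of \<open>A\<close> consists of
  its eigenvalues, and its last entry follows from the trace of the product.\<close>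

lemma bounded_normal_form:
  assumes A: "det A = 1" and B: "det B = 1" and nce: "\<not> common_eigenvector A B"
    and T: "cmod (trace A) \<le> T" "cmod (trace B) \<le> T" "cmod (trace (A ** B)) \<le> T"
  obtains P where "det P = 1" "norm (adj2 P ** A ** P) \<le> 4 * (T + 1) ^ 2" "norm (adj2 P ** B ** P) \<le> 4 * (T + 1) ^ 2"
proof -
  have T0: "0 \<le> T" using T(1) norm_ge_zero order_trans by blast
  obtain k v where v: "v \<noteq> 0" "eigen A k v" using exists_eigen[of A] by blast
  define w where "w = B *v v"
  define D where "D = v$1 * w$2 - v$2 * w$1"
  have D: "D \<noteq> 0"
  proof
    assume D0: "D = 0"
    have "\<exists>c. w = c *s v"
    proof (cases "v$1 = 0")
      case True
      then have "v$2 \<noteq> 0" using v by (auto simp: vec2_eq_iff)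
      then have "w = (w$2 / v$2) *s v" using D0 True by (simp add: vec2_eq_iff D_def)
      then show ?thesis by blast
    next
      case False
      then have "w = (w$1 / v$1) *s v" using D0 by (simp add: vec2_eq_iff D_def field_simps)
      then show ?thesis by blast
    qed
    then show False using nce v by (auto simp: common_eigenvector_def eigen_def w_def)
  qed
  \<comment> \<open>Dividing both basis vectors by a square root of their determinant makes det P =
    1.\<close>
  define s where "s = csqrt D"
  have s: "s * s = D" by (simp add: s_def flip: power2_eq_square)
  have s0: "s \<noteq> 0" using D s by auto
  define P :: mat2 where "P = vector [vector [v$1 / s, w$1 / s], vector [v$2 / s, w$2 / s]]"
  have Pn: "P$1$1 = v$1 / s" "P$1$2 = w$1 / s" "P$2$1 = v$2 / s" "P$2$2 = w$2 / s"
    by (simp_all add: P_def)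
  have dP: "det P = 1" using s0 s D by (simp add: det_2 Pn field_simps D_def)
  have Av: "A$1$1 * v$1 + A$1$2 * v$2 = k * v$1" "A$2$1 * v$1 + A$2$2 * v$2 = k * v$2"
    using v(2) by (auto simp: eigen_def vec2_eq_iff mult_vec2_nth)
  have Bv: "B$1$1 * v$1 + B$1$2 * v$2 = w$1" "B$2$1 * v$1 + B$2$2 * v$2 = w$2"
    by (auto simp: w_def mult_vec2_nth)
  let ?A = "adj2 P ** A ** P" and ?B = "adj2 P ** B ** P"
  have AP: "(A ** P)$1$1 = k * P$1$1" "(A ** P)$2$1 = k * P$2$1"
    using Av by (simp_all add: mult2_nth Pn flip: add_divide_distrib)
  have BP: "(B ** P)$1$1 = P$1$2" "(B ** P)$2$1 = P$2$2"
    using Bv by (simp_all add: mult2_nth Pn flip: add_divide_distrib)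
  have dP': "P$1$1 * P$2$2 - P$1$2 * P$2$1 = 1" using dP by (simp add: det_2)
  have "?A$1$1 = P$2$2 * (k * P$1$1) - P$1$2 * (k * P$2$1)"
    unfolding matrix_mul_assoc[symmetric] mult2_nth[of "adj2 P"] AP by simp
  also have "\<dots> = k * (P$1$1 * P$2$2 - P$1$2 * P$2$1)" by (simp add: algebra_simps)
  finally have A11: "?A$1$1 = k" by (simp add: dP')
  have A21: "?A$2$1 = 0"
    unfolding matrix_mul_assoc[symmetric] mult2_nth[of "adj2 P"] AP by simp
  have B11: "?B$1$1 = 0"
    unfolding matrix_mul_assoc[symmetric] mult2_nth[of "adj2 P"] BP by simp
  have "?B$2$1 = P$1$1 * P$2$2 - P$1$2 * P$2$1"
    unfolding matrix_mul_assoc[symmetric] mult2_nth[of "adj2 P"] BP by simp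
  then have B21: "?B$2$1 = 1" by (simp add: dP')
  have detA: "det ?A = 1" and detB: "det ?B = 1" by (simp_all add: det_mul A B dP)
  have trA: "trace ?A = trace A" and trB: "trace ?B = trace B" by (simp_all add: trace_conj dP)
  have "?A ** ?B = adj2 P ** (A ** B) ** P"
    using adj2_cancel(2)[OF dP, of "B ** P"] by (simp only: matrix_mul_assoc[symmetric])
  then have trAB: "trace (?A ** ?B) = trace (A ** B)" by (simp add: trace_conj dP)
  have k: "k * ?A$2$2 = 1" using detA A11 A21 by (simp add: det_2)
  have k22: "k + ?A$2$2 = trace A" using trA A11 by (simp add: trace2)
  have B12: "?B$1$2 = - 1" using detB B11 B21 by (simp add: det_2 minus_equation_iff)
  have B22: "?B$2$2 = trace B" using trB B11 by (simp add: trace2)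
  have "?A$1$2 + ?A$2$2 * trace B = trace (A ** B)"
    using trAB unfolding trace2[of "?A ** ?B"] mult2_nth[of ?A] by (simp add: A11 A21 B11 B21 B22 B12)
  then have A12: "?A$1$2 = trace (A ** B) - ?A$2$2 * trace B" by (simp add: algebra_simps)
  \<comment> \<open>An eigenvalue of modulus above 1 differs from the trace by its inverse, whose
    modulus is at most 1.\<close>
  have bnd: "cmod x \<le> T + 1" if "x * y = 1" "x + y = trace A" for x y
  proof (cases "cmod x \<le> 1")
    case False
    have "cmod x * cmod y = 1" using that(1) by (metis norm_mult norm_one)
    then have "cmod y \<le> 1" using False by (smt (verit) mult_le_cancel_right1 norm_ge_zero mult_nonneg_nonneg mult_less_cancel_right1)
    moreover have "x = trace A - y" using that(2) by (simp add: algebra_simps)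
    then have "cmod x \<le> cmod (trace A) + cmod y" by (metis norm_triangle_ineq4)
    ultimately show ?thesis using T(1) by simp
  qed (use T0 in simp)
  have k1: "cmod k \<le> T + 1" "cmod (?A$2$2) \<le> T + 1"
    using bnd[of k "?A$2$2"] bnd[of "?A$2$2" k] k k22 by (simp_all add: mult.commute add.commute)
  have "cmod (?A$1$2) \<le> cmod (trace (A ** B)) + cmod (?A$2$2) * cmod (trace B)"
    unfolding A12 using norm_triangle_ineq4[of "trace (A ** B)" "?A$2$2 * trace B"] by (simp add: norm_mult)
  also have "\<dots> \<le> T + (T + 1) * T" using T k1 T0 by (intro add_mono mult_mono) auto
  finally have a12: "cmod (?A$1$2) \<le> T + (T + 1) * T" .
  have "norm ?A \<le> (T + 1) + (T + (T + 1) * T) + 0 + (T + 1)"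
    using norm_mat2_le_sum[of ?A] k1 a12 A11 A21 by simp
  also have "\<dots> \<le> 4 * (T + 1) ^ 2" using T0 by (simp add: power2_eq_square algebra_simps)
  finally have 1: "norm ?A \<le> 4 * (T + 1) ^ 2" .
  have "norm ?B \<le> 0 + 1 + 1 + T"
    using norm_mat2_le_sum[of ?B] T(2) by (simp add: B11 B12 B21 B22)
  also have "\<dots> \<le> 4 * (T + 1) ^ 2" using T0 by (simp add: power2_eq_square algebra_simps)
  finally have 2: "norm ?B \<le> 4 * (T + 1) ^ 2" .
  show ?thesis by (rule that[OF dP 1 2])
qed

section \<open>Traces of primitive elements\<close>

definition per :: "'a list \<Rightarrow> nat \<Rightarrow> 'a" where
  "per w i = w ! (i mod length w)"

lemma per_periodic: "per w (i + length w * k) = per w i"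
  by (simp add: per_def)

lemma seg_per: "seg (per w) 0 (length w) = w"
  by (auto simp: seg_def per_def intro!: nth_equalityI)

lemma set_per: "w \<noteq> [] \<Longrightarrow> per w i \<in> set w"
  by (simp add: per_def)

text \<open>Primitive elements are presented as images of generators, so that transvections and
  conjugations act by composition; cyclic reducedness makes the periodic sequence the labelling of
  an axis.\<close>

definition prim_seqs :: "nat \<Rightarrow> (nat \<Rightarrow> nat \<times> bool) set" where
  "prim_seqs n = {per (\<theta> (gen i)) | \<theta> i. \<theta> \<in> iso (Fn n) (Fn n) \<and> i < n \<and> cyclically_reduced (\<theta> (gen i))}"

text \<open>Powers are included because a bound on the trace of w alone would admit a unipotent
  image of a short element; growth in k forces eigenvalues off the unit circle
  (\<open>eigen_growth\<close>). With moduli of traces the condition ignores conjugation and the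
  signs of lifts.\<close>

definition trace_expanding :: "nat \<Rightarrow> nat \<Rightarrow> (nat \<Rightarrow> mat2) \<Rightarrow> bool" where
  "trace_expanding n N B \<longleftrightarrow> (\<forall>\<theta>\<in>iso (Fn n) (Fn n). \<forall>i<n. cyclically_reduced (\<theta> (gen i)) \<longrightarrow>
     (\<forall>k\<ge>1. 2 ^ (length (\<theta> (gen i)) * k) \<le> (cmod (trace (mpow (wmat B (\<theta> (gen i))) k)) + 1) ^ N))"

lemma iso_hom: "\<theta> \<in> iso G H \<Longrightarrow> \<theta> \<in> hom G H"
  by (simp add: iso_def)

lemma iso_gen_closed: "\<theta> \<in> iso (Fn n) (Fn n) \<Longrightarrow> i < n \<Longrightarrow> \<theta> (gen i) \<in> carrier (Fn n)"
  by (auto simp: iso_def hom_def)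

lemma iso_gen_nonempty:
  assumes "\<theta> \<in> iso (Fn n) (Fn n)" "i < n" shows "\<theta> (gen i) \<noteq> []"
proof
  assume "\<theta> (gen i) = []"
  then have "\<theta> (gen i) = \<theta> \<one>\<^bsub>Fn n\<^esub>"
    using hom_one[OF iso_hom[OF assms(1)] group_free_group group_free_group] by (simp add: one_Fn)
  then have "gen i = \<one>\<^bsub>Fn n\<^esub>"
    using inj_onD[OF bij_betw_imp_inj_on, of \<theta> "carrier (Fn n)" "carrier (Fn n)" "gen i" "\<one>\<^bsub>Fn n\<^esub>"] assms
      group.is_monoid[OF group_free_group, of "{..<n}"] by (simp add: iso_def monoid.one_closed)
  then show False by (simp add: one_Fn gen_def)
qed

lemma prim_seqs_letter:
  assumes "a \<in> prim_seqs n" shows "fst (a i) < n"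
proof -
  obtain \<theta> j where \<theta>: "a = per (\<theta> (gen j))" "\<theta> \<in> iso (Fn n) (Fn n)" "j < n"
    using assms by (auto simp: prim_seqs_def)
  have "a i \<in> set (\<theta> (gen j))" unfolding \<theta>(1) by (rule set_per[OF iso_gen_nonempty[OF \<theta>(2,3)]])
  then show ?thesis using iso_gen_closed[OF \<theta>(2,3)] by (simp add: carrier_Fn)
qed

text \<open>Powers come for free from \<open>trace_growth\<close>: a sequence of period l also has
  period l k.\<close>

lemma trace_expandingI:
  assumes B: "\<And>i. det (B i) = 1" and loc: "\<And>a. a \<in> prim_seqs n \<Longrightarrow> locally_expanding B a N"
  shows "trace_expanding n N B"
  unfolding trace_expanding_def
proof (intro ballI allI impI)
  fix \<theta> i k assume *: "\<theta> \<in> iso (Fn n) (Fn n)" "i < n" "cyclically_reduced (\<theta> (gen i))" "(1::nat) \<le> k"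
  let ?w = "\<theta> (gen i)"
  have "per ?w \<in> prim_seqs n" using * by (auto simp: prim_seqs_def)
  moreover have "1 \<le> length ?w * k" using * iso_gen_nonempty[of \<theta> n i] by (simp add: Suc_le_eq)
  ultimately have "2 ^ (length ?w * k) \<le> (cmod (trace (wmat B (seg (per ?w) 0 (length ?w * k)))) + 1) ^ N"
    using per_periodic by (intro trace_growth[OF B loc]) auto
  also have "wmat B (seg (per ?w) 0 (length ?w * k)) = mpow (wmat B ?w) k"
    using wmat_seg_periodic[of "per ?w" "length ?w" B k] per_periodic[of ?w _ 1] by (simp add: seg_per)
  finally show "2 ^ (length ?w * k) \<le> (cmod (trace (mpow (wmat B ?w) k)) + 1) ^ N" .
qed

lemma mpow_conj: "det g = 1 \<Longrightarrow> mpow (adj2 g ** A ** g) k = adj2 g ** mpow A k ** g"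
proof (induction k)
  case (Suc k)
  have "g ** (adj2 g ** (mpow A k ** g)) = mpow A k ** g" by (rule adj2_cancel[OF Suc.prems])
  then show ?case using Suc by (simp add: matrix_mul_assoc[symmetric])
qed (simp add: adj2_inverse)

lemma trace_expanding_conj:
  assumes "det g = 1"
  shows "trace_expanding n N (\<lambda>i. adj2 g ** B i ** g) \<longleftrightarrow> trace_expanding n N B"
  unfolding trace_expanding_def wmat_conj[OF assms] mpow_conj[OF assms] trace_conj[OF assms] ..

lemma trace_expanding_mono:
  assumes "trace_expanding n N B" "N \<le> M" shows "trace_expanding n M B"
proof -
  have "(cmod x + 1) ^ N \<le> (cmod x + 1) ^ M" for x :: complex using assms(2) by (intro power_increasing) auto
  then show ?thesis using assms(1) unfolding trace_expanding_def by (meson order_trans)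
qed

context
  fixes B :: "nat \<Rightarrow> mat2" assumes B: "\<And>i. det (B i) = 1"
begin

lemma wmat_mult_Fn: "wmat B (u \<otimes>\<^bsub>Fn n\<^esub> v) = wmat B u ** wmat B v"
  by (simp add: mult_Fn wmat_foldr_push B)

lemma wmat_inv_Fn:
  assumes "u \<in> carrier (Fn n)" shows "wmat B (inv\<^bsub>Fn n\<^esub> u) = adj2 (wmat B u)"
proof -
  interpret group "Fn n" by (rule group_free_group)
  have "wmat B (inv\<^bsub>Fn n\<^esub> u) ** wmat B u = mat 1"
    using assms wmat_mult_Fn[where n = n and u = "inv\<^bsub>Fn n\<^esub> u" and v = u] by (simp add: one_Fn)
  then have "adj2 (wmat B u) = wmat B (inv\<^bsub>Fn n\<^esub> u) ** wmat B u ** adj2 (wmat B u)" by simp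
  also have "\<dots> = wmat B (inv\<^bsub>Fn n\<^esub> u)"
    by (simp add: matrix_mul_assoc[symmetric] adj2_inverse det_wmat B)
  finally show ?thesis by simp
qed

lemma trace_mpow_conj_Fn:
  assumes "g \<in> carrier (Fn n)" "w \<in> carrier (Fn n)"
  shows "trace (mpow (wmat B (conj_Fn n g w)) k) = trace (mpow (wmat B w) k)"
  using mpow_conj[of "adj2 (wmat B g)" "wmat B w" k] trace_conj[of "adj2 (wmat B g)"] assms
  by (simp add: wmat_mult_Fn wmat_inv_Fn det_wmat B)

end

lemma mpow_wmat: "\<exists>v. (\<forall>x\<in>set v. x \<in> set u) \<and> (\<forall>B :: nat \<Rightarrow> mat2. mpow (wmat B u) k = wmat B v)"
proof (induction k)
  case 0
  show ?case by (rule exI[of _ "[]"]) simp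
next
  case (Suc k)
  then obtain v where "\<forall>x\<in>set v. x \<in> set u" "\<And>B :: nat \<Rightarrow> mat2. mpow (wmat B u) k = wmat B v" by blast
  then show ?case by (intro exI[of _ "u @ v"]) (auto simp: wmat_append)
qed

lemma trace_expanding_power:
  assumes B: "\<And>i. det (B i) = 1" and te: "trace_expanding n N B"
    and \<theta>: "\<theta> \<in> iso (Fn n) (Fn n)" and i: "i < n" and k: "1 \<le> k"
  shows "2 ^ k \<le> (cmod (trace (mpow (wmat B (\<theta> (gen i))) k)) + 1) ^ N"
proof -
  let ?w = "\<theta> (gen i)"
  have w: "?w \<in> carrier (Fn n)" by (rule iso_gen_closed[OF \<theta> i])
  obtain g where g: "g \<in> carrier (Fn n)" "cyclically_reduced (conj_Fn n g ?w)"
    using exists_cyclically_reduced_conj[OF w] by blast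
  define \<theta>' where "\<theta>' = (\<lambda>x. conj_Fn n g x) \<circ> \<theta>"
  have \<theta>': "\<theta>' \<in> iso (Fn n) (Fn n)"
    unfolding \<theta>'_def by (rule iso_set_trans[OF \<theta> iso_conj[OF g(1)]])
  have ne: "1 \<le> length (\<theta>' (gen i))" using iso_gen_nonempty[OF \<theta>' i] by (simp add: Suc_le_eq)
  have "(2::real) ^ k \<le> 2 ^ (length (\<theta>' (gen i)) * k)" using ne by (intro power_increasing) auto
  also have "\<dots> \<le> (cmod (trace (mpow (wmat B (\<theta>' (gen i))) k)) + 1) ^ N"
    using te \<theta>' i k g(2) by (auto simp: trace_expanding_def \<theta>'_def)
  also have "trace (mpow (wmat B (\<theta>' (gen i))) k) = trace (mpow (wmat B ?w) k)"
    unfolding \<theta>'_def comp_def by (rule trace_mpow_conj_Fn[OF B g(1) w])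
  finally show ?thesis .
qed

text \<open>The trace of A^k is \<alpha>^k + \<alpha>^(-k), and growing k removes the factor 3^N
  from the comparison. The result is a gap: on primitive elements the logarithm stays uniformly away
  from 0.\<close>

lemma eigen_growth:
  assumes A: "det A = 1" and v: "eigen A \<alpha> v" "v \<noteq> 0"
    and gr: "\<And>k. 1 \<le> k \<Longrightarrow> 2 ^ k \<le> (cmod (trace (mpow A k)) + 1) ^ N"
  shows "ln 2 \<le> N * \<bar>ln (cmod \<alpha>)\<bar>"
proof -
  have nz: "\<alpha> \<noteq> 0" by (rule eigen_SL2[OF A v])
  let ?m = "exp \<bar>ln (cmod \<alpha>)\<bar>"
  have m: "cmod \<alpha> \<le> ?m" "inverse (cmod \<alpha>) \<le> ?m" "1 \<le> ?m"
  proof -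
    have "exp (ln (cmod \<alpha>)) \<le> ?m" "exp (- ln (cmod \<alpha>)) \<le> ?m" by auto
    then show "cmod \<alpha> \<le> ?m" "inverse (cmod \<alpha>) \<le> ?m" using nz by (simp_all add: exp_minus)
  qed simp
  have "1 * 2 ^ k \<le> 3 ^ N * (?m ^ N) ^ k" if k: "1 \<le> k" for k
  proof -
    have "trace (mpow A k) = \<alpha> ^ k + inverse (\<alpha> ^ k)"
      by (rule eigen_SL2(2)[OF det_mpow[OF A] eigen_mpow[OF v(1)] v(2)])
    then have "cmod (trace (mpow A k)) \<le> cmod \<alpha> ^ k + inverse (cmod \<alpha>) ^ k"
      using norm_triangle_ineq[of "\<alpha> ^ k" "inverse (\<alpha> ^ k)"] by (simp add: norm_power norm_inverse power_inverse)
    also have "\<dots> \<le> ?m ^ k + ?m ^ k" using m by (intro add_mono power_mono) auto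
    finally have "cmod (trace (mpow A k)) + 1 \<le> 3 * ?m ^ k" using one_le_power[OF m(3), of k] by linarith
    then have "(cmod (trace (mpow A k)) + 1) ^ N \<le> (3 * ?m ^ k) ^ N" by (intro power_mono) auto
    also have "\<dots> = 3 ^ N * (?m ^ N) ^ k" by (simp add: power_mult_distrib mult.commute flip: power_mult)
    finally show ?thesis using gr[OF k] by simp
  qed
  then have "2 \<le> ?m ^ N" using power_le_power_imp_le[of 1 2 "?m ^ N" "3 ^ N"] by simp
  also have "?m ^ N = exp (N * \<bar>ln (cmod \<alpha>)\<bar>)" by (simp add: exp_of_nat_mult)
  finally show ?thesis by (subst ln_exp[symmetric]) (intro ln_mono, auto)
qed

text \<open>If \<open>B 0\<close> and \<open>B 1\<close> have a common eigenvector, then the logarithm of the modulus of the eigenvalue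
  is a homomorphism, and the Euclidean algorithm on the pair of its values at the first two basis
  elements, realized by transvections, makes it arbitrarily small on primitive elements.\<close>

lemma no_common_eigenvector:
  assumes B: "\<And>i. det (B i) = 1" and n: "2 \<le> n"
    and gr: "\<And>\<theta> i k. \<theta> \<in> iso (Fn n) (Fn n) \<Longrightarrow> fst ` set (\<theta> (gen 0)) \<subseteq> {..<2} \<Longrightarrow> fst ` set (\<theta> (gen 1)) \<subseteq> {..<2} \<Longrightarrow>
      i < 2 \<Longrightarrow> 1 \<le> k \<Longrightarrow> 2 ^ k \<le> (cmod (trace (mpow (wmat B (\<theta> (gen i))) k)) + 1) ^ N"
  shows "\<not> common_eigenvector (B 0) (B 1)"
proof
  interpret group "Fn n" by (rule group_free_group)
  assume "common_eigenvector (B 0) (B 1)"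
  moreover have dw: "det (wmat B u) = 1" for u by (simp add: det_wmat B)
  ultimately obtain v \<alpha>0 \<beta>0 where v: "v \<noteq> 0" "eigen (B 0) \<alpha>0 v" "eigen (B 1) \<beta>0 v"
    by (auto simp: common_eigenvector_def)
  let ?h = "\<lambda>\<alpha>. \<bar>ln (cmod \<alpha>)\<bar>"
  \<comment> \<open>The restriction to the first two letters is carried along because
    \<open>gr\<close> is available only for such automorphisms.\<close>
  define good where "good \<theta> \<alpha> \<beta> \<longleftrightarrow> \<theta> \<in> iso (Fn n) (Fn n) \<and> fst ` set (\<theta> (gen 0)) \<subseteq> {..<2} \<and>
    fst ` set (\<theta> (gen 1)) \<subseteq> {..<2} \<and> eigen (wmat B (\<theta> (gen 0))) \<alpha> v \<and> eigen (wmat B (\<theta> (gen 1))) \<beta> v" for \<theta> \<alpha> \<beta>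
  have ge: "ln 2 \<le> N * ?h \<alpha>" "ln 2 \<le> N * ?h \<beta>" "\<alpha> \<noteq> 0" "\<beta> \<noteq> 0" if "good \<theta> \<alpha> \<beta>" for \<theta> \<alpha> \<beta>
  proof -
    have *: "\<theta> \<in> iso (Fn n) (Fn n)" "fst ` set (\<theta> (gen 0)) \<subseteq> {..<2}" "fst ` set (\<theta> (gen 1)) \<subseteq> {..<2}"
      "eigen (wmat B (\<theta> (gen 0))) \<alpha> v" "eigen (wmat B (\<theta> (gen 1))) \<beta> v"
      using that by (auto simp: good_def)
    show "ln 2 \<le> N * ?h \<alpha>" by (rule eigen_growth[OF dw *(4) v(1) gr[OF *(1-3)]]) auto
    show "ln 2 \<le> N * ?h \<beta>" by (rule eigen_growth[OF dw *(5) v(1) gr[OF *(1-3)]]) auto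
    show "\<alpha> \<noteq> 0" "\<beta> \<noteq> 0" using eigen_SL2(1)[OF dw _ v(1)] *(4,5) by blast+
  qed
  have step: "\<exists>\<theta>' \<alpha>' \<beta>'. good \<theta>' \<alpha>' \<beta>' \<and> ?h \<alpha>' + ?h \<beta>' = max (?h \<alpha>) (?h \<beta>)" if g: "good \<theta> \<alpha> \<beta>" for \<theta> \<alpha> \<beta>
  proof -
    have \<theta>: "\<theta> \<in> iso (Fn n) (Fn n)" "\<theta> \<in> hom (Fn n) (Fn n)" using g by (auto simp: good_def iso_def)
    have cl: "\<theta> (gen i) \<in> carrier (Fn n)" if "i < n" for i by (rule iso_gen_closed[OF \<theta>(1) that])
    have letter: "\<theta> [(j, e)] = (if e then \<theta> (gen j) else inv\<^bsub>Fn n\<^esub> (\<theta> (gen j)))" if "j < n" for j e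
      using hom_letter[OF is_group \<theta>(2), of "(j, e)"] that by (simp add: letter_val_def)
    have set_inv: "fst ` set (inv\<^bsub>Fn n\<^esub> u) \<subseteq> {..<2}" if u: "u \<in> carrier (Fn n)" "fst ` set u \<subseteq> {..<2}" for u
    proof -
      have "inv\<^bsub>Fn n\<^esub> u = foldr push (rev (map flip u)) []"
      proof (rule inv_equality)
        show "foldr push (rev (map flip u)) [] \<otimes>\<^bsub>Fn n\<^esub> u = \<one>\<^bsub>Fn n\<^esub>"
          using u foldr_push_inverse[of "[]" u] by (simp add: mult_Fn one_Fn carrier_Fn foldr_push_assoc foldr_push_Nil)
        have "fst ` set u \<subseteq> {..<n}" using u by (auto simp: carrier_Fn)
        then show "foldr push (rev (map flip u)) [] \<in> carrier (Fn n)"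
          by (intro foldr_push_closed) auto
      qed (rule u)
      then show ?thesis using set_foldr_push[of "rev (map flip u)" "[]"] u(2) by fastforce
    qed
    have set_mult: "fst ` set (u \<otimes>\<^bsub>Fn n\<^esub> w) \<subseteq> {..<2}" if "fst ` set u \<subseteq> {..<2}" "fst ` set w \<subseteq> {..<2}" for u w
      using that set_foldr_push[of u w] by (fastforce simp: mult_Fn)
    have key: "\<exists>\<theta>' \<gamma>. \<theta>' \<in> iso (Fn n) (Fn n) \<and> \<theta>' (gen j) = \<theta> (gen j) \<and> fst ` set (\<theta>' (gen i)) \<subseteq> {..<2} \<and>
        eigen (wmat B (\<theta>' (gen i))) \<gamma> v \<and> ?h \<gamma> = ?h \<alpha>i - ?h \<alpha>j"
      if ij: "i < 2" "j < 2" "i \<noteq> j" and e: "eigen (wmat B (\<theta> (gen i))) \<alpha>i v" "eigen (wmat B (\<theta> (gen j))) \<alpha>j v"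
        and s: "fst ` set (\<theta> (gen i)) \<subseteq> {..<2}" "fst ` set (\<theta> (gen j)) \<subseteq> {..<2}"
        and le: "?h \<alpha>j \<le> ?h \<alpha>i" for i j \<alpha>i \<alpha>j
    proof -
      have ijn: "i < n" "j < n" using ij n by auto
      \<comment> \<open>The exponent makes the two logarithms partly cancel:
        \<open>\<alpha>j\<close> is multiplied in if the signs differ, and its inverse
        otherwise.\<close>
      define pos where "pos \<longleftrightarrow> (ln (cmod \<alpha>i) \<ge> 0) \<noteq> (ln (cmod \<alpha>j) \<ge> 0)"
      obtain \<nu> where \<nu>: "\<nu> \<in> iso (Fn n) (Fn n)" "\<nu> (gen i) = gen i \<otimes>\<^bsub>Fn n\<^esub> [(j, pos)]"
        "\<And>k. k < n \<Longrightarrow> k \<noteq> i \<Longrightarrow> \<nu> (gen k) = gen k"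
        using iso_transvection[OF ijn ij(3)] by blast
      have nz: "\<alpha>i \<noteq> 0" "\<alpha>j \<noteq> 0" using eigen_SL2(1)[OF dw _ v(1)] e by blast+
      let ?\<gamma> = "\<alpha>i * (if pos then \<alpha>j else inverse \<alpha>j)"
      have val: "(\<theta> \<circ> \<nu>) (gen i) = \<theta> (gen i) \<otimes>\<^bsub>Fn n\<^esub> \<theta> [(j, pos)]"
        using ijn by (simp add: \<nu> hom_mult[OF \<theta>(2)])
      have "eigen (wmat B (\<theta> [(j, pos)])) (if pos then \<alpha>j else inverse \<alpha>j) v"
        using e eigen_SL2(3)[OF dw e(2) v(1)] ijn by (simp add: letter wmat_inv_Fn[OF B] cl)
      then have "eigen (wmat B ((\<theta> \<circ> \<nu>) (gen i))) ?\<gamma> v"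
        unfolding val wmat_mult_Fn[OF B] using e by (intro eigen_mult)
      moreover have "\<theta> \<circ> \<nu> \<in> iso (Fn n) (Fn n)" by (rule iso_set_trans[OF \<nu>(1) \<theta>(1)])
      moreover have "(\<theta> \<circ> \<nu>) (gen j) = \<theta> (gen j)" using \<nu>(3) ijn ij by simp
      moreover have "fst ` set ((\<theta> \<circ> \<nu>) (gen i)) \<subseteq> {..<2}"
        unfolding val using s ijn set_inv[OF cl] by (intro set_mult) (auto simp: letter)
      moreover have "?h ?\<gamma> = ?h \<alpha>i - ?h \<alpha>j"
      proof -
        have "ln (cmod ?\<gamma>) = ln (cmod \<alpha>i) + (if pos then ln (cmod \<alpha>j) else - ln (cmod \<alpha>j))"
          using nz by (simp add: norm_mult norm_inverse ln_mult ln_inverse)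
        then show ?thesis using le by (auto simp: pos_def abs_if split: if_splits)
      qed
      ultimately show ?thesis by blast
    qed
    show ?thesis
    proof (cases "?h \<beta> \<le> ?h \<alpha>")
      case True
      then obtain \<theta>' \<gamma> where "\<theta>' \<in> iso (Fn n) (Fn n)" "\<theta>' (gen 1) = \<theta> (gen 1)" "fst ` set (\<theta>' (gen 0)) \<subseteq> {..<2}"
        "eigen (wmat B (\<theta>' (gen 0))) \<gamma> v" "?h \<gamma> = ?h \<alpha> - ?h \<beta>"
        using key[of 0 1 \<alpha> \<beta>] g by (auto simp: good_def)
      then have "good \<theta>' \<gamma> \<beta>" "?h \<gamma> + ?h \<beta> = max (?h \<alpha>) (?h \<beta>)" using g True by (auto simp: good_def)
      then show ?thesis by blast
    next
      case False
      then obtain \<theta>' \<gamma> where "\<theta>' \<in> iso (Fn n) (Fn n)" "\<theta>' (gen 0) = \<theta> (gen 0)" "fst ` set (\<theta>' (gen 1)) \<subseteq> {..<2}"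
        "eigen (wmat B (\<theta>' (gen 1))) \<gamma> v" "?h \<gamma> = ?h \<beta> - ?h \<alpha>"
        using key[of 1 0 \<beta> \<alpha>] g by (auto simp: good_def)
      then have "good \<theta>' \<alpha> \<gamma>" "?h \<alpha> + ?h \<gamma> = max (?h \<alpha>) (?h \<beta>)" using g False by (auto simp: good_def)
      then show ?thesis by blast
    qed
  qed
  \<comment> \<open>Each step loses the smaller of the two values, which \<open>ge\<close> bounds
    from below, so N times their sum drops by at least ln 2. A nonnegative quantity allows only
    finitely many such steps.\<close>
  have none: "\<not> (good \<theta> \<alpha> \<beta> \<and> N * (?h \<alpha> + ?h \<beta>) < real s * ln 2)" for \<theta> \<alpha> \<beta> s
  proof (induction s arbitrary: \<theta> \<alpha> \<beta>)
    case 0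
    have "0 \<le> N * (?h \<alpha> + ?h \<beta>)" by (intro mult_nonneg_nonneg) auto
    then show ?case by (simp add: not_less)
  next
    case (Suc s)
    show ?case
    proof
      assume *: "good \<theta> \<alpha> \<beta> \<and> N * (?h \<alpha> + ?h \<beta>) < real (Suc s) * ln 2"
      then obtain \<theta>' \<alpha>' \<beta>' where g': "good \<theta>' \<alpha>' \<beta>'" and eq: "?h \<alpha>' + ?h \<beta>' = max (?h \<alpha>) (?h \<beta>)"
        using step by blast
      have "N * max (?h \<alpha>) (?h \<beta>) + ln 2 \<le> N * (?h \<alpha> + ?h \<beta>)"
        using ge(1,2)[of \<theta> \<alpha> \<beta>] * by (auto simp: max_def distrib_left)
      then have "N * (?h \<alpha>' + ?h \<beta>') < real s * ln 2" unfolding eq using * by (simp add: distrib_right)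
      then show False using Suc.IH[of \<theta>' \<alpha>' \<beta>'] g' by blast
    qed
  qed
  have "good (\<lambda>x. x) \<alpha>0 \<beta>0"
    using v by (auto simp: good_def gen_def iso_def hom_def bij_betw_def)
  moreover obtain s :: nat where "N * (?h \<alpha>0 + ?h \<beta>0) / ln 2 < real s" using reals_Archimedean2 by blast
  then have "N * (?h \<alpha>0 + ?h \<beta>0) < real s * ln 2" by (simp add: divide_less_eq)
  ultimately show False using none by blast
qed

corollary trace_expanding_no_common_eigenvector:
  assumes "\<And>i. det (B i) = 1" "2 \<le> n" "trace_expanding n N B"
  shows "\<not> common_eigenvector (B 0) (B 1)"
proof (rule no_common_eigenvector[OF assms(1,2)])
  fix \<theta> i and k :: nat
  assume "\<theta> \<in> iso (Fn n) (Fn n)" "i < (2::nat)" "1 \<le> k"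
  then show "2 ^ k \<le> (cmod (trace (mpow (wmat B (\<theta> (gen i))) k)) + 1) ^ N"
    using assms(2) by (intro trace_expanding_power[OF assms(1,3)]) auto
qed

section \<open>Limits of representations\<close>

lemma convergent_subsequence_family:
  fixes X :: "nat \<Rightarrow> nat \<Rightarrow> 'a::heine_borel"
  assumes "\<And>i. i < n \<Longrightarrow> bounded (range (\<lambda>k. X k i))"
  shows "\<exists>r L. strict_mono r \<and> (\<forall>i<n. (\<lambda>k. X (r k) i) \<longlonglongrightarrow> L i)"
  using assms
proof (induction n)
  case 0
  then show ?case by (intro exI[of _ "\<lambda>k. k"]) (simp add: strict_mono_def)
next
  case (Suc n)
  then obtain r L where r: "strict_mono r" "\<forall>i<n. (\<lambda>k. X (r k) i) \<longlonglongrightarrow> L i" by auto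
  have "bounded (range (\<lambda>k. X (r k) n))" by (rule bounded_subset[OF Suc.prems[of n]]) auto
  then obtain s l where s: "strict_mono s" "((\<lambda>k. X (r k) n) \<circ> s) \<longlonglongrightarrow> l"
    using bounded_imp_convergent_subsequence by blast
  have rs: "strict_mono (r \<circ> s)" by (rule strict_mono_o[OF r(1) s(1)])
  have "(\<lambda>k. X ((r \<circ> s) k) i) \<longlonglongrightarrow> (L(n := l)) i" if "i < Suc n" for i
    using that r(2) s(2) LIMSEQ_subseq_LIMSEQ[of "\<lambda>k. X (r k) i" "L i" s] s(1) by (auto simp: less_Suc_eq comp_def)
  with rs show ?case by blast
qed

lemma tendsto_cmod_of_square:
  fixes f :: "nat \<Rightarrow> complex"
  assumes "(\<lambda>k. (f k)\<^sup>2) \<longlonglongrightarrow> c\<^sup>2" shows "(\<lambda>k. cmod (f k)) \<longlonglongrightarrow> cmod c"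
proof -
  have "(\<lambda>k. sqrt (cmod ((f k)\<^sup>2))) \<longlonglongrightarrow> sqrt (cmod (c\<^sup>2))"
    by (intro tendsto_real_sqrt tendsto_norm assms)
  then show ?thesis by (simp add: norm_power)
qed

lemma wmat_normalize:
  assumes "\<And>i. det (B i) = 1" shows "wmat B (foldr push u []) = wmat B u"
  by (simp add: wmat_foldr_push[OF assms])

text \<open>The representations are conjugated so that the first two generators converge. The
  limit pair has no common eigenvector, so its traces bound the remaining generators, and a
  subsequence converges to a tuple \<open>L\<close> with the same traces (up to sign) as \<open>B0\<close>. Being \<open>expanding\<close> is
  inherited from \<open>B0\<close> because the norm is comparable to \<open>trace_norm\<close>.\<close>

lemma trace_expanding_limit:
  fixes B :: "nat \<Rightarrow> nat \<Rightarrow> mat2"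
  assumes n: "2 \<le> n" and B: "\<And>k i. det (B k i) = 1" and B0: "\<And>i. det (B0 i) = 1"
    and te: "\<And>k. \<exists>N. trace_expanding n N (B k)" and te0: "trace_expanding n N0 B0"
    and ex: "expanding B0 (prim_seqs n)"
    and lim: "\<And>u. u \<in> carrier (Fn n) \<Longrightarrow> (\<lambda>k. (trace (wmat (B k) u))\<^sup>2) \<longlonglongrightarrow> (trace (wmat B0 u))\<^sup>2"
  obtains N r where "strict_mono (r :: nat \<Rightarrow> nat)" "\<forall>\<^sub>F k in sequentially. trace_expanding n N (B (r k))"
proof -
  have lim': "(\<lambda>k. cmod (trace (wmat (B k) u))) \<longlonglongrightarrow> cmod (trace (wmat B0 u))" if u: "fst ` set u \<subseteq> {..<n}" for u
  proof -
    have "foldr push u [] \<in> carrier (Fn n)" using u by (intro foldr_push_closed) auto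
    from lim[OF this] show ?thesis
      by (intro tendsto_cmod_of_square) (simp add: wmat_normalize B B0)
  qed
  have bd: "\<exists>T. \<forall>k. cmod (trace (wmat (B k) u)) \<le> T" if u: "fst ` set u \<subseteq> {..<n}" for u
  proof -
    have "Bseq (\<lambda>k. cmod (trace (wmat (B k) u)))" using lim'[OF u] by (intro convergent_imp_Bseq) (auto simp: convergent_def)
    then show ?thesis by (auto simp: Bseq_def)
  qed
  define T where "T u = (SOME T. \<forall>k. cmod (trace (wmat (B k) u)) \<le> T)" for u
  have T: "cmod (trace (wmat (B k) u)) \<le> T u" if "fst ` set u \<subseteq> {..<n}" for k u
    using someI_ex[OF bd[OF that]] by (auto simp: T_def)
  have nce: "\<not> common_eigenvector (B k 0) (B k 1)" for k
    using te[of k] trace_expanding_no_common_eigenvector[of "B k", OF B n] by blast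
  let ?g = "\<lambda>i. [(i, True)] :: nat word"
  have T0: "0 \<le> T u" if "fst ` set u \<subseteq> {..<n}" for u using T[OF that, of 0] norm_ge_zero order_trans by blast
  define M0 where "M0 = T (?g 0) + T (?g 1) + T (?g 0 @ ?g 1)"
  define M where "M = 4 * (M0 + 1) ^ 2"
  have "\<exists>P. det P = 1 \<and> norm (adj2 P ** B k 0 ** P) \<le> M \<and> norm (adj2 P ** B k 1 ** P) \<le> M" for k
  proof -
    have "cmod (trace (B k 0)) \<le> M0" "cmod (trace (B k 1)) \<le> M0" "cmod (trace (B k 0 ** B k 1)) \<le> M0"
      using T[of "?g 0" k] T[of "?g 1" k] T[of "?g 0 @ ?g 1" k] T0[of "?g 0"] T0[of "?g 1"] T0[of "?g 0 @ ?g 1"] n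
      by (auto simp: M0_def)
    from bounded_normal_form[OF B B nce this] show ?thesis unfolding M_def by blast
  qed
  then obtain P where P: "\<And>k. det (P k) = 1" "\<And>k. norm (adj2 (P k) ** B k 0 ** P k) \<le> M"
    "\<And>k. norm (adj2 (P k) ** B k 1 ** P k) \<le> M" by metis
  define C where "C k i = adj2 (P k) ** B k i ** P k" for k i
  have dC: "det (C k i) = 1" for k i by (simp add: C_def det_mul P B)
  have wC: "wmat (C k) u = adj2 (P k) ** wmat (B k) u ** P k" for k u
    unfolding C_def by (rule wmat_conj[OF P(1)])
  have trC: "trace (wmat (C k) u) = trace (wmat (B k) u)" for k u
    unfolding wC by (rule trace_conj[OF P(1)])
  have "bounded (range (\<lambda>k. C k i))" if "i < 2" for i
    using that P by (auto simp: less_2_cases_iff C_def bounded_iff)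
  then obtain r L where r: "strict_mono r" and L: "\<forall>i<2. (\<lambda>k. C (r k) i) \<longlonglongrightarrow> L i"
    using convergent_subsequence_family[of 2 C] by blast
  define L' where "L' i = (if i < 2 then L i else mat 1)" for i :: nat
  \<comment> \<open>Moduli are what passes to the limit, as the hypothesis concerns squares. It is
    applied with m = 2 for the first two generators and with m = n for all of them.\<close>
  have same_trace: "cmod (trace (wmat Z u)) = cmod (trace (wmat B0 u))"
    if s: "strict_mono s" and Z: "\<And>i. i < m \<Longrightarrow> (\<lambda>k. C (s k) i) \<longlonglongrightarrow> Z i" and u: "fst ` set u \<subseteq> {..<m}" and m: "m \<le> n"
    for s m Z u
  proof (rule LIMSEQ_unique)
    show "(\<lambda>k. cmod (trace (wmat (C (s k)) u))) \<longlonglongrightarrow> cmod (trace (wmat Z u))"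
      using Z u by (intro tendsto_norm tendsto_trace2 tendsto_wmat) auto
    have "fst ` set u \<subseteq> {..<n}" using u m by auto
    from LIMSEQ_subseq_LIMSEQ[OF lim'[OF this] s]
    show "(\<lambda>k. cmod (trace (wmat (C (s k)) u))) \<longlonglongrightarrow> cmod (trace (wmat B0 u))" by (simp add: comp_def trC)
  qed
  have det_lim: "det Z = 1" if "(\<lambda>k. C (s k) i) \<longlonglongrightarrow> Z" for s Z i
    using tendsto_det2[OF that] by (simp add: dC LIMSEQ_const_iff)
  have dL': "det (L' i) = 1" for i using L det_lim[of r i "L i"] by (simp add: L'_def)
  \<comment> \<open>At this point only words in the letters 0 and 1 have limits. Their traces have
    the same moduli as for \<open>B0\<close>, where the growth is known; the identity matrices in
    \<open>L'\<close> are placeholders.\<close>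
  have "\<not> common_eigenvector (L' 0) (L' 1)"
  proof (rule no_common_eigenvector[where n = n and N = N0])
    fix \<theta> i and k :: nat
    assume \<theta>: "\<theta> \<in> iso (Fn n) (Fn n)" "fst ` set (\<theta> (gen 0)) \<subseteq> {..<2}" "fst ` set (\<theta> (gen 1)) \<subseteq> {..<2}"
      and i: "i < (2::nat)" and k: "1 \<le> k"
    have u: "fst ` set (\<theta> (gen i)) \<subseteq> {..<2}" using \<theta> i by (auto simp: less_2_cases_iff)
    obtain v where v: "\<forall>x\<in>set v. x \<in> set (\<theta> (gen i))" "\<And>B :: nat \<Rightarrow> mat2. mpow (wmat B (\<theta> (gen i))) k = wmat B v"
      using mpow_wmat[of "\<theta> (gen i)" k] by blast
    have "fst ` set v \<subseteq> {..<2}" using v(1) u by auto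
    then have "cmod (trace (wmat L' v)) = cmod (trace (wmat B0 v))"
      using L by (intro same_trace[OF r]) (auto simp: L'_def n)
    then show "2 ^ k \<le> (cmod (trace (mpow (wmat L' (\<theta> (gen i))) k)) + 1) ^ N0"
      using trace_expanding_power[OF B0 te0 \<theta>(1) _ k, of i] i n v(2) by simp
  qed (rule dL' n)+
  then obtain \<epsilon> where \<epsilon>: "0 < \<epsilon>" "\<And>X. \<epsilon> * norm X \<le> trace_norm (L' 0) (L' 1) X"
    using trace_norm_lower[OF dL' dL'] by blast
  have L01: "(\<lambda>k. C (r k) 0) \<longlonglongrightarrow> L' 0" "(\<lambda>k. C (r k) 1) \<longlonglongrightarrow> L' 1" using L by (auto simp: L'_def)
  define e where "e k = 2 * (norm (C (r k) 0 - L' 0) + norm (C (r k) 1 - L' 1) + norm (C (r k) 0 ** C (r k) 1 - L' 0 ** L' 1))" for k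
  have "e \<longlonglongrightarrow> 2 * (norm (L' 0 - L' 0) + norm (L' 1 - L' 1) + norm (L' 0 ** L' 1 - L' 0 ** L' 1))"
    unfolding e_def by (intro tendsto_intros tendsto_mult2 L01)
  then have "\<forall>\<^sub>F k in sequentially. e k < \<epsilon> / 2"
    by (rule order_tendstoD) (simp add: \<epsilon>)
  then obtain K where K: "\<And>k. K \<le> k \<Longrightarrow> e k < \<epsilon> / 2"
    by (auto simp: eventually_sequentially)
  \<comment> \<open>The shift by \<open>K\<close> makes the perturbation bound hold for every
    member, so the remaining generators are bounded along the whole sequence.\<close>
  define R where "R k = r (k + K)" for k
  have R: "strict_mono R" using r by (auto simp: R_def strict_mono_def)
  have "bounded (range (\<lambda>k. C (R k) i))" if i: "i < n" for i
  proof -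
    define b where "b = (T (?g i) + T (?g 0 @ ?g i) + T (?g 1 @ ?g i) + T (?g 0 @ ?g 1 @ ?g i)) / (\<epsilon> / 2)"
    have "norm (C (R k) i) \<le> b" for k
    proof -
      let ?C = "C (R k)"
      have "\<epsilon> / 2 * norm (?C i) \<le> trace_norm (?C 0) (?C 1) (?C i)"
        unfolding R_def by (rule trace_norm_perturb[OF \<epsilon>(2)]) (use K[of "k + K"] in \<open>simp add: e_def\<close>)
      also have "\<dots> = cmod (trace (wmat ?C (?g i))) + cmod (trace (wmat ?C (?g 0 @ ?g i)))
          + cmod (trace (wmat ?C (?g 1 @ ?g i))) + cmod (trace (wmat ?C (?g 0 @ ?g 1 @ ?g i)))"
        by (simp add: trace_norm_def matrix_mul_assoc)
      also have "\<dots> \<le> T (?g i) + T (?g 0 @ ?g i) + T (?g 1 @ ?g i) + T (?g 0 @ ?g 1 @ ?g i)"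
        unfolding trC using i n by (intro add_mono T) auto
      finally show ?thesis using \<epsilon>(1) by (simp add: b_def field_simps)
    qed
    then show ?thesis by (auto simp: bounded_iff)
  qed
  then obtain q Z where q: "strict_mono q" and Z: "\<forall>i<n. (\<lambda>k. C (R (q k)) i) \<longlonglongrightarrow> Z i"
    using convergent_subsequence_family[of n "\<lambda>k. C (R k)"] by blast
  define s where "s = R \<circ> q"
  have s: "strict_mono s" unfolding s_def by (rule strict_mono_o[OF R q])
  define W where "W i = (if i < n then Z i else mat 1)" for i
  have W: "(\<lambda>k. C (s k) i) \<longlonglongrightarrow> W i" if "i < n" for i using Z that by (simp add: W_def s_def)
  have dW: "det (W i) = 1" for i using W[of i] det_lim[of s i "W i"] by (cases "i < n") (auto simp: W_def)
  have trW: "cmod (trace (wmat W u)) = cmod (trace (wmat B0 u))" if "fst ` set u \<subseteq> {..<n}" for u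
    by (rule same_trace[OF s W that]) auto
  obtain \<delta> where \<delta>: "0 < \<delta>" "\<And>X. \<delta> * norm X \<le> trace_norm (B0 0) (B0 1) X"
    using trace_norm_lower[OF B0 B0] trace_expanding_no_common_eigenvector[OF B0 n te0] by blast
  define c where "c = 2 * (1 + norm (W 0) + norm (W 1) + norm (W 0 ** W 1))"
  have c: "0 < c" unfolding c_def by (intro mult_pos_pos add_pos_nonneg) auto
  \<comment> \<open>The traces that make up \<open>trace_norm\<close> are traces of words, so their
    moduli agree for \<open>B0\<close> and \<open>W\<close>. They dominate the norm on the side of
    \<open>B0\<close> and are dominated by it on the side of \<open>W\<close>.\<close>
  have cmp: "\<delta> * norm (wmat B0 u) \<le> c * norm (wmat W u)" if u: "fst ` set u \<subseteq> {..<n}" for u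
  proof -
    have tr: "cmod (trace (wmat B0 f ** wmat B0 u)) = cmod (trace (wmat W f ** wmat W u))" if "fst ` set f \<subseteq> {..<n}" for f
      using trW[of "f @ u"] that u by (simp add: wmat_append image_Un)
    have le: "cmod (trace (X ** wmat W u)) \<le> 2 * (norm X * norm (wmat W u))" for X
      using norm_trace2[of "X ** wmat W u"] norm_mult2[of X "wmat W u"] by linarith
    have "\<delta> * norm (wmat B0 u) \<le> trace_norm (B0 0) (B0 1) (wmat B0 u)" by (rule \<delta>)
    also have "\<dots> = cmod (trace (wmat W u)) + cmod (trace (W 0 ** wmat W u)) + cmod (trace (W 1 ** wmat W u)) + cmod (trace (W 0 ** W 1 ** wmat W u))"
      using tr[of "[]"] tr[of "?g 0"] tr[of "?g 1"] tr[of "?g 0 @ ?g 1"] n by (simp add: trace_norm_def matrix_mul_assoc)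
    also have "\<dots> \<le> 2 * norm (wmat W u) + 2 * (norm (W 0) * norm (wmat W u)) + 2 * (norm (W 1) * norm (wmat W u)) + 2 * (norm (W 0 ** W 1) * norm (wmat W u))"
      by (intro add_mono le norm_trace2)
    also have "\<dots> = c * norm (wmat W u)" by (simp add: c_def algebra_simps)
    finally show ?thesis .
  qed
  have "expanding W (prim_seqs n)"
  proof -
    obtain a \<mu> where a: "0 < a" "1 < \<mu>" "\<And>p j m. p \<in> prim_seqs n \<Longrightarrow> a * \<mu> ^ m \<le> (norm (wmat B0 (seg p j m)))\<^sup>2"
      using ex by (auto simp: expanding_def)
    have "(\<delta> / c)\<^sup>2 * a * \<mu> ^ m \<le> (norm (wmat W (seg p j m)))\<^sup>2" if p: "p \<in> prim_seqs n" for p j m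
    proof -
      have "fst ` set (seg p j m) \<subseteq> {..<n}" using prim_seqs_letter[OF p] by (auto simp: seg_def)
      then have "\<delta> / c * norm (wmat B0 (seg p j m)) \<le> norm (wmat W (seg p j m))"
        using cmp[of "seg p j m"] c by (simp add: field_simps)
      then have le: "(\<delta> / c * norm (wmat B0 (seg p j m)))\<^sup>2 \<le> (norm (wmat W (seg p j m)))\<^sup>2"
        using \<delta>(1) c by (intro power_mono) auto
      have "(\<delta> / c)\<^sup>2 * a * \<mu> ^ m \<le> (\<delta> / c)\<^sup>2 * (norm (wmat B0 (seg p j m)))\<^sup>2"
        unfolding mult.assoc by (intro mult_left_mono a(3) p) simp
      also have "\<dots> = (\<delta> / c * norm (wmat B0 (seg p j m)))\<^sup>2" by (simp only: power_mult_distrib)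
      finally show ?thesis using le by linarith
    qed
    then show ?thesis unfolding expanding_def using a \<delta> c by (intro exI[of _ "(\<delta> / c)\<^sup>2 * a"] exI[of _ \<mu>]) auto
  qed
  then obtain N where "\<forall>\<^sub>F k in sequentially. \<forall>p\<in>prim_seqs n. locally_expanding (C (s k)) p N"
  proof (rule locally_expanding_nearby[where L = W and S = "prim_seqs n" and I = "{..<n}"
        and B = "\<lambda>k. C (s k)" and F = sequentially, OF dW])
    show "fst (a i) \<in> {..<n}" if "a \<in> prim_seqs n" for a i using prim_seqs_letter[OF that] by simp
    show "(\<lambda>k. C (s k) i) \<longlonglongrightarrow> W i" if "i \<in> {..<n}" for i using W that by simp
  qed auto
  then have "\<forall>\<^sub>F k in sequentially. trace_expanding n N (B (s k))"
  proof eventually_elim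
    case (elim k)
    have "trace_expanding n N (C (s k))" using elim by (intro trace_expandingI dC) auto
    then show ?case unfolding C_def trace_expanding_conj[OF P(1)] .
  qed
  with s show ?thesis by (rule that)
qed

section \<open>Axes in the Cayley tree\<close>

lemma cayley_edges_sym: "(g, h) \<in> cayley_edges n \<longleftrightarrow> (h, g) \<in> cayley_edges n"
  by (auto simp: cayley_edges_def)

lemma cayley_edges_relpow_sym: "(g, h) \<in> cayley_edges n ^^ m \<Longrightarrow> (h, g) \<in> cayley_edges n ^^ m"
proof (induction m arbitrary: h)
  case (Suc m)
  then obtain k where "(g, k) \<in> cayley_edges n ^^ m" "(k, h) \<in> cayley_edges n" by auto
  then have "(h, k) \<in> cayley_edges n" "(k, g) \<in> cayley_edges n ^^ m" using Suc.IH cayley_edges_sym by auto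
  then show ?case by (rule relpow_Suc_I2)
qed simp

lemma vertex_dist_sym: "vertex_dist n g h = vertex_dist n h g"
proof -
  have "(g, h) \<in> cayley_edges n ^^ m \<longleftrightarrow> (h, g) \<in> cayley_edges n ^^ m" for m
    using cayley_edges_relpow_sym by blast
  then show ?thesis by (simp add: vertex_dist_def)
qed

lemma vertex_dist_refl [simp]: "vertex_dist n g g = 0"
  unfolding vertex_dist_def by (rule Least_eq_0) simp

lemma cayley_edges_carrier: "(g, h) \<in> cayley_edges n \<Longrightarrow> g \<in> carrier (Fn n) \<and> h \<in> carrier (Fn n)"
  by (simp add: cayley_edges_def)

lemma cayley_edges_letter:
  assumes "g \<in> carrier (Fn n)" "fst a < n" shows "(g, g \<otimes>\<^bsub>Fn n\<^esub> [a]) \<in> cayley_edges n"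
proof -
  interpret group "Fn n" by (rule group_free_group)
  obtain i s where a: "a = (i, s)" by (cases a)
  have i: "i < n" using assms a by simp
  have m: "g \<otimes>\<^bsub>Fn n\<^esub> [(i, False)] \<otimes>\<^bsub>Fn n\<^esub> gen i = g"
  proof -
    have "[(i, False)] \<otimes>\<^bsub>Fn n\<^esub> gen i = \<one>\<^bsub>Fn n\<^esub>" by (simp add: mult_Fn one_Fn gen_def)
    then show ?thesis using assms i by (simp add: m_assoc)
  qed
  have c: "g \<otimes>\<^bsub>Fn n\<^esub> [a] \<in> carrier (Fn n)" using assms by (intro m_closed) auto
  show ?thesis
  proof (cases s)
    case True
    then show ?thesis using assms(1) c i a by (auto simp: cayley_edges_def gen_def)
  next
    case False
    then show ?thesis using assms(1) c i a m by (auto simp: cayley_edges_def)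
  qed
qed

text \<open>Each edge multiplies by one letter, so the word length of g^(-1) h bounds every path
  from below; this yields the lower bound for \<open>vertex_dist\<close>.\<close>

lemma length_inv_mult_le:
  assumes "(g, h) \<in> cayley_edges n ^^ m" "g \<in> carrier (Fn n)"
  shows "h \<in> carrier (Fn n) \<and> length (inv\<^bsub>Fn n\<^esub> g \<otimes>\<^bsub>Fn n\<^esub> h) \<le> m"
  using assms(1)
proof (induction m arbitrary: h)
  case 0
  interpret group "Fn n" by (rule group_free_group)
  show ?case using 0 assms(2) by (simp add: l_inv one_Fn)
next
  case (Suc m)
  interpret group "Fn n" by (rule group_free_group)
  obtain k where k: "(g, k) \<in> cayley_edges n ^^ m" "(k, h) \<in> cayley_edges n" using Suc.prems by auto
  note c = cayley_edges_carrier[OF k(2)]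
  obtain i where i: "i < n" "h = k \<otimes>\<^bsub>Fn n\<^esub> gen i \<or> k = h \<otimes>\<^bsub>Fn n\<^esub> gen i"
    using k(2) by (auto simp: cayley_edges_def)
  have "\<exists>a. fst a < n \<and> h = k \<otimes>\<^bsub>Fn n\<^esub> [a]"
  proof (cases "h = k \<otimes>\<^bsub>Fn n\<^esub> gen i")
    case True
    then show ?thesis using i by (intro exI[of _ "(i, True)"]) (simp add: gen_def)
  next
    case False
    have "gen i \<otimes>\<^bsub>Fn n\<^esub> [(i, False)] = \<one>\<^bsub>Fn n\<^esub>" by (simp add: mult_Fn one_Fn gen_def)
    then have "h = k \<otimes>\<^bsub>Fn n\<^esub> [(i, False)]" using False i c by (simp add: m_assoc)
    then show ?thesis using i by auto
  qed
  then obtain a where a: "fst a < n" "h = k \<otimes>\<^bsub>Fn n\<^esub> [a]" by blast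
  then have "inv\<^bsub>Fn n\<^esub> g \<otimes>\<^bsub>Fn n\<^esub> h = (inv\<^bsub>Fn n\<^esub> g \<otimes>\<^bsub>Fn n\<^esub> k) \<otimes>\<^bsub>Fn n\<^esub> [a]"
    using assms(2) c by (simp add: m_assoc)
  then have "length (inv\<^bsub>Fn n\<^esub> g \<otimes>\<^bsub>Fn n\<^esub> h) \<le> length (inv\<^bsub>Fn n\<^esub> g \<otimes>\<^bsub>Fn n\<^esub> k) + 1"
    using length_mult_Fn[of n "inv\<^bsub>Fn n\<^esub> g \<otimes>\<^bsub>Fn n\<^esub> k" "[a]"] by simp
  then show ?case using Suc.IH[OF k(1)] c by simp
qed

section \<open>The axis of a cyclically reduced word\<close>

locale cyclic_word =
  fixes n :: nat and w :: "nat word"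
  assumes w_in: "w \<in> carrier (Fn n)" and w_ne: "w \<noteq> []" and w_cyc: "cyclically_reduced w"
begin

sublocale Fn: group "Fn n" by (rule group_free_group)

definition letter :: "int \<Rightarrow> nat \<times> bool" where
  "letter k = w ! nat (k mod int (length w))"

definition seg_word :: "int \<Rightarrow> nat \<Rightarrow> nat word" where
  "seg_word j m = map (\<lambda>i. letter (j + int i)) [0..<m]"

text \<open>The bi-infinite path through the identity in which \<open>letter k\<close> labels the
  step from position k to k+1. Walking backwards spells inverse letters and starts with
  \<open>letter (- 1)\<close>, hence the offset.\<close>

definition vert :: "int \<Rightarrow> nat word" where
  "vert k = (if 0 \<le> k then seg_word 0 (nat k) else map (\<lambda>i. flip (letter (- 1 - int i))) [0..<nat (- k)])"

lemma letter_less: "fst (letter k) < n"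
proof -
  have "nat (k mod int (length w)) < length w" using w_ne by (simp add: nat_less_iff)
  then have "letter k \<in> set w" unfolding letter_def by (rule nth_mem)
  then show ?thesis using w_in by (simp add: carrier_Fn)
qed

lemma letter_nat: "letter (int i) = per w i"
  by (simp add: letter_def per_def nat_mod_as_int)

lemma letter_periodic: "letter (k + int (length w)) = letter k"
  by (simp add: letter_def)

lemma letter_Suc: "letter (k + 1) \<noteq> flip (letter k)"
proof -
  let ?l = "length w" and ?i = "nat (k mod int (length w))"
  have l: "0 < ?l" using w_ne by simp
  have i: "?i < ?l" using l by (simp add: nat_less_iff)
  have ii: "int ?i = k mod int ?l" using l by simp
  \<comment> \<open>The second copy of \<open>w\<close> covers the step from the last letter to the
    first letter of the next period.\<close>
  have "(w @ w) ! Suc ?i \<noteq> flip ((w @ w) ! ?i)"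
  proof -
    have "successively (\<lambda>a b. \<not> (fst b = fst a \<and> snd b \<noteq> snd a)) (w @ w)"
      using w_cyc by (simp add: cyclically_reduced_def reduced_def)
    then have "\<not> (fst ((w @ w) ! Suc ?i) = fst ((w @ w) ! ?i) \<and> snd ((w @ w) ! Suc ?i) \<noteq> snd ((w @ w) ! ?i))"
      using i l unfolding successively_conv_nth by (simp del: nth_append)
    then show ?thesis by (metis fst_conv snd_conv)
  qed
  moreover have "(w @ w) ! ?i = letter k" using i by (simp add: letter_def nth_append)
  moreover have "(w @ w) ! Suc ?i = letter (k + 1)"
  proof -
    have e: "(k + 1) mod int ?l = (int ?i + 1) mod int ?l" unfolding ii by (simp add: mod_add_left_eq)
    show ?thesis
    proof (cases "Suc ?i < ?l")
      case True
      then have "(int ?i + 1) mod int ?l = int (Suc ?i)" by simp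
      with e have "(k + 1) mod int ?l = int (Suc ?i)" by (simp only:)
      then have "nat ((k + 1) mod int ?l) = Suc ?i" by (simp only: nat_int)
      then show ?thesis using True by (simp add: letter_def nth_append)
    next
      case False
      then have S: "Suc ?i = ?l" using i by simp
      then have "int ?i + 1 = int ?l" by linarith
      with e have "nat ((k + 1) mod int ?l) = 0" by simp
      then show ?thesis using S by (simp add: letter_def nth_append)
    qed
  qed
  ultimately show ?thesis by simp
qed

lemma reduced_map_upt:
  assumes "\<And>i. f (Suc i) \<noteq> flip (f i)" shows "reduced (map f [0..<m])"
  using assms by (auto simp: reduced_def successively_conv_nth prod_eq_iff)

lemma seg_word_in: "seg_word j m \<in> carrier (Fn n)"
proof -
  have "reduced (seg_word j m)" unfolding seg_word_def
    using letter_Suc[of "j + int _"] by (intro reduced_map_upt) (simp add: algebra_simps)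
  then show ?thesis using letter_less by (auto simp: carrier_Fn seg_word_def)
qed

lemma neg_word_in: "map (\<lambda>i. flip (letter (- 1 - int i))) [0..<m] \<in> carrier (Fn n)"
proof -
  have "reduced (map (\<lambda>i. flip (letter (- 1 - int i))) [0..<m])"
  proof (rule reduced_map_upt)
    fix i
    have "letter (- 1 - int i) \<noteq> flip (letter (- 1 - int (Suc i)))"
      using letter_Suc[of "- 1 - int (Suc i)"] by simp
    then show "flip (letter (- 1 - int (Suc i))) \<noteq> flip (flip (letter (- 1 - int i)))" by (auto simp: prod_eq_iff)
  qed
  then show ?thesis using letter_less by (auto simp: carrier_Fn)
qed

lemma vert_in: "vert k \<in> carrier (Fn n)"
  using seg_word_in neg_word_in by (simp add: vert_def)

lemma seg_word_Suc: "seg_word j (Suc m) = seg_word j m \<otimes>\<^bsub>Fn n\<^esub> [letter (j + int m)]"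
proof -
  have eq: "seg_word j (Suc m) = seg_word j m @ [letter (j + int m)]" by (simp add: seg_word_def)
  moreover have "reduced (seg_word j (Suc m))" using seg_word_in by (simp add: carrier_Fn)
  ultimately show ?thesis using mult_Fn_append by metis
qed

lemma vert_Suc: "vert (k + 1) = vert k \<otimes>\<^bsub>Fn n\<^esub> [letter k]"
proof (cases "0 \<le> k")
  case True
  then have "nat (k + 1) = Suc (nat k)" by simp
  then show ?thesis using True seg_word_Suc[of 0 "nat k"] by (simp add: vert_def)
next
  case False
  define m where "m = nat (- k - 1)"
  have m: "nat (- k) = Suc m" "nat (- (k + 1)) = m" "- 1 - int m = k" using False by (auto simp: m_def)
  let ?f = "\<lambda>i. flip (letter (- 1 - int i))"
  have v: "vert k = map ?f [0..<m] @ [?f m]" using False m by (simp add: vert_def)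
  have "vert (k + 1) = map ?f [0..<m]"
  proof (cases "k = - 1")
    case True
    then show ?thesis using m by (simp add: vert_def seg_word_def m_def)
  next
    case False
    then show ?thesis using \<open>\<not> 0 \<le> k\<close> m by (simp add: vert_def)
  qed
  moreover have "vert k \<otimes>\<^bsub>Fn n\<^esub> [letter k] = butlast (vert k)"
    using v m(3) by (intro cancel_last vert_in) auto
  ultimately show ?thesis using v by simp
qed

lemma vert_0 [simp]: "vert 0 = []" by (simp add: vert_def seg_word_def)

lemma vert_add: "vert (j + int m) = vert j \<otimes>\<^bsub>Fn n\<^esub> seg_word j m"
proof (induction m)
  case 0
  have "seg_word j 0 = \<one>\<^bsub>Fn n\<^esub>" by (simp add: seg_word_def one_Fn)
  then show ?case using vert_in by simp
next
  case (Suc m)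
  have "vert (j + int (Suc m)) = vert (j + int m + 1)" by (simp add: algebra_simps)
  also have "\<dots> = vert j \<otimes>\<^bsub>Fn n\<^esub> seg_word j m \<otimes>\<^bsub>Fn n\<^esub> [letter (j + int m)]" by (simp add: vert_Suc Suc)
  also have "\<dots> = vert j \<otimes>\<^bsub>Fn n\<^esub> seg_word j (Suc m)"
    unfolding seg_word_Suc using vert_in seg_word_in letter_less by (simp add: Fn.m_assoc)
  finally show ?case .
qed

lemma vert_translate: "w \<otimes>\<^bsub>Fn n\<^esub> vert k = vert (k + int (length w))"
proof (induction k rule: int_induct[where k = 0])
  case base
  have "vert (int (length w)) = w"
    by (auto simp: vert_def seg_word_def letter_nat per_def intro!: nth_equalityI)
  moreover have "w \<otimes>\<^bsub>Fn n\<^esub> [] = w" using w_in Fn.r_one by (simp add: one_Fn)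
  ultimately show ?case by simp
next
  case (step1 k)
  have "w \<otimes>\<^bsub>Fn n\<^esub> vert (k + 1) = w \<otimes>\<^bsub>Fn n\<^esub> vert k \<otimes>\<^bsub>Fn n\<^esub> [letter k]"
    using w_in vert_in letter_less by (simp add: vert_Suc Fn.m_assoc)
  also have "\<dots> = vert (k + int (length w) + 1)"
    using step1 by (simp add: vert_Suc letter_periodic)
  finally show ?case by (simp add: algebra_simps)
next
  case (step2 k)
  have "w \<otimes>\<^bsub>Fn n\<^esub> vert (k - 1) \<otimes>\<^bsub>Fn n\<^esub> [letter (k - 1)] = w \<otimes>\<^bsub>Fn n\<^esub> vert k"
    using w_in vert_in letter_less vert_Suc[of "k - 1"] by (simp add: Fn.m_assoc)
  also have "\<dots> = vert (k - 1 + int (length w)) \<otimes>\<^bsub>Fn n\<^esub> [letter (k - 1)]"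
    using step2 vert_Suc[of "k - 1 + int (length w)"] letter_periodic[of "k - 1"] by simp
  finally show ?case using w_in vert_in letter_less by (simp add: Fn.right_cancel)
qed

text \<open>The letters give a path of length m, and none is shorter because the quotient of the two
  vertices is the reduced word \<open>seg_word j m\<close>.\<close>

lemma vertex_dist_vert_add: "vertex_dist n (vert j) (vert (j + int m)) = m"
proof -
  have "(vert j, vert (j + int m)) \<in> cayley_edges n ^^ m"
  proof (induction m)
    case (Suc m)
    have "vert (j + int (Suc m)) = vert (j + int m) \<otimes>\<^bsub>Fn n\<^esub> [letter (j + int m)]"
      using vert_Suc[of "j + int m"] by (simp add: algebra_simps)
    then have "(vert (j + int m), vert (j + int (Suc m))) \<in> cayley_edges n"
      using cayley_edges_letter[OF vert_in letter_less] by metis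
    with Suc show ?case by (rule relpow_Suc_I)
  qed simp
  moreover have "m \<le> l" if "(vert j, vert (j + int m)) \<in> cayley_edges n ^^ l" for l
  proof -
    have "inv\<^bsub>Fn n\<^esub> (vert j) \<otimes>\<^bsub>Fn n\<^esub> vert (j + int m) = seg_word j m"
      unfolding vert_add using vert_in[of j] seg_word_in[of j m] by (simp add: Fn.l_inv flip: Fn.m_assoc)
    then show ?thesis using length_inv_mult_le[OF that vert_in] by (simp add: seg_word_def)
  qed
  ultimately show ?thesis unfolding vertex_dist_def by (intro Least_equality)
qed

lemma vertex_dist_vert: "real (vertex_dist n (vert j) (vert k)) = \<bar>real_of_int j - real_of_int k\<bar>"
proof (cases "j \<le> k")
  case True
  then show ?thesis using vertex_dist_vert_add[of j "nat (k - j)"] by simp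
next
  case False
  then show ?thesis using vertex_dist_vert_add[of k "nat (j - k)"] vertex_dist_sym[of n "vert j"] by simp
qed

lemma vert_inj: "vert j = vert k \<longleftrightarrow> j = k"
  using vertex_dist_vert[of j k] by auto

text \<open>Edges of \<open>tree\<close> are stored in the direction of a generator. For an inverse
  letter the edge starts at the later vertex and is traversed with reversed parameter.\<close>

definition axis :: "real \<Rightarrow> tree_point" where
  "axis s = (let k = \<lfloor>s\<rfloor>; a = letter k in
     if snd a then (vert k, fst a, frac s) else (vert (k + 1), fst a, 1 - frac s))"

lemma vert_letter_False: "\<not> snd (letter k) \<Longrightarrow> vert (k + 1) \<otimes>\<^bsub>Fn n\<^esub> gen (fst (letter k)) = vert k"
proof -
  assume "\<not> snd (letter k)"
  then have l: "letter k = (fst (letter k), False)" by (simp add: prod_eq_iff)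
  have "[letter k] \<otimes>\<^bsub>Fn n\<^esub> gen (fst (letter k)) = \<one>\<^bsub>Fn n\<^esub>"
    by (subst l) (simp add: mult_Fn one_Fn gen_def)
  then show ?thesis using vert_in letter_less by (simp add: vert_Suc Fn.m_assoc)
qed

lemma vert_letter_True: "snd (letter k) \<Longrightarrow> vert k \<otimes>\<^bsub>Fn n\<^esub> gen (fst (letter k)) = vert (k + 1)"
  unfolding vert_Suc gen_def by (metis prod.collapse)

lemma edge_ends_axis:
  "edge_ends n (axis s) = {(vert \<lfloor>s\<rfloor>, frac s), (vert (\<lfloor>s\<rfloor> + 1), 1 - frac s)}"
  by (cases "snd (letter \<lfloor>s\<rfloor>)")
    (auto simp: axis_def Let_def vert_letter_True vert_letter_False)

lemma axis_in_tree: "axis s \<in> tree n"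
  using vert_in letter_less frac_lt_1[of s]
  by (auto simp: axis_def Let_def tree_def less_imp_le)

lemma tree_dist_Min:
  "\<not> (fst p = fst q \<and> fst (snd p) = fst (snd q)) \<Longrightarrow>
   tree_dist n p q = Min ((\<lambda>((u, a), (v, b)). a + real (vertex_dist n u v) + b) ` (edge_ends n p \<times> edge_ends n q))"
  by (cases p; cases q) auto

lemma tree_dist_axis: "tree_dist n (axis s) (axis t) = \<bar>s - t\<bar>"
proof (cases "\<lfloor>s\<rfloor> = \<lfloor>t\<rfloor>")
  case True
  then show ?thesis by (auto simp: axis_def Let_def frac_def)
next
  case False
  let ?k = "\<lfloor>s\<rfloor>" and ?l = "\<lfloor>t\<rfloor>"
  let ?S = "(\<lambda>((u, a), (v, b)). a + real (vertex_dist n u v) + b) ` (edge_ends n (axis s) \<times> edge_ends n (axis t))"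
  \<comment> \<open>This selects the branch of \<open>tree_dist\<close> for different edges: the
    pair of ends determines the position of an edge on the axis.\<close>
  have ne: "\<not> (fst (axis s) = fst (axis t) \<and> fst (snd (axis s)) = fst (snd (axis t)))"
  proof
    assume *: "fst (axis s) = fst (axis t) \<and> fst (snd (axis s)) = fst (snd (axis t))"
    have "fst ` edge_ends n p = {fst p, fst p \<otimes>\<^bsub>Fn n\<^esub> gen (fst (snd p))}" for p by (cases p) simp
    with * have "fst ` edge_ends n (axis s) = fst ` edge_ends n (axis t)" by simp
    then have "{vert ?k, vert (?k + 1)} = {vert ?l, vert (?l + 1)}" by (simp add: edge_ends_axis)
    then show False using False by (auto simp: doubleton_eq_iff vert_inj)
  qed
  have s: "s = of_int ?k + frac s" and t: "t = of_int ?l + frac t" by (simp_all add: frac_def)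
  have f: "0 \<le> frac s" "frac s < 1" "0 \<le> frac t" "frac t < 1" by (simp_all add: frac_lt_1)
  have "Min ?S = \<bar>s - t\<bar>"
  proof (rule Min_eqI)
    show "finite ?S"
      by (simp add: edge_ends_axis)
    show "\<bar>s - t\<bar> \<le> y" if "y \<in> ?S" for y
    proof -
      have "y = frac s + \<bar>of_int ?k - of_int ?l\<bar> + frac t \<or> y = frac s + \<bar>of_int ?k - (of_int ?l + 1)\<bar> + (1 - frac t) \<or>
          y = 1 - frac s + \<bar>of_int ?k + 1 - of_int ?l\<bar> + frac t \<or> y = 1 - frac s + \<bar>of_int ?k - of_int ?l\<bar> + (1 - frac t)"
        using that by (auto simp: edge_ends_axis vertex_dist_vert)
      then show ?thesis using s t f by (elim disjE; linarith)
    qed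
    \<comment> \<open>The minimum is attained at the two ends that face each other.\<close>
    show "\<bar>s - t\<bar> \<in> ?S"
    proof (cases "?k < ?l")
      case True
      then have "real_of_int ?k + 1 \<le> real_of_int ?l" by linarith
      then have "\<bar>s - t\<bar> = (1 - frac s) + real (vertex_dist n (vert (?k + 1)) (vert ?l)) + frac t"
        unfolding vertex_dist_vert of_int_add of_int_1 using s t f by linarith
      then show ?thesis unfolding edge_ends_axis
        by (intro image_eqI[where x = "((vert (?k + 1), 1 - frac s), (vert ?l, frac t))"]) auto
    next
      case F: False
      then have "?l < ?k" using False by linarith
      then have "real_of_int ?l + 1 \<le> real_of_int ?k" by linarith
      then have "\<bar>s - t\<bar> = frac s + real (vertex_dist n (vert ?k) (vert (?l + 1))) + (1 - frac t)"
        unfolding vertex_dist_vert of_int_add of_int_1 using s t f by linarith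
      then show ?thesis unfolding edge_ends_axis
        by (intro image_eqI[where x = "((vert ?k, frac s), (vert (?l + 1), 1 - frac t))"]) auto
    qed
  qed
  then show ?thesis using tree_dist_Min[OF ne] by simp
qed

lemma is_axis_axis: "is_axis n w axis"
  unfolding is_axis_def
proof (intro conjI allI)
  show "axis s \<in> tree n" for s by (rule axis_in_tree)
  show "tree_dist n (axis s) (axis t) = \<bar>s - t\<bar>" for s t by (rule tree_dist_axis)
  have "tree_act n w (axis s) = axis (s + real (length w))" for s
  proof -
    have "\<lfloor>s + real (length w)\<rfloor> = \<lfloor>s\<rfloor> + int (length w)" by linarith
    moreover have "frac (s + real (length w)) = frac s" by (simp add: frac_def)
    ultimately show ?thesis
      using vert_translate[of "\<lfloor>s\<rfloor>"] vert_translate[of "\<lfloor>s\<rfloor> + 1"]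
      by (simp add: axis_def Let_def letter_periodic algebra_simps)
  qed
  then have "\<forall>s. tree_dist n (tree_act n w (axis s)) (axis (s + real (length w))) = 0"
    by (simp add: tree_dist_axis)
  then show "\<exists>l>0. \<forall>s. tree_dist n (tree_act n w (axis s)) (axis (s + l)) = 0"
    using w_ne by (intro exI[of _ "real (length w)"]) simp
qed

lemma axis_leaf: "primitive (Fn n) w \<Longrightarrow> range axis \<in> primitive_leaves n"
  unfolding primitive_leaves_def
  using is_axis_axis w_in Fn.one_closed
  by (intro CollectI exI[of _ axis] exI[of _ w] exI[of _ "\<one>\<^bsub>Fn n\<^esub>"]) simp

lemma tau_axis:
  assumes "is_tau n \<rho> x \<tau>"
  shows "\<tau> (axis (of_int k)) = H3_act (\<rho> (vert k)) x"
proof -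
  let ?i = "fst (letter k)"
  have wd: "\<tau> p = \<tau> q" if "p \<in> tree n" "q \<in> tree n" "tree_dist n p q = 0" for p q
    using assms that by (auto simp: is_tau_def)
  have "(\<one>\<^bsub>Fn n\<^esub>, ?i, 0) \<in> tree n" using letter_less by (simp add: tree_def)
  then have "\<tau> (tree_act n (vert k) (\<one>\<^bsub>Fn n\<^esub>, ?i, 0)) = H3_act (\<rho> (vert k)) (\<tau> (\<one>\<^bsub>Fn n\<^esub>, ?i, 0))"
    using assms vert_in[of k] unfolding is_tau_def by blast
  moreover have "\<tau> (\<one>\<^bsub>Fn n\<^esub>, ?i, 0) = x"
    using assms letter_less[of k] unfolding is_tau_def by blast
  ultimately have v: "\<tau> (vert k, ?i, 0) = H3_act (\<rho> (vert k)) x" using vert_in by simp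
  show ?thesis
  proof (cases "snd (letter k)")
    case True
    then show ?thesis using v by (simp add: axis_def)
  next
    case False
    \<comment> \<open>For an inverse letter \<open>axis\<close> describes the vertex as the far end
      of an edge. That is another name of the same point, at \<open>tree_dist\<close> 0, and \<tau>
      takes the same value on both.\<close>
    then have a: "axis (of_int k) = (vert (k + 1), ?i, 1)" by (simp add: axis_def)
    have ends: "edge_ends n (vert (k + 1), ?i, 1) = {(vert (k + 1), 1), (vert k, 0)}"
      using vert_letter_False[OF False] by simp
    let ?S = "(\<lambda>((u, a), (v, b)). a + real (vertex_dist n u v) + b) `
      (edge_ends n (vert (k + 1), ?i, 1) \<times> edge_ends n (vert k, ?i, 0))"
    have "tree_dist n (vert (k + 1), ?i, 1) (vert k, ?i, 0) = 0"
    proof (subst tree_dist_Min)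
      show "\<not> (fst (vert (k + 1), ?i, 1) = fst (vert k, ?i, 0) \<and> fst (snd (vert (k + 1), ?i, 1)) = fst (snd (vert k, ?i, 0)))"
        by (simp add: vert_inj)
      show "Min ?S = 0"
      proof (rule Min_eqI)
        show "0 \<in> ?S"
          unfolding ends by (intro image_eqI[where x = "((vert k, 0), (vert k, 0))"]) auto
      qed auto
    qed
    then show ?thesis using wd[of "(vert (k + 1), ?i, 1)" "(vert k, ?i, 0)"] a v vert_in letter_less[of k]
      by (simp add: tree_def)
  qed
qed

lemma seg_word_eq_seg: "seg_word (int j) m = seg (per w) j m"
  by (auto simp: seg_word_def seg_def letter_nat[symmetric] intro!: nth_equalityI)

end

section \<open>Primitive-stable representations\<close>

text \<open>The squared norm is 2 cosh of the distance, which exceeds the exponential of the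
  distance.\<close>

lemma H3_dist_orbit_pt:
  assumes A: "det A = 1" and B: "det B = 1"
  shows "exp (H3_dist (orbit_pt A) (orbit_pt B)) \<le> (norm (adj2 A ** B))\<^sup>2"
proof -
  let ?p = "orbit_pt A" and ?q = "orbit_pt B" and ?N = "(norm (adj2 A ** B))\<^sup>2"
  have "(dist ?p ?q)\<^sup>2 = (cmod (fst ?p - fst ?q))\<^sup>2 + (snd ?p - snd ?q)\<^sup>2"
    by (simp add: dist_prod_def dist_norm)
  then have n1: "?N - 2 = ((cmod (fst ?p - fst ?q))\<^sup>2 + (snd ?p - snd ?q)\<^sup>2) / (snd ?p * snd ?q)"
    using norm_adj2_mult[OF A B] by simp
  have n2: "x / (2 * a * b) = x / (a * b) / 2" for x a b :: real by simp
  have n3: "1 + ((cmod (fst ?p - fst ?q))\<^sup>2 + (snd ?p - snd ?q)\<^sup>2) / (2 * snd ?p * snd ?q) = ?N / 2"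
    unfolding n2 n1[symmetric] by (simp add: diff_divide_distrib)
  have d: "H3_dist ?p ?q = arcosh (?N / 2)" unfolding H3_dist_def n3 ..
  have "2 \<le> ?N" by (rule norm_SL2_ge) (simp add: det_mul A B)
  then have "?N / 2 = cosh (H3_dist ?p ?q)" unfolding d by simp
  also have "\<dots> = (exp (H3_dist ?p ?q) + exp (- H3_dist ?p ?q)) / 2" by (simp add: cosh_def)
  finally show ?thesis using exp_gt_zero[of "- H3_dist ?p ?q"] by (simp add: field_simps)
qed

text \<open>The upper triangular matrix that moves (0, 1) to \<open>x\<close>; conjugation by it
  reduces an arbitrary base point to the standard one.\<close>

definition base_mat :: "complex \<times> real \<Rightarrow> mat2" where
  "base_mat x = vector [vector [of_real (sqrt (snd x)), fst x / of_real (sqrt (snd x))],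
     vector [0, 1 / of_real (sqrt (snd x))]]"

lemma base_mat_nth:
  "base_mat x $ 1 $ 1 = of_real (sqrt (snd x))" "base_mat x $ 1 $ 2 = fst x / of_real (sqrt (snd x))"
  "base_mat x $ 2 $ 1 = 0" "base_mat x $ 2 $ 2 = 1 / of_real (sqrt (snd x))"
  by (simp_all add: base_mat_def)

lemma det_base_mat: "x \<in> H3 \<Longrightarrow> det (base_mat x) = 1"
  by (simp add: det_2 base_mat_nth H3_def)

lemma H3_act_eq_orbit_pt:
  assumes x: "x \<in> H3"
  shows "H3_act P x = orbit_pt (psl_rep P ** base_mat x)"
proof -
  obtain z t where xz: "x = (z, t)" by (cases x)
  have t: "0 < t" using x by (simp add: H3_def xz)
  define A where "A = psl_rep P"
  let ?a = "A$1$1" and ?b = "A$1$2" and ?c = "A$2$1" and ?d = "A$2$2"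
  let ?s = "complex_of_real (sqrt t)"
  have s: "?s \<noteq> 0" "?s * ?s = of_real t" "cnj ?s = ?s" using t by (simp_all flip: of_real_mult)
  let ?X = "A ** base_mat (z, t)"
  have X: "?X$1$1 = ?a * ?s" "?X$1$2 = (?a * z + ?b) / ?s" "?X$2$1 = ?c * ?s" "?X$2$2 = (?c * z + ?d) / ?s"
    using s(1) by (simp_all add: mult2_nth base_mat_nth add_divide_distrib)
  define N where "N = (cmod (?c * z + ?d))\<^sup>2 + (cmod ?c)\<^sup>2 * t\<^sup>2"
  have N: "(cmod (?X$2$1))\<^sup>2 + (cmod (?X$2$2))\<^sup>2 = N / t"
    using t by (simp add: X N_def norm_mult norm_divide power_mult_distrib power_divide field_simps power2_eq_square)
  have num: "?X$1$1 * cnj (?X$2$1) + ?X$1$2 * cnj (?X$2$2) =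
      ((?a * z + ?b) * cnj (?c * z + ?d) + ?a * cnj ?c * of_real (t\<^sup>2)) / of_real t"
  proof -
    have "?X$1$1 * cnj (?X$2$1) = ?a * cnj ?c * (?s * ?s)" by (simp add: X s(3))
    moreover have "?X$1$2 * cnj (?X$2$2) = ((?a * z + ?b) * cnj (?c * z + ?d)) / (?s * ?s)"
      unfolding X complex_cnj_divide s(3) by simp
    ultimately show ?thesis unfolding s(2) using t by (simp add: field_simps power2_eq_square)
  qed
  have "orbit_pt ?X = (((?a * z + ?b) * cnj (?c * z + ?d) + ?a * cnj ?c * of_real (t\<^sup>2)) / of_real N, t / N)"
    unfolding orbit_pt_def Let_def N num using t by simp
  then show ?thesis by (simp add: H3_act_def Let_def xz A_def[symmetric] N_def)
qed

section \<open>Representatives and lifts of elements of PSL(2,C)\<close>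

lemma PSL2_eq:
  assumes "P \<in> carrier PSL2" "A \<in> P" shows "det A = 1" "P = {A, - A}"
proof -
  obtain B where "det B = 1" "P = {B, - B}"
    using assms(1) by (auto simp: PSL2_def FactGroup_def RCOSETS_def r_coset_def SL2_def matrix_mul_minus)
  then show "det A = 1" "P = {A, - A}" using assms(2) by (auto simp: det_2)
qed

lemma PSL2_I: assumes "det A = 1" shows "{A, - A} \<in> carrier PSL2"
  using assms by (auto simp: PSL2_def FactGroup_def RCOSETS_def r_coset_def SL2_def matrix_mul_minus)

lemma psl_rep_in: assumes "P \<in> carrier PSL2" shows "psl_rep P \<in> P"
proof -
  have "\<exists>A. A \<in> P" using assms by (auto simp: PSL2_def FactGroup_def RCOSETS_def r_coset_def)
  then show ?thesis unfolding psl_rep_def by (rule someI_ex)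
qed

lemma PSL2_mult: "A \<in> P \<Longrightarrow> B \<in> Q \<Longrightarrow> A ** B \<in> P \<otimes>\<^bsub>PSL2\<^esub> Q"
  by (auto simp: PSL2_def FactGroup_def set_mult_def SL2_def)

lemma PSL2_one: "\<one>\<^bsub>PSL2\<^esub> = {mat 1, - mat 1}"
  by (simp add: PSL2_def FactGroup_def)

lemma PSL2_inv:
  assumes P: "P \<in> carrier PSL2" "A \<in> P" shows "adj2 A \<in> inv\<^bsub>PSL2\<^esub> P"
proof -
  interpret group PSL2 by (rule group_PSL2)
  have d: "det (adj2 A) = 1" using PSL2_eq[OF P] by simp
  let ?Q = "{adj2 A, - adj2 A}"
  have Q: "?Q \<in> carrier PSL2" by (rule PSL2_I[OF d])
  have "mat 1 \<in> ?Q \<otimes>\<^bsub>PSL2\<^esub> P" using PSL2_mult[of "adj2 A" ?Q A P] P adj2_inverse[OF PSL2_eq(1)[OF P]] by simp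
  then have "?Q \<otimes>\<^bsub>PSL2\<^esub> P = \<one>\<^bsub>PSL2\<^esub>" using PSL2_eq(2)[of "?Q \<otimes>\<^bsub>PSL2\<^esub> P" "mat 1"] Q P by (simp add: PSL2_one)
  then have "inv\<^bsub>PSL2\<^esub> P = ?Q" using Q P by (intro inv_equality) auto
  then show ?thesis by simp
qed

text \<open>As the group is free, the signs at the generators can be chosen independently. The value
  beyond \<open>n\<close> keeps the determinant 1 at every index.\<close>

definition lift :: "nat \<Rightarrow> (nat word \<Rightarrow> (complex^2^2) set) \<Rightarrow> nat \<Rightarrow> mat2" where
  "lift n \<rho> i = (if i < n then psl_rep (\<rho> (gen i)) else mat 1)"

lemma Rep_closed: "\<rho> \<in> Rep n \<Longrightarrow> g \<in> carrier (Fn n) \<Longrightarrow> \<rho> g \<in> carrier PSL2"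
  by (auto simp: Rep_def hom_def)

lemma Rep_mult:
  "\<rho> \<in> Rep n \<Longrightarrow> g \<in> carrier (Fn n) \<Longrightarrow> h \<in> carrier (Fn n) \<Longrightarrow> \<rho> (g \<otimes>\<^bsub>Fn n\<^esub> h) = \<rho> g \<otimes>\<^bsub>PSL2\<^esub> \<rho> h"
  by (auto simp: Rep_def hom_def)

lemma det_lift: assumes "\<rho> \<in> Rep n" shows "det (lift n \<rho> i) = 1"
  using PSL2_eq(1)[OF Rep_closed[OF assms] psl_rep_in[OF Rep_closed[OF assms]]] by (simp add: lift_def)

lemma wmat_lift:
  assumes r: "\<rho> \<in> Rep n" and u: "u \<in> carrier (Fn n)"
  shows "wmat (lift n \<rho>) u \<in> \<rho> u"
  using u
proof (induction u)
  case Nil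
  have "\<rho> \<one>\<^bsub>Fn n\<^esub> = \<one>\<^bsub>PSL2\<^esub>"
    using r hom_one[OF _ group_free_group group_PSL2] by (auto simp: Rep_def)
  then show ?case by (simp add: one_Fn PSL2_one)
next
  case (Cons a u)
  obtain i s where a: "a = (i, s)" by (cases a)
  have c: "fst a < n" "u \<in> carrier (Fn n)" and eq: "a # u = [a] \<otimes>\<^bsub>Fn n\<^esub> u"
    using Fn_Cons[OF Cons.prems] by blast+
  have i: "i < n" using c(1) a by simp
  have A: "psl_rep (\<rho> (gen i)) \<in> \<rho> (gen i)" by (rule psl_rep_in[OF Rep_closed[OF r]]) (simp add: i)
  have "lmat (lift n \<rho>) a \<in> \<rho> [a]"
  proof (cases s)
    case True
    then show ?thesis using A i by (simp add: a lift_def gen_def)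
  next
    case False
    have "[a] = inv\<^bsub>Fn n\<^esub> (gen i)" using i False by (simp add: a gen_def inv_letter)
    moreover have "\<rho> (inv\<^bsub>Fn n\<^esub> (gen i)) = inv\<^bsub>PSL2\<^esub> (\<rho> (gen i))"
    proof -
      interpret group_hom "Fn n" PSL2 \<rho>
        using r group_free_group group_PSL2 by (auto simp: group_hom_def group_hom_axioms_def Rep_def)
      show ?thesis by (rule hom_inv) (simp add: i)
    qed
    ultimately show ?thesis using PSL2_inv[OF Rep_closed[OF r] A] i False by (simp add: a lift_def)
  qed
  then have "lmat (lift n \<rho>) a ** wmat (lift n \<rho>) u \<in> \<rho> [a] \<otimes>\<^bsub>PSL2\<^esub> \<rho> u"
    using Cons.IH c by (intro PSL2_mult) auto
  also have "\<rho> [a] \<otimes>\<^bsub>PSL2\<^esub> \<rho> u = \<rho> (a # u)"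
    unfolding eq using c by (intro Rep_mult[OF r, symmetric]) auto
  finally show ?case by simp
qed

lemma psl_rep_lift:
  assumes "\<rho> \<in> Rep n" "u \<in> carrier (Fn n)"
  shows "psl_rep (\<rho> u) = wmat (lift n \<rho>) u \<or> psl_rep (\<rho> u) = - wmat (lift n \<rho>) u"
  using PSL2_eq(2)[OF Rep_closed[OF assms] wmat_lift[OF assms]] psl_rep_in[OF Rep_closed[OF assms]] by auto

lemma trace_uminus2: "trace (- A) = - trace A" for A :: mat2
  by (simp add: trace2)

lemma trace_psl_rep:
  assumes "\<rho> \<in> Rep n" "u \<in> carrier (Fn n)"
  shows "(trace (psl_rep (\<rho> u)))\<^sup>2 = (trace (wmat (lift n \<rho>) u))\<^sup>2"
  using psl_rep_lift[OF assms] by (auto simp: trace_uminus2)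

text \<open>Exponentiating the lower quasi-geodesic bound between vertices of an axis gives the
  constants exp(-\<delta>) and exp(1 / K). Conjugation by \<open>g\<close> moves the base point to
  (0, 1), where norms measure displacements.\<close>

lemma primitive_stable_expanding:
  assumes r: "\<rho> \<in> Rep n" and ps: "primitive_stable n \<rho>"
  obtains g where "det g = 1" "expanding (\<lambda>i. adj2 g ** lift n \<rho> i ** g) (prim_seqs n)"
proof -
  obtain K \<delta> x \<tau> where K: "1 \<le> K" and x: "x \<in> H3" and \<tau>: "is_tau n \<rho> x \<tau>"
    and qg: "\<And>L. L \<in> primitive_leaves n \<Longrightarrow> quasi_geodesic_on n K \<delta> L \<tau>"
    using ps unfolding primitive_stable_def by blast
  define g where "g = base_mat x"
  have g: "det g = 1" unfolding g_def by (rule det_base_mat[OF x])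
  let ?B = "\<lambda>i. adj2 g ** lift n \<rho> i ** g"
  have "exp (- \<delta>) * exp (1 / K) ^ m \<le> (norm (wmat ?B (seg a j m)))\<^sup>2" if a: "a \<in> prim_seqs n" for a j m
  proof -
    obtain \<theta> i where \<theta>: "a = per (\<theta> (gen i))" "\<theta> \<in> iso (Fn n) (Fn n)" "i < n" "cyclically_reduced (\<theta> (gen i))"
      using a by (auto simp: prim_seqs_def)
    interpret cyclic_word n "\<theta> (gen i)"
      using \<theta> iso_gen_closed iso_gen_nonempty by unfold_locales auto
    let ?u = "vert (int j)" and ?v = "vert (int (j + m))"
    have "range axis \<in> primitive_leaves n" by (rule axis_leaf[OF primitive_iso_gen[OF \<theta>(2,3)]])
    then have "1 / K * tree_dist n (axis (of_int (int j))) (axis (of_int (int (j + m)))) - \<delta>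
        \<le> H3_dist (\<tau> (axis (of_int (int j)))) (\<tau> (axis (of_int (int (j + m)))))"
      using qg unfolding quasi_geodesic_on_def by blast
    then have d: "1 / K * real m - \<delta> \<le> H3_dist (H3_act (\<rho> ?u) x) (H3_act (\<rho> ?v) x)"
      unfolding tree_dist_axis tau_axis[OF \<tau>] by simp
    define U where "U = psl_rep (\<rho> ?u)"
    define V where "V = psl_rep (\<rho> ?v)"
    have UV: "U = wmat (lift n \<rho>) ?u \<or> U = - wmat (lift n \<rho>) ?u" "V = wmat (lift n \<rho>) ?v \<or> V = - wmat (lift n \<rho>) ?v"
      unfolding U_def V_def by (intro psl_rep_lift[OF r vert_in])+
    have dw: "det (wmat (lift n \<rho>) u) = 1" for u by (rule det_wmat[OF det_lift[OF r]])
    have dUV: "det (U ** g) = 1" "det (V ** g) = 1"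
      using UV dw[of ?u] dw[of ?v] by (auto simp: det_mul g) (auto simp: det_2)
    have "wmat ?B (seg a j m) = adj2 g ** wmat (lift n \<rho>) (seg a j m) ** g" by (rule wmat_conj[OF g])
    also have "wmat (lift n \<rho>) (seg a j m) = adj2 (wmat (lift n \<rho>) ?u) ** wmat (lift n \<rho>) ?v"
      using vert_add[of "int j" m]
      by (simp add: wmat_mult_Fn[OF det_lift[OF r]] seg_word_eq_seg \<theta>(1) adj2_cancel[OF dw])
    also have "adj2 g ** (adj2 (wmat (lift n \<rho>) ?u) ** wmat (lift n \<rho>) ?v) ** g =
        adj2 (wmat (lift n \<rho>) ?u ** g) ** (wmat (lift n \<rho>) ?v ** g)"
      by (simp add: adj2_mult matrix_mul_assoc)
    finally have W: "wmat ?B (seg a j m) = adj2 (wmat (lift n \<rho>) ?u ** g) ** (wmat (lift n \<rho>) ?v ** g)" .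
    have neg: "adj2 (- X) = - adj2 X" for X by (simp add: mat2_eq_iff)
    have "norm (adj2 (U ** g) ** (V ** g)) = norm (wmat ?B (seg a j m))"
      using UV unfolding W by (auto simp: matrix_mul_minus neg)
    moreover have "exp (1 / K * real m - \<delta>) \<le> (norm (adj2 (U ** g) ** (V ** g)))\<^sup>2"
    proof -
      have "exp (1 / K * real m - \<delta>) \<le> exp (H3_dist (orbit_pt (U ** g)) (orbit_pt (V ** g)))"
        using d unfolding H3_act_eq_orbit_pt[OF x] U_def V_def g_def by simp
      then show ?thesis using H3_dist_orbit_pt[OF dUV] by linarith
    qed
    moreover have "exp (1 / K * real m - \<delta>) = exp (- \<delta>) * exp (1 / K) ^ m"
      by (simp add: exp_diff exp_minus exp_of_nat_mult[symmetric] field_simps)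
    ultimately show ?thesis by simp
  qed
  moreover have "1 < exp (1 / K)" using K by simp
  ultimately have "expanding ?B (prim_seqs n)"
    unfolding expanding_def by (intro exI[of _ "exp (- \<delta>)"] exI[of _ "exp (1 / K)"]) auto
  with g show ?thesis by (rule that)
qed

lemma expanding_trace_expanding:
  assumes B: "\<And>i. det (B i) = 1" and ex: "expanding B (prim_seqs n)"
  shows "\<exists>N. trace_expanding n N B"
proof -
  obtain N where "\<forall>\<^sub>F k in sequentially. \<forall>a\<in>prim_seqs n. locally_expanding B a N"
  proof (rule locally_expanding_nearby[where L = B and S = "prim_seqs n" and I = "{..<n}"
        and B = "\<lambda>k :: nat. B" and F = sequentially, OF B ex])
    show "fst (a i) \<in> {..<n}" if "a \<in> prim_seqs n" for a i using prim_seqs_letter[OF that] by simp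
  qed auto
  then have "trace_expanding n N B" by (intro trace_expandingI[OF B]) auto
  then show ?thesis ..
qed

section \<open>Squared traces as functions on the character variety\<close>

definition trace_sq :: "nat \<Rightarrow> nat word \<Rightarrow> (nat word \<Rightarrow> (complex^2^2) set) \<Rightarrow> complex" where
  "trace_sq n u = (\<lambda>\<rho>\<in>Rep n. (trace (psl_rep (\<rho> u)))\<^sup>2)"

text \<open>A trace is defined only up to sign on PSL(2,C); its square is even in the entries, being
  a sum of four of the products in \<open>coord\<close>.\<close>

lemma trace_sq_invariant:
  assumes u: "u \<in> carrier (Fn n)" shows "trace_sq n u \<in> invariants n"
proof -
  define c where "c i k = (\<lambda>\<rho>\<in>Rep n. psl_rep (\<rho> u) $ i $ i * psl_rep (\<rho> u) $ k $ k)" for i k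
  have c: "c i k \<in> regular n" for i k unfolding c_def by (rule regular.coord[OF u])
  have "(\<lambda>\<rho>\<in>Rep n. c 1 1 \<rho> + (\<lambda>\<rho>\<in>Rep n. c 1 2 \<rho> + (\<lambda>\<rho>\<in>Rep n. c 2 1 \<rho> + c 2 2 \<rho>) \<rho>) \<rho>) \<in> regular n"
    by (intro regular.add c)
  also have "(\<lambda>\<rho>\<in>Rep n. c 1 1 \<rho> + (\<lambda>\<rho>\<in>Rep n. c 1 2 \<rho> + (\<lambda>\<rho>\<in>Rep n. c 2 1 \<rho> + c 2 2 \<rho>) \<rho>) \<rho>) = trace_sq n u"
    unfolding trace_sq_def by (rule ext) (simp add: c_def trace2 power2_eq_square algebra_simps)
  finally have reg: "trace_sq n u \<in> regular n" .
  have "trace_sq n u (conj_rep n P \<rho>) = trace_sq n u \<rho>" if P: "P \<in> carrier PSL2" and r: "\<rho> \<in> Rep n" for P \<rho>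
  proof -
    let ?A = "psl_rep P" and ?X = "psl_rep (\<rho> u)" and ?Q = "conj_rep n P \<rho> u"
    have A: "?A \<in> P" "det ?A = 1" using psl_rep_in[OF P] PSL2_eq(1)[OF P] by auto
    have "?A ** ?X ** adj2 ?A \<in> ?Q"
      using u psl_rep_in[OF Rep_closed[OF r u]] PSL2_inv[OF P A(1)] A(1)
      by (simp add: conj_rep_def PSL2_mult)
    then have Q: "?Q = {?A ** ?X ** adj2 ?A, - (?A ** ?X ** adj2 ?A)}"
      by (rule PSL2_eq(2)[OF Rep_closed[OF conj_rep_Rep[OF P r] u]])
    have "psl_rep ?Q \<in> ?Q" by (rule psl_rep_in[OF Rep_closed[OF conj_rep_Rep[OF P r] u]])
    then have "psl_rep ?Q = ?A ** ?X ** adj2 ?A \<or> psl_rep ?Q = - (?A ** ?X ** adj2 ?A)" using Q by blast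
    then have "(trace (psl_rep ?Q))\<^sup>2 = (trace (?A ** ?X ** adj2 ?A))\<^sup>2" by (auto simp: trace_uminus2)
    also have "trace (?A ** ?X ** adj2 ?A) = trace ?X" using trace_conj[of "adj2 ?A" ?X] A(2) by simp
    finally show ?thesis using r conj_rep_Rep[OF P r] by (simp add: trace_sq_def)
  qed
  with reg show ?thesis by (simp add: invariants_def)
qed

lemma char_of_trace_sq:
  assumes "\<rho> \<in> Rep n" "u \<in> carrier (Fn n)"
  shows "char_of n \<rho> (trace_sq n u) = (trace (wmat (lift n \<rho>) u))\<^sup>2"
  using assms trace_sq_invariant by (simp add: char_of_def trace_sq_def trace_psl_rep)

text \<open>The character variety sits in a product over uncountably many invariants, where
  compactness does not directly yield convergent subsequences. Words are countable, so in this
  function space compact sets are sequentially compact.\<close>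

definition all_traces :: "nat \<Rightarrow> (((nat word \<Rightarrow> (complex^2^2) set) \<Rightarrow> complex) \<Rightarrow> complex) \<Rightarrow> nat word \<Rightarrow> complex" where
  "all_traces n \<xi> u = (if u \<in> carrier (Fn n) then \<xi> (trace_sq n u) else 0)"

lemma compact_all_traces:
  assumes "compactin (subtopology (char_variety n) (PS n)) C"
  shows "compact (all_traces n ` C)"
proof -
  let ?T = "product_topology (\<lambda>_. euclidean) (invariants n) :: (((nat word \<Rightarrow> (complex^2^2) set) \<Rightarrow> complex) \<Rightarrow> complex) topology"
  have "compactin ?T C" using assms by (simp add: char_variety_def compactin_subtopology)
  moreover have "continuous_map ?T euclidean (all_traces n)"
    unfolding euclidean_product_topology[symmetric] continuous_map_componentwise_UNIV
  proof
    fix u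
    show "continuous_map ?T euclidean (\<lambda>\<xi>. all_traces n \<xi> u)"
    proof (cases "u \<in> carrier (Fn n)")
      case True
      then show ?thesis
        using continuous_map_product_projection[OF trace_sq_invariant[OF True]] by (simp add: all_traces_def)
    qed (simp add: all_traces_def)
  qed
  ultimately have "compactin euclidean (all_traces n ` C)" by (rule image_compactin)
  then show ?thesis by simp
qed

text \<open>Otherwise some representation with character in \<open>C\<close> fails with exponent k,
  for every k. A subsequence of their squared traces converges to those of a primitive-stable
  representation, and \<open>trace_expanding_limit\<close> supplies one exponent for infinitely many
  members.\<close>

lemma uniform_trace_expanding:
  assumes n: "2 \<le> n" and C: "compactin (subtopology (char_variety n) (PS n)) C"
  obtains N where "\<And>\<rho>. \<rho> \<in> Rep n \<Longrightarrow> primitive_stable n \<rho> \<Longrightarrow> char_of n \<rho> \<in> C \<Longrightarrow> trace_expanding n N (lift n \<rho>)"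
proof (rule ccontr)
  assume "\<not> thesis"
  then have "\<forall>N. \<exists>\<rho>. \<rho> \<in> Rep n \<and> primitive_stable n \<rho> \<and> char_of n \<rho> \<in> C \<and> \<not> trace_expanding n N (lift n \<rho>)"
    using that by blast
  then obtain \<rho> where \<rho>: "\<And>k. \<rho> k \<in> Rep n" "\<And>k. primitive_stable n (\<rho> k)" "\<And>k. char_of n (\<rho> k) \<in> C"
    "\<And>k. \<not> trace_expanding n k (lift n (\<rho> k))" by metis
  have "seq_compact (all_traces n ` C)" by (rule compact_imp_seq_compact[OF compact_all_traces[OF C]])
  moreover have "\<forall>k. all_traces n (char_of n (\<rho> k)) \<in> all_traces n ` C" using \<rho>(3) by blast
  ultimately obtain l r where lr: "l \<in> all_traces n ` C" "strict_mono r"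
    "((\<lambda>k. all_traces n (char_of n (\<rho> k))) \<circ> r) \<longlonglongrightarrow> l" by (rule seq_compactE)
  have "C \<subseteq> PS n" using compactin_subset_topspace[OF C] by auto
  then obtain \<rho>0 where \<rho>0: "\<rho>0 \<in> Rep n" "primitive_stable n \<rho>0" "l = all_traces n (char_of n \<rho>0)"
    using lr(1) by (auto simp: PS_def)
  obtain g where g: "det g = 1" "expanding (\<lambda>i. adj2 g ** lift n \<rho>0 i ** g) (prim_seqs n)"
    using primitive_stable_expanding[OF \<rho>0(1,2)] by blast
  let ?B0 = "\<lambda>i. adj2 g ** lift n \<rho>0 i ** g"
  have dB0: "det (?B0 i) = 1" for i using det_lift[OF \<rho>0(1)] g(1) by (simp add: det_mul)
  obtain N0 where N0: "trace_expanding n N0 ?B0" using expanding_trace_expanding[OF dB0 g(2)] by blast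
  have te: "\<exists>N. trace_expanding n N (lift n (\<rho> k))" for k
  proof -
    obtain h where h: "det h = 1" "expanding (\<lambda>i. adj2 h ** lift n (\<rho> k) i ** h) (prim_seqs n)"
      using primitive_stable_expanding[OF \<rho>(1,2)] by blast
    have "det (adj2 h ** lift n (\<rho> k) i ** h) = 1" for i using det_lift[OF \<rho>(1)] h(1) by (simp add: det_mul)
    from expanding_trace_expanding[OF this h(2)] show ?thesis by (simp add: trace_expanding_conj[OF h(1)])
  qed
  have lim: "(\<lambda>k. (trace (wmat (lift n (\<rho> (r k))) u))\<^sup>2) \<longlonglongrightarrow> (trace (wmat ?B0 u))\<^sup>2" if u: "u \<in> carrier (Fn n)" for u
  proof -
    have cont: "isCont (\<lambda>f :: nat word \<Rightarrow> complex. f u) l"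
      by (rule continuous_on_interior[OF continuous_on_product_coordinates]) simp
    have "(\<lambda>k. all_traces n (char_of n (\<rho> (r k))) u) \<longlonglongrightarrow> l u"
      using isCont_tendsto_compose[OF cont lr(3)] by (simp add: comp_def)
    then show ?thesis
      using u by (simp add: \<rho>0(3) all_traces_def char_of_trace_sq \<rho>(1) \<rho>0(1) wmat_conj[OF g(1)] trace_conj[OF g(1)])
  qed
  obtain N s where Ns: "strict_mono (s :: nat \<Rightarrow> nat)" "\<forall>\<^sub>F k in sequentially. trace_expanding n N (lift n (\<rho> (r (s k))))"
    by (rule trace_expanding_limit[OF n det_lift[OF \<rho>(1)] dB0 te N0 g(2) lim])
  then obtain K where K: "\<And>k. K \<le> k \<Longrightarrow> trace_expanding n N (lift n (\<rho> (r (s k))))"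
    by (auto simp: eventually_sequentially)
  \<comment> \<open>At this position the representation has the bound with exponent
    \<open>N\<close>, its number is at least \<open>N\<close>, and by monotonicity it cannot fail
    with its own number as exponent.\<close>
  let ?k = "max K N"
  have "?k \<le> r (s ?k)" using seq_suble[OF Ns(1)] seq_suble[OF lr(2)] le_trans by blast
  then have "N \<le> r (s ?k)" by simp
  then have "trace_expanding n (r (s ?k)) (lift n (\<rho> (r (s ?k))))"
    by (rule trace_expanding_mono[OF K[of ?k], rotated]) simp
  then show False using \<rho>(4) by blast
qed

section \<open>Short automorphisms and cosets of inner automorphisms\<close>

abbreviation (input) AutFn :: "nat \<Rightarrow> (nat word \<Rightarrow> nat word) monoid" where
  "AutFn n \<equiv> AutoGroup (Fn n)"

lemma auto_Fn_iff: "\<eta> \<in> auto (Fn n) \<longleftrightarrow> \<eta> \<in> iso (Fn n) (Fn n) \<and> \<eta> \<in> extensional (carrier (Fn n))"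
  by (auto simp: auto_def iso_def Bij_def)

lemma finite_short_automorphisms: "finite {\<eta> \<in> auto (Fn n). \<forall>i<n. length (\<eta> (gen i)) \<le> R}"
proof (rule inj_on_finite)
  let ?X = "{\<eta> \<in> auto (Fn n). \<forall>i<n. length (\<eta> (gen i)) \<le> R}"
  let ?W = "{u. set u \<subseteq> {..<n} \<times> (UNIV :: bool set) \<and> length u \<le> R}"
  show "finite ({..<n} \<rightarrow>\<^sub>E ?W)" by (intro finite_PiE finite_lists_length_le) auto
  show "(\<lambda>\<eta>. \<lambda>i\<in>{..<n}. \<eta> (gen i)) ` ?X \<subseteq> {..<n} \<rightarrow>\<^sub>E ?W"
  proof
    fix f assume "f \<in> (\<lambda>\<eta>. \<lambda>i\<in>{..<n}. \<eta> (gen i)) ` ?X"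
    then obtain \<eta> where \<eta>: "f = (\<lambda>i\<in>{..<n}. \<eta> (gen i))" "\<eta> \<in> auto (Fn n)" "\<forall>i<n. length (\<eta> (gen i)) \<le> R" by auto
    have "\<eta> (gen i) \<in> ?W" if "i < n" for i
      using iso_gen_closed[of \<eta> n i] \<eta>(2,3) that by (auto simp: auto_Fn_iff carrier_Fn)
    then show "f \<in> {..<n} \<rightarrow>\<^sub>E ?W" by (auto simp: \<eta>(1))
  qed
  show "inj_on (\<lambda>\<eta>. \<lambda>i\<in>{..<n}. \<eta> (gen i)) ?X"
  proof (rule inj_onI)
    fix \<eta> \<eta>' assume *: "\<eta> \<in> ?X" "\<eta>' \<in> ?X" and eq: "(\<lambda>i\<in>{..<n}. \<eta> (gen i)) = (\<lambda>i\<in>{..<n}. \<eta>' (gen i))"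
    have hom: "\<eta> \<in> hom (Fn n) (Fn n)" "\<eta>' \<in> hom (Fn n) (Fn n)" using * by (simp_all add: auto_def)
    have gen: "\<eta> (gen i) = \<eta>' (gen i)" if "i < n" for i using fun_cong[OF eq, of i] that by simp
    have "\<eta> u = \<eta>' u" if "u \<in> carrier (Fn n)" for u
      by (rule hom_eqI[OF group_free_group hom gen that])
    then show "\<eta> = \<eta>'" using * by (intro extensionalityI[of _ "carrier (Fn n)"]) (auto simp: auto_Fn_iff)
  qed
qed

lemma inner_aut_auto: "g \<in> carrier (Fn n) \<Longrightarrow> inner_aut (Fn n) g \<in> auto (Fn n)"
proof -
  assume g: "g \<in> carrier (Fn n)"
  interpret group "Fn n" by (rule group_free_group)
  from iso_conj[OF g] have "inner_aut (Fn n) g \<in> iso (Fn n) (Fn n)"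
    by (auto simp: iso_def inner_aut_def hom_def cong: bij_betw_cong)
  then show ?thesis by (simp add: auto_Fn_iff) (simp add: inner_aut_def)
qed

lemma mult_AutoGroup:
  "a \<in> auto (Fn n) \<Longrightarrow> b \<in> auto (Fn n) \<Longrightarrow> a \<otimes>\<^bsub>AutFn n\<^esub> b = compose (carrier (Fn n)) a b"
  by (simp add: AutoGroup_def BijGroup_def auto_def)

lemma carrier_AutoGroup: "carrier (AutoGroup G) = auto G"
  by (simp add: AutoGroup_def)

lemma subgroup_inner_aut: "subgroup (inner_aut (Fn n) ` carrier (Fn n)) (AutFn n)"
proof -
  interpret F: group "Fn n" by (rule group_free_group)
  interpret A: group "AutFn n" by (rule F.AutoGroup)
  have "inner_aut (Fn n) \<in> hom (Fn n) (AutFn n)"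
  proof (rule homI)
    fix g h assume gh: "g \<in> carrier (Fn n)" "h \<in> carrier (Fn n)"
    show "inner_aut (Fn n) (g \<otimes>\<^bsub>Fn n\<^esub> h) = inner_aut (Fn n) g \<otimes>\<^bsub>AutFn n\<^esub> inner_aut (Fn n) h"
      using gh by (simp add: mult_AutoGroup inner_aut_auto)
        (auto simp: inner_aut_def compose_def fun_eq_iff F.m_assoc F.inv_mult_group)
  qed (simp add: carrier_AutoGroup inner_aut_auto)
  then interpret group_hom "Fn n" "AutFn n" "inner_aut (Fn n)" by unfold_locales
  show ?thesis by (rule img_is_subgroup)
qed

text \<open>An inner automorphism moves past \<phi> by applying \<phi> to the conjugating element,
  so changing the inverse of \<phi> by an inner automorphism does not change the outer
  class.\<close>

lemma inv_conj_in_coset: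
  assumes \<phi>: "\<phi> \<in> auto (Fn n)" and g: "g \<in> carrier (Fn n)"
  shows "inv\<^bsub>AutFn n\<^esub> (inner_aut (Fn n) g \<otimes>\<^bsub>AutFn n\<^esub> inv\<^bsub>AutFn n\<^esub> \<phi>)
     \<in> (inner_aut (Fn n) ` carrier (Fn n)) #>\<^bsub>AutFn n\<^esub> \<phi>"
proof -
  interpret F: group "Fn n" by (rule group_free_group)
  interpret A: group "AutFn n" by (rule F.AutoGroup)
  interpret I: subgroup "inner_aut (Fn n) ` carrier (Fn n)" "AutFn n" by (rule subgroup_inner_aut)
  have \<phi>A: "\<phi> \<in> carrier (AutFn n)" using \<phi> by (simp add: carrier_AutoGroup)
  have gA: "inner_aut (Fn n) g \<in> carrier (AutFn n)" using inner_aut_auto[OF g] by (simp add: carrier_AutoGroup)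
  have "inv\<^bsub>AutFn n\<^esub> (inner_aut (Fn n) g) \<in> inner_aut (Fn n) ` carrier (Fn n)" using g by (intro I.m_inv_closed) auto
  then obtain h where h: "h \<in> carrier (Fn n)" "inv\<^bsub>AutFn n\<^esub> (inner_aut (Fn n) g) = inner_aut (Fn n) h" by auto
  have \<phi>i: "\<phi> \<in> iso (Fn n) (Fn n)" "\<phi> \<in> extensional (carrier (Fn n))" using \<phi> by (auto simp: auto_Fn_iff)
  interpret \<phi>: group_hom "Fn n" "Fn n" \<phi> using \<phi>i by unfold_locales (simp add: iso_def)
  have "inv\<^bsub>AutFn n\<^esub> (inner_aut (Fn n) g \<otimes>\<^bsub>AutFn n\<^esub> inv\<^bsub>AutFn n\<^esub> \<phi>)
     = \<phi> \<otimes>\<^bsub>AutFn n\<^esub> inner_aut (Fn n) h"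
    using \<phi>A gA h by (simp add: A.inv_mult_group)
  also have "\<dots> = inner_aut (Fn n) (\<phi> h) \<otimes>\<^bsub>AutFn n\<^esub> \<phi>"
    using \<phi> h by (simp add: mult_AutoGroup inner_aut_auto)
      (auto simp: inner_aut_def compose_def fun_eq_iff)
  finally show ?thesis using h(1) by (auto simp: r_coset_def)
qed

text \<open>The case k = 1 of \<open>trace_expanding\<close> for the conjugated automorphism, whose
  traces ignore the conjugation; m < 2^m avoids a logarithm.\<close>

lemma length_le_of_trace:
  assumes te: "trace_expanding n N B" and B: "\<And>i. det (B i) = 1"
    and \<theta>: "\<theta> \<in> iso (Fn n) (Fn n)" and i: "i < n" and g: "g \<in> carrier (Fn n)"
    and cyc: "cyclically_reduced (conj_Fn n g (\<theta> (gen i)))"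
    and T: "cmod (trace (wmat B (\<theta> (gen i)))) \<le> T"
  shows "length (conj_Fn n g (\<theta> (gen i))) \<le> nat \<lceil>(T + 1) ^ N\<rceil>"
proof -
  let ?w = "conj_Fn n g (\<theta> (gen i))"
  have "(\<lambda>x. conj_Fn n g x) \<circ> \<theta> \<in> iso (Fn n) (Fn n)" (is "?\<theta> \<in> _")
    by (rule iso_set_trans[OF \<theta> iso_conj[OF g]])
  moreover have w: "?\<theta> (gen i) = ?w" by simp
  ultimately have "2 ^ (length ?w * 1) \<le> (cmod (trace (mpow (wmat B ?w) 1)) + 1) ^ N"
    using te i cyc unfolding trace_expanding_def by (metis order_refl)
  also have "trace (mpow (wmat B ?w) 1) = trace (wmat B (\<theta> (gen i)))"
    using trace_mpow_conj_Fn[OF B g iso_gen_closed[OF \<theta> i], where k = 1] by simp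
  also have "(cmod (trace (wmat B (\<theta> (gen i)))) + 1) ^ N \<le> (T + 1) ^ N" using T by (intro power_mono) auto
  finally have "2 ^ length ?w \<le> (T + 1) ^ N" by simp
  moreover have "real (length ?w) < 2 ^ length ?w" by (rule of_nat_less_two_power)
  ultimately show ?thesis by linarith
qed

theorem theorem3p3:
  fixes n :: nat
  assumes "n \<ge> 2"
  shows "properly_discontinuous (Out (Fn n)) (Out_act n) (subtopology (char_variety n) (PS n))"
  unfolding properly_discontinuous_def
proof (intro allI impI)
  interpret F: group "Fn n" by (rule group_free_group)
  interpret A: group "AutFn n" by (rule F.AutoGroup)
  let ?Inn = "inner_aut (Fn n) ` carrier (Fn n)"
  fix C assume C: "compactin (subtopology (char_variety n) (PS n)) C"
  have CPS: "C \<subseteq> PS n" using compactin_subset_topspace[OF C] by auto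
  obtain N where N: "\<And>\<rho>. \<rho> \<in> Rep n \<Longrightarrow> primitive_stable n \<rho> \<Longrightarrow> char_of n \<rho> \<in> C \<Longrightarrow> trace_expanding n N (lift n \<rho>)"
    using uniform_trace_expanding[OF assms C] by blast
  have "\<exists>M. \<forall>\<xi>\<in>C. cmod (all_traces n \<xi> u) \<le> M" for u
  proof -
    have "compact ((\<lambda>f. f u) ` all_traces n ` C)"
      by (rule compact_continuous_image[OF continuous_on_subset[OF continuous_on_product_coordinates] compact_all_traces[OF C]]) simp
    then show ?thesis using compact_imp_bounded by (fastforce simp: bounded_iff)
  qed
  then obtain M where M: "\<And>\<xi> u. \<xi> \<in> C \<Longrightarrow> cmod (all_traces n \<xi> u) \<le> M u" by metis
  \<comment> \<open>\<open>U\<close> contains the elements that \<open>short_conjugate\<close> asks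
    about. \<open>M\<close> bounds squared traces, hence the root in \<open>T\<close>.\<close>
  define U where "U = gen ` {..<n} \<union> (\<lambda>(i, j). gen i \<otimes>\<^bsub>Fn n\<^esub> gen j) ` ({..<n} \<times> {..<n})"
  define T where "T = sqrt (Max (M ` U))"
  define R where "R = nat \<lceil>(T + 1) ^ N\<rceil>"
  have "{\<psi> \<in> carrier (Out (Fn n)). Out_act n \<psi> ` C \<inter> C \<noteq> {}} \<subseteq>
     (\<lambda>\<eta>. ?Inn #>\<^bsub>AutFn n\<^esub> inv\<^bsub>AutFn n\<^esub> \<eta>) ` {\<eta> \<in> auto (Fn n). \<forall>i<n. length (\<eta> (gen i)) \<le> R}"
  proof
    fix \<psi> assume "\<psi> \<in> {\<psi> \<in> carrier (Out (Fn n)). Out_act n \<psi> ` C \<inter> C \<noteq> {}}"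
    then obtain \<xi> where \<psi>: "\<psi> \<in> carrier (Out (Fn n))" and \<xi>: "\<xi> \<in> C" "Out_act n \<psi> \<xi> \<in> C" by auto
    obtain \<phi> where \<phi>: "\<phi> \<in> auto (Fn n)" and \<psi>\<phi>: "\<psi> = ?Inn #>\<^bsub>AutFn n\<^esub> \<phi>"
      using \<psi> by (auto simp: Out_def FactGroup_def RCOSETS_def carrier_AutoGroup)
    have \<phi>\<psi>: "\<phi> \<in> \<psi>"
      unfolding \<psi>\<phi> using \<phi> subgroup_inner_aut by (intro A.rcos_self) (auto simp: carrier_AutoGroup)
    obtain \<rho> where \<rho>: "\<rho> \<in> Rep n" "primitive_stable n \<rho>" "\<xi> = char_of n \<rho>" using \<xi>(1) CPS by (auto simp: PS_def)
    define \<theta> where "\<theta> = inv\<^bsub>AutFn n\<^esub> \<phi>"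
    have \<theta>a: "\<theta> \<in> auto (Fn n)" unfolding \<theta>_def by (rule inv_AutoGroup_auto[OF \<phi>])
    then have \<theta>: "\<theta> \<in> iso (Fn n) (Fn n)" "\<theta> \<in> hom (Fn n) (Fn n)" by (auto simp: auto_Fn_iff iso_def)
    have te: "trace_expanding n N (lift n \<rho>)" using N[OF \<rho>(1,2)] \<xi>(1) \<rho>(3) by simp
    \<comment> \<open>\<rho> has expanding traces because \<xi> lies in \<open>C\<close>. The trace
      bound comes from the other point of \<open>C\<close>: the squared trace of
      \<open>Out_act n \<psi> \<xi>\<close> at u is that of \<rho> at \<theta> u.\<close>
    have tr: "cmod (trace (wmat (lift n \<rho>) (\<theta> u))) \<le> T" if u: "u \<in> U" for u
    proof -
      have uc: "u \<in> carrier (Fn n)" using u by (auto simp: U_def)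
      then have \<theta>u: "\<theta> u \<in> carrier (Fn n)" using \<theta>(2) by (auto simp: hom_def)
      have r': "compose (carrier (Fn n)) \<rho> \<theta> \<in> Rep n" by (rule compose_Rep[OF \<rho>(1) \<theta>(2)])
      have "Out_act n \<psi> \<xi> = char_of n (compose (carrier (Fn n)) \<rho> \<theta>)"
        unfolding \<rho>(3) \<theta>_def by (rule Out_act_char_of[OF \<psi> \<phi>\<psi> \<rho>(1)])
      then have "all_traces n (Out_act n \<psi> \<xi>) u = (trace (psl_rep (\<rho> (\<theta> u))))\<^sup>2"
        using uc r' trace_sq_invariant[OF uc]
        by (simp add: all_traces_def char_of_def) (simp add: trace_sq_def compose_eq)
      then have "(cmod (trace (wmat (lift n \<rho>) (\<theta> u))))\<^sup>2 \<le> M u"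
        using M[OF \<xi>(2), of u] trace_psl_rep[OF \<rho>(1) \<theta>u] by (simp add: norm_power)
      also have "M u \<le> Max (M ` U)" using u by (intro Max_ge) (auto simp: U_def)
      finally show ?thesis unfolding T_def by (rule real_le_rsqrt)
    qed
    have "\<exists>g\<in>carrier (Fn n). \<forall>i<n. length (conj_Fn n g (\<theta> (gen i))) \<le> R"
    proof (rule short_conjugate[OF \<theta>(2)])
      fix g i assume g: "g \<in> carrier (Fn n)" and i: "i < n"
        and cyc: "cyclically_reduced (conj_Fn n g (\<theta> (gen i)))"
      show "length (conj_Fn n g (\<theta> (gen i))) \<le> R"
        unfolding R_def using i by (intro length_le_of_trace[OF te det_lift[OF \<rho>(1)] \<theta>(1) i g cyc] tr) (auto simp: U_def)
    next
      fix g i j assume g: "g \<in> carrier (Fn n)" and ij: "i < n" "j < n" "i \<noteq> j"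
        and cyc: "cyclically_reduced (conj_Fn n g (\<theta> (gen i \<otimes>\<^bsub>Fn n\<^esub> gen j)))"
      \<comment> \<open>A transvection exhibits the product of two distinct generators as the image
        of one generator, so the length bound applies to it with \<theta> composed with
        \<nu>.\<close>
      obtain \<nu> where \<nu>: "\<nu> \<in> iso (Fn n) (Fn n)" "\<nu> (gen i) = gen i \<otimes>\<^bsub>Fn n\<^esub> [(j, True)]"
        using iso_transvection[OF ij] by blast
      have val: "(\<theta> \<circ> \<nu>) (gen i) = \<theta> (gen i \<otimes>\<^bsub>Fn n\<^esub> gen j)" using \<nu>(2) by (simp add: gen_def)
      have "cmod (trace (wmat (lift n \<rho>) ((\<theta> \<circ> \<nu>) (gen i)))) \<le> T"
        unfolding val using ij by (intro tr) (auto simp: U_def)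
      from length_le_of_trace[OF te det_lift[OF \<rho>(1)] iso_set_trans[OF \<nu>(1) \<theta>(1)] ij(1) g _ this]
      show "length (conj_Fn n g (\<theta> (gen i \<otimes>\<^bsub>Fn n\<^esub> gen j))) \<le> R"
        unfolding val R_def using cyc by simp
    qed
    then obtain g where g: "g \<in> carrier (Fn n)" "\<And>i. i < n \<Longrightarrow> length (conj_Fn n g (\<theta> (gen i))) \<le> R"
      by blast
    define \<eta> where "\<eta> = inner_aut (Fn n) g \<otimes>\<^bsub>AutFn n\<^esub> \<theta>"
    have \<eta>a: "\<eta> \<in> auto (Fn n)"
      unfolding \<eta>_def using A.m_closed[of "inner_aut (Fn n) g" \<theta>] \<theta>a inner_aut_auto[OF g(1)] by (simp add: carrier_AutoGroup)
    have \<eta>gen: "\<eta> (gen i) = conj_Fn n g (\<theta> (gen i))" if "i < n" for i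
      using that iso_gen_closed[OF \<theta>(1) that] inner_aut_auto[OF g(1)] \<theta>a
      by (simp add: \<eta>_def mult_AutoGroup compose_eq inner_aut_def)
    have "inv\<^bsub>AutFn n\<^esub> \<eta> \<in> ?Inn #>\<^bsub>AutFn n\<^esub> \<phi>"
      unfolding \<eta>_def \<theta>_def by (rule inv_conj_in_coset[OF \<phi> g(1)])
    then have "\<psi> = ?Inn #>\<^bsub>AutFn n\<^esub> inv\<^bsub>AutFn n\<^esub> \<eta>"
      unfolding \<psi>\<phi> using \<phi> subgroup_inner_aut by (intro A.repr_independence) (auto simp: carrier_AutoGroup)
    moreover have "\<eta> \<in> {\<eta> \<in> auto (Fn n). \<forall>i<n. length (\<eta> (gen i)) \<le> R}" using \<eta>a \<eta>gen g(2) by simp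
    ultimately show "\<psi> \<in> (\<lambda>\<eta>. ?Inn #>\<^bsub>AutFn n\<^esub> inv\<^bsub>AutFn n\<^esub> \<eta>) `
        {\<eta> \<in> auto (Fn n). \<forall>i<n. length (\<eta> (gen i)) \<le> R}" by blast
  qed
  then show "finite {\<psi> \<in> carrier (Out (Fn n)). Out_act n \<psi> ` C \<inter> C \<noteq> {}}"
    using finite_short_automorphisms by (rule finite_surj[rotated])
qed

end
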